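(* (i) Suppose that for every $d\ge 1$, every homogeneous ideal in $H^2_d$ that is generated by quadratic polynomials is $p$-essentially normal for all $p>d$. Then for all $d,r\ge 1$, every homogeneous submodule of $H^2_d\otimes\mathbb{C}^r$ that is generated by linear polynomials is $p$-essentially normal for all $p>d+r$. (ii) Similarly, suppose that for every $d\ge 1$, every homogeneous ideal in $H^2_d$ that is generated by quadratic polynomials is essentially normal. Then for all $d,r\ge 1$, every homogeneous submodule of $H^2_d\otimes\mathbb{C}^r$ that is generated by linear polynomials is essentially normal.
   Context: Let $\mathcal{A}_d=\mathbb{C}[z_1,\dots,z_d]$. The $H^2$ inner product on $\mathcal{A}_d$ is defined by declaring distinct monomials orthogonal and $\|z^\alpha\|^2=\frac{\alpha_1!\cdots\alpha_d!}{|\alpha|!}$. $H^2_d$ is the Hilbert space completion, and $H^2_d\otimes\mathbb{C}^r$ is the Hilbert space tensor product. A homogeneous (graded) submodule of $H^2_d\otimes\mathbb{C}^r$ generated by a set $F$ of homogeneous polynomials in $\mathcal{A}_d\otimes\mathbb{C}^r$ is the closure in $H^2_d\otimes\mathbb{C}^r$ of the $\mathcal{A}_d$-submodule of $\mathcal{A}_d\otimes\mathbb{C}^r$ generated by $F$; when $r=1$ it is called a homogeneous ideal in $H^2_d$. "Quadratic polynomials" are homogeneous scalar polynomials of degree 2. "Linear polynomials" in $\mathcal{A}_d\otimes\mathbb{C}^r$ are homogeneous vector-valued polynomials of degree 1, i.e. $\sum_{i,j}a_{ij}z_i\otimes v_j$ with $\{v_j\}$ a basis of $\mathbb{C}^r$.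 $Z_i$ is the (bounded) operator of multiplication by $z_i$ on $H^2_d\otimes\mathbb{C}^r$. For a homogeneous submodule $M$ put $A_i=Z_i|_M$, $i=1,\dots,d$. $M$ is $p$-essentially normal if $[A_i,A_j^*]=A_iA_j^*-A_j^*A_i$ belongs to the Schatten class $\mathcal{L}^p$ for all $i,j$. $M$ is essentially normal if $[A_i,A_j^*]$ is compact for all $i,j$. *)

theory Defs
  imports "HOL-Analysis.Analysis" "HOL-Library.Poly_Mapping"
begin

section \<open>Polynomials\<close>

text \<open>
  Since \<open>d\<close> and \<open>r\<close> are quantified inside the statement, all numbers of variables and all ranks
  live in the same types: the variables are indexed by \<open>nat\<close>, with \<open>d\<close> variables \<open>z\<^sub>i\<close>, \<open>i < d\<close>,
  singled out by the carriers below, and likewise the basis vectors \<open>v\<^sub>j\<close>, \<open>j < r\<close>, of \<open>\<complex>\<^sup>r\<close>.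
\<close>

type_synonym mono = "nat \<Rightarrow>\<^sub>0 nat"
type_synonym mpoly = "mono \<Rightarrow>\<^sub>0 complex"
type_synonym vpoly = "nat \<Rightarrow>\<^sub>0 mpoly"

abbreviation lookup :: "('a \<Rightarrow>\<^sub>0 'b::zero) \<Rightarrow> 'a \<Rightarrow> 'b" where "lookup \<equiv> Poly_Mapping.lookup"
abbreviation keys :: "('a \<Rightarrow>\<^sub>0 'b::zero) \<Rightarrow> 'a set" where "keys \<equiv> Poly_Mapping.keys"

definition mdeg :: "mono \<Rightarrow> nat"
  where "mdeg \<alpha> = (\<Sum>i\<in>keys \<alpha>. lookup \<alpha> i)"

definition polys :: "nat \<Rightarrow> mpoly set"
  where "polys d = {a. \<forall>\<alpha>\<in>keys a. keys \<alpha> \<subseteq> {..<d}}"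

definition vpolys :: "nat \<Rightarrow> nat \<Rightarrow> vpoly set"
  where "vpolys d r = {f. keys f \<subseteq> {..<r} \<and> (\<forall>j. lookup f j \<in> polys d)}"

definition homogeneous_vpolys :: "nat \<Rightarrow> nat \<Rightarrow> nat \<Rightarrow> vpoly set"
  where "homogeneous_vpolys d r n =
    {f \<in> vpolys d r. \<forall>j. \<forall>\<alpha>\<in>keys (lookup f j). mdeg \<alpha> = n}"

definition vscale :: "mpoly \<Rightarrow> vpoly \<Rightarrow> vpoly"
  where "vscale a f = Poly_Mapping.map (\<lambda>b. a * b) f"

definition poly_submodule :: "nat \<Rightarrow> vpoly set \<Rightarrow> vpoly set"
  where "poly_submodule d F =
    {(\<Sum>f\<in>G. vscale (a f) f) |G a. finite G \<and> G \<subseteq> F \<and> (\<forall>f\<in>G. a f \<in> polys d)}"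


section \<open>The Hilbert space\<close>

definition weight :: "mono \<Rightarrow> real"
  where "weight \<alpha> = (\<Prod>i\<in>keys \<alpha>. fact (lookup \<alpha> i)) / fact (mdeg \<alpha>)"

lemma mdeg_superset: "finite S \<Longrightarrow> keys \<alpha> \<subseteq> S \<Longrightarrow> mdeg \<alpha> = (\<Sum>i\<in>S. lookup \<alpha> i)"
  unfolding mdeg_def by (rule sum.mono_neutral_left) (auto simp: in_keys_iff)

lemma weight_superset:
  "finite S \<Longrightarrow> keys \<alpha> \<subseteq> S \<Longrightarrow> weight \<alpha> = (\<Prod>i\<in>S. fact (lookup \<alpha> i)) / fact (\<Sum>i\<in>S. lookup \<alpha> i)"
  unfolding weight_def mdeg_superset[symmetric]
  by (subst prod.mono_neutral_left[of S "keys \<alpha>"]) (auto simp: in_keys_iff mdeg_superset)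

lemma weight_pos: "weight \<alpha> > 0"
  unfolding weight_def by (auto intro!: divide_pos_pos prod_pos)

lemma weight_nonneg [simp]: "weight \<alpha> \<ge> 0"
  using weight_pos[of \<alpha>] by linarith

lemma weight_add_single:
  "weight (\<alpha> + Poly_Mapping.single i 1) = weight \<alpha> * (real (lookup \<alpha> i) + 1) / (real (mdeg \<alpha>) + 1)"
proof -
  define S where "S = insert i (keys \<alpha>)"
  define \<beta> where "\<beta> = \<alpha> + Poly_Mapping.single i 1"
  have S: "finite S" "keys \<alpha> \<subseteq> S" "i \<in> S" by (auto simp: S_def)
  have l: "lookup \<beta> k = (if k = i then Suc (lookup \<alpha> i) else lookup \<alpha> k)" for k
    by (auto simp: \<beta>_def lookup_add lookup_single)
  have S': "keys \<beta> \<subseteq> S"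
    using S by (auto simp: in_keys_iff l subset_iff split: if_splits)
  have s: "(\<Sum>k\<in>S. lookup \<beta> k) = Suc (\<Sum>k\<in>S. lookup \<alpha> k)"
    using S by (simp add: sum.remove[of S i] l)
  have p: "(\<Prod>k\<in>S. fact (lookup \<beta> k)) = (real (lookup \<alpha> i) + 1) * (\<Prod>k\<in>S. fact (lookup \<alpha> k))"
    using S by (simp add: prod.remove[of S i] l algebra_simps)
  show ?thesis
    unfolding \<beta>_def[symmetric] weight_superset[OF S(1) S'] weight_superset[OF S(1,2)]
      mdeg_superset[OF S(1,2)] s p
    by (simp add: field_simps)
qed

lemma lookup_le_mdeg: "lookup \<alpha> i \<le> mdeg \<alpha>"
  by (cases "i \<in> keys \<alpha>") (auto simp: mdeg_def in_keys_iff intro!: member_le_sum)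

lemma weight_add_single_le: "weight (\<alpha> + Poly_Mapping.single i 1) \<le> weight \<alpha>"
  unfolding weight_add_single
  using mult_left_mono[of "real (lookup \<alpha> i) + 1" "real (mdeg \<alpha>) + 1" "weight \<alpha>"] lookup_le_mdeg[of \<alpha> i]
  by (simp add: divide_le_eq)

text \<open>
  A vector is the family of its coefficients with respect to the orthogonal vectors
  \<open>z\<^sup>\<alpha> \<otimes> v\<^sub>j\<close>, indexed by the pairs \<open>(\<alpha>, j)\<close>, where \<open>\<parallel>z\<^sup>\<alpha> \<otimes> v\<^sub>j\<parallel>\<^sup>2 = weight \<alpha>\<close>.
  The type contains every \<open>H\<^sup>2\<^sub>d \<otimes> \<complex>\<^sup>r\<close> as a closed subspace, see \<open>H2\<close> below.
\<close>

typedef h2 = "{f :: mono \<times> nat \<Rightarrow> complex. (\<lambda>k. weight (fst k) * (cmod (f k))\<^sup>2) summable_on UNIV}"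
  morphisms h2_coeff Abs_h2
  by (intro exI[of _ "\<lambda>_. 0"]) simp

setup_lifting type_definition_h2

lemma h2_summable: "(\<lambda>k. weight (fst k) * (cmod (h2_coeff f k))\<^sup>2) summable_on UNIV"
  using h2_coeff[of f] by simp

lemma norm_sq_add_le: "(norm (a + b :: 'a::real_normed_vector))\<^sup>2 \<le> 2 * (norm a)\<^sup>2 + 2 * (norm b)\<^sup>2"
proof -
  have "(norm (a + b))\<^sup>2 \<le> (norm a + norm b)\<^sup>2"
    by (intro power_mono norm_triangle_ineq) auto
  also have "\<dots> \<le> 2 * (norm a)\<^sup>2 + 2 * (norm b)\<^sup>2"
    using zero_le_power2[of "norm a - norm b"] by (simp add: power2_eq_square algebra_simps)
  finally show ?thesis .
qed

lemma sq_summable_add: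
  assumes "(\<lambda>k. weight (fst k) * (cmod (f k))\<^sup>2) summable_on UNIV"
    and "(\<lambda>k. weight (fst k) * (cmod (g k))\<^sup>2) summable_on UNIV"
  shows "(\<lambda>k. weight (fst k) * (cmod (f k + g k))\<^sup>2) summable_on UNIV"
proof (rule summable_on_comparison_test)
  show "(\<lambda>k. 2 * (weight (fst k) * (cmod (f k))\<^sup>2) + 2 * (weight (fst k) * (cmod (g k))\<^sup>2)) summable_on UNIV"
    by (intro summable_on_add summable_on_cmult_right assms)
  show "weight (fst k) * (cmod (f k + g k))\<^sup>2
      \<le> 2 * (weight (fst k) * (cmod (f k))\<^sup>2) + 2 * (weight (fst k) * (cmod (g k))\<^sup>2)" for k
    using mult_left_mono[OF norm_sq_add_le[of "f k" "g k"] weight_nonneg[of "fst k"]]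
    by (simp add: algebra_simps)
qed auto

lemma sq_summable_scale:
  assumes "(\<lambda>k. weight (fst k) * (cmod (f k))\<^sup>2) summable_on UNIV"
  shows "(\<lambda>k. weight (fst k) * (cmod (c * f k))\<^sup>2) summable_on UNIV"
  using summable_on_cmult_right[OF assms, of "(cmod c)\<^sup>2"]
  by (simp add: norm_mult power_mult_distrib algebra_simps)

instantiation h2 :: real_vector
begin

lift_definition zero_h2 :: h2 is "\<lambda>_. 0" by simp
lift_definition plus_h2 :: "h2 \<Rightarrow> h2 \<Rightarrow> h2" is "\<lambda>f g k. f k + g k"
  by (rule sq_summable_add)
lift_definition uminus_h2 :: "h2 \<Rightarrow> h2" is "\<lambda>f k. - f k" by simp
definition minus_h2 :: "h2 \<Rightarrow> h2 \<Rightarrow> h2" where "minus_h2 f g = f + - g"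
lift_definition scaleR_h2 :: "real \<Rightarrow> h2 \<Rightarrow> h2" is "\<lambda>c f k. complex_of_real c * f k"
  by (rule sq_summable_scale)

instance
  by standard ((unfold minus_h2_def)?; transfer; simp add: fun_eq_iff algebra_simps)+

end

lift_definition scaleC :: "complex \<Rightarrow> h2 \<Rightarrow> h2" (infixr "*\<^sub>C" 75) is "\<lambda>c f k. c * f k"
  by (rule sq_summable_scale)

interpretation h2: vector_space scaleC
  by standard (transfer; simp add: fun_eq_iff algebra_simps)+

definition cinner :: "h2 \<Rightarrow> h2 \<Rightarrow> complex"
  where "cinner f g = (\<Sum>\<^sub>\<infinity>k. of_real (weight (fst k)) * h2_coeff f k * cnj (h2_coeff g k))"

lemma cinner_summable:
  "(\<lambda>k. of_real (weight (fst k)) * h2_coeff f k * cnj (h2_coeff g k)) summable_on UNIV"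
proof (rule summable_on_iff_abs_summable_on_complex[THEN iffD2],
    rule Infinite_Sum.abs_summable_on_comparison_test')
  show "(\<lambda>k. weight (fst k) * (cmod (h2_coeff f k))\<^sup>2 + weight (fst k) * (cmod (h2_coeff g k))\<^sup>2)
    summable_on UNIV"
    by (intro summable_on_add h2_summable)
  fix k
  have "cmod (h2_coeff f k) * cmod (h2_coeff g k) \<le> (cmod (h2_coeff f k))\<^sup>2 + (cmod (h2_coeff g k))\<^sup>2"
    using sum_squares_bound[of "cmod (h2_coeff f k)" "cmod (h2_coeff g k)"]
      mult_nonneg_nonneg[OF norm_ge_zero[of "h2_coeff f k"] norm_ge_zero[of "h2_coeff g k"]]
    by linarith
  from mult_left_mono[OF this weight_nonneg[of "fst k"]]
  show "cmod (of_real (weight (fst k)) * h2_coeff f k * cnj (h2_coeff g k))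
    \<le> weight (fst k) * (cmod (h2_coeff f k))\<^sup>2 + weight (fst k) * (cmod (h2_coeff g k))\<^sup>2"
    by (simp add: norm_mult algebra_simps)
qed

lemma cinner_add_left: "cinner (f + g) h = cinner f h + cinner g h"
  unfolding cinner_def
  by (subst infsum_add[symmetric, OF cinner_summable cinner_summable])
     (simp add: plus_h2.rep_eq algebra_simps)

lemma cinner_scaleC_left: "cinner (c *\<^sub>C f) g = c * cinner f g"
  unfolding cinner_def infsum_cmult_right'[symmetric] scaleC.rep_eq by (simp only: ac_simps)

lemma cinner_commute: "cinner f g = cnj (cinner g f)"
  unfolding cinner_def infsum_cnj[symmetric] by (intro infsum_cong) simp

lemma scaleR_scaleC: "c *\<^sub>R f = of_real c *\<^sub>C f"
  by transfer simp

lemma cinner_self: "cinner f f = of_real (\<Sum>\<^sub>\<infinity>k. weight (fst k) * (cmod (h2_coeff f k))\<^sup>2)"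
proof -
  have "of_real (weight (fst k)) * h2_coeff f k * cnj (h2_coeff f k)
      = of_real (weight (fst k) * (cmod (h2_coeff f k))\<^sup>2)" for k
    unfolding of_real_mult complex_norm_square by (simp only: mult.assoc)
  then show ?thesis
    unfolding cinner_def
    by (simp only:) (intro infsumI has_sum_of_real has_sum_infsum h2_summable)
qed

instantiation h2 :: real_inner
begin

definition inner_h2 :: "h2 \<Rightarrow> h2 \<Rightarrow> real" where "inner_h2 f g = Re (cinner f g)"
definition norm_h2 :: "h2 \<Rightarrow> real" where "norm_h2 f = sqrt (inner f f)"
definition sgn_h2 :: "h2 \<Rightarrow> h2" where "sgn_h2 f = f /\<^sub>R norm f"
definition dist_h2 :: "h2 \<Rightarrow> h2 \<Rightarrow> real" where "dist_h2 f g = norm (f - g)"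
definition uniformity_h2 :: "(h2 \<times> h2) filter"
  where "uniformity_h2 = (INF e\<in>{0<..}. principal {(f, g). dist f g < e})"
definition open_h2 :: "h2 set \<Rightarrow> bool"
  where "open_h2 U = (\<forall>x\<in>U. eventually (\<lambda>(x', y). x' = x \<longrightarrow> y \<in> U) uniformity)"

instance
proof
  fix f g h :: h2 and c :: real
  show "inner f g = inner g f"
    unfolding inner_h2_def by (subst cinner_commute) simp
  show "inner (f + g) h = inner f h + inner g h"
    by (simp add: inner_h2_def cinner_add_left)
  show "inner (c *\<^sub>R f) g = c * inner f g"
    by (simp add: inner_h2_def scaleR_scaleC cinner_scaleC_left)
  show "0 \<le> inner f f"
    by (simp add: inner_h2_def cinner_self infsum_nonneg)
  show "inner f f = 0 \<longleftrightarrow> f = 0"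
  proof
    assume "inner f f = 0"
    then have "(\<Sum>\<^sub>\<infinity>k. weight (fst k) * (cmod (h2_coeff f k))\<^sup>2) \<le> 0"
      by (simp add: inner_h2_def cinner_self)
    from nonneg_infsum_le_0D[OF this h2_summable]
    have "weight (fst k) * (cmod (h2_coeff f k))\<^sup>2 = 0" for k by simp
    then have "h2_coeff f k = 0" for k
      using weight_pos[of "fst k"] by (metis less_irrefl mult_eq_0_iff norm_eq_zero power_eq_0_iff)
    then show "f = 0"
      by (simp add: h2_coeff_inject[symmetric] zero_h2.rep_eq fun_eq_iff)
  qed (simp add: inner_h2_def cinner_def zero_h2.rep_eq)
qed (fact norm_h2_def sgn_h2_def dist_h2_def uniformity_h2_def open_h2_def)+

end

lemma norm_h2_sq: "(norm f)\<^sup>2 = (\<Sum>\<^sub>\<infinity>k. weight (fst k) * (cmod (h2_coeff f k))\<^sup>2)"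
  unfolding power2_norm_eq_inner inner_h2_def cinner_self by simp

lemma sum_le_norm_h2_sq:
  "finite S \<Longrightarrow> (\<Sum>k\<in>S. weight (fst k) * (cmod (h2_coeff f k))\<^sup>2) \<le> (norm f)\<^sup>2"
  unfolding norm_h2_sq by (rule finite_sum_le_infsum[OF h2_summable]) auto

lemma h2_coeff_diff: "h2_coeff (f - g) k = h2_coeff f k - h2_coeff g k"
  unfolding minus_h2_def plus_h2.rep_eq uminus_h2.rep_eq by simp

instance h2 :: complete_space
proof
  fix X :: "nat \<Rightarrow> h2"
  assume X: "Cauchy X"
  have "Cauchy (\<lambda>n. h2_coeff (X n) k)" for k
  proof (rule metric_CauchyI)
    fix e :: real
    assume "e > 0"
    define w where "w = sqrt (weight (fst k))"
    have w: "w > 0" "weight (fst k) = w\<^sup>2" using weight_pos[of "fst k"] by (auto simp: w_def)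
    have "e * w > 0" using \<open>e > 0\<close> w by simp
    from metric_CauchyD[OF X this] obtain N
      where N: "\<And>m n. m \<ge> N \<Longrightarrow> n \<ge> N \<Longrightarrow> dist (X m) (X n) < e * w" by blast
    have "dist (h2_coeff (X m) k) (h2_coeff (X n) k) < e" if "m \<ge> N" "n \<ge> N" for m n
    proof -
      have "(w * cmod (h2_coeff (X m - X n) k))\<^sup>2 \<le> (norm (X m - X n))\<^sup>2"
        using sum_le_norm_h2_sq[of "{k}" "X m - X n"] by (simp add: w(2) power_mult_distrib)
      then have "w * cmod (h2_coeff (X m - X n) k) \<le> norm (X m - X n)"
        by (rule power2_le_imp_le) simp
      also have "\<dots> < w * e" using N[OF that] by (simp add: dist_norm mult.commute)
      finally show ?thesis using w by (simp add: dist_norm h2_coeff_diff)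
    qed
    then show "\<exists>N. \<forall>m\<ge>N. \<forall>n\<ge>N. dist (h2_coeff (X m) k) (h2_coeff (X n) k) < e" by blast
  qed
  then have "\<forall>k. \<exists>l. (\<lambda>n. h2_coeff (X n) k) \<longlonglongrightarrow> l"
    using Cauchy_convergent convergent_def by blast
  from choice[OF this] obtain l where l: "\<And>k. (\<lambda>n. h2_coeff (X n) k) \<longlonglongrightarrow> l k" by blast
  have tail: "\<exists>N. \<forall>n\<ge>N. \<forall>S. finite S \<longrightarrow>
      (\<Sum>k\<in>S. weight (fst k) * (cmod (h2_coeff (X n) k - l k))\<^sup>2) \<le> e\<^sup>2" if "e > 0" for e
  proof -
    from metric_CauchyD[OF X that] obtain N
      where N: "\<And>m n. m \<ge> N \<Longrightarrow> n \<ge> N \<Longrightarrow> dist (X m) (X n) < e" by blast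
    have "(\<Sum>k\<in>S. weight (fst k) * (cmod (h2_coeff (X n) k - l k))\<^sup>2) \<le> e\<^sup>2"
      if "n \<ge> N" "finite S" for n S
    proof (rule tendsto_upperbound)
      show "(\<lambda>m. \<Sum>k\<in>S. weight (fst k) * (cmod (h2_coeff (X n) k - h2_coeff (X m) k))\<^sup>2)
          \<longlonglongrightarrow> (\<Sum>k\<in>S. weight (fst k) * (cmod (h2_coeff (X n) k - l k))\<^sup>2)"
        by (intro tendsto_intros l)
      show "\<forall>\<^sub>F m in sequentially.
          (\<Sum>k\<in>S. weight (fst k) * (cmod (h2_coeff (X n) k - h2_coeff (X m) k))\<^sup>2) \<le> e\<^sup>2"
        unfolding eventually_sequentially
      proof (intro exI allI impI)
        fix m
        assume "m \<ge> N"
        have "(\<Sum>k\<in>S. weight (fst k) * (cmod (h2_coeff (X n) k - h2_coeff (X m) k))\<^sup>2)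
            \<le> (norm (X n - X m))\<^sup>2"
          using sum_le_norm_h2_sq[OF \<open>finite S\<close>, of "X n - X m"] by (simp add: h2_coeff_diff)
        also have "\<dots> \<le> e\<^sup>2"
          using N[OF \<open>n \<ge> N\<close> \<open>m \<ge> N\<close>] by (intro power_mono) (auto simp: dist_norm)
        finally show "(\<Sum>k\<in>S. weight (fst k) * (cmod (h2_coeff (X n) k - h2_coeff (X m) k))\<^sup>2) \<le> e\<^sup>2" .
      qed
    qed simp
    then show ?thesis by blast
  qed
  have sm: "(\<lambda>k. weight (fst k) * (cmod (l k))\<^sup>2) summable_on UNIV"
  proof -
    from tail[of 1] obtain N where N: "\<And>S. finite S \<Longrightarrow>
      (\<Sum>k\<in>S. weight (fst k) * (cmod (h2_coeff (X N) k - l k))\<^sup>2) \<le> 1" by auto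
    have "(\<lambda>k. weight (fst k) * (cmod (h2_coeff (X N) k - l k))\<^sup>2) summable_on UNIV"
      by (rule nonneg_bdd_above_summable_on) (auto intro!: bdd_aboveI2[where M = 1] N)
    from sq_summable_add[OF h2_summable[of "X N"] sq_summable_scale[OF this, of "-1"]]
    show ?thesis by simp
  qed
  define L where "L = Abs_h2 l"
  have L: "h2_coeff L = l" using sm by (simp add: L_def Abs_h2_inverse)
  have "X \<longlonglongrightarrow> L"
  proof (rule metric_LIMSEQ_I)
    fix e :: real
    assume "e > 0"
    then obtain N where N: "\<And>n S. n \<ge> N \<Longrightarrow> finite S \<Longrightarrow>
      (\<Sum>k\<in>S. weight (fst k) * (cmod (h2_coeff (X n) k - l k))\<^sup>2) \<le> (e / 2)\<^sup>2"
      using tail[of "e / 2"] by auto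
    have "dist (X n) L < e" if "n \<ge> N" for n
    proof -
      have "(norm (X n - L))\<^sup>2 \<le> (e / 2)\<^sup>2"
        unfolding norm_h2_sq
        by (rule infsum_le_finite_sums[OF h2_summable]) (use N[OF that] in \<open>simp add: h2_coeff_diff L\<close>)
      then have "norm (X n - L) \<le> e / 2"
        by (rule power2_le_imp_le) (use \<open>e > 0\<close> in simp)
      then show ?thesis using \<open>e > 0\<close> by (simp add: dist_norm)
    qed
    then show "\<exists>N. \<forall>n\<ge>N. dist (X n) L < e" by blast
  qed
  then show "convergent X" by (rule convergentI)
qed

lemma of_vpoly_summable:
  "(\<lambda>k. weight (fst k) * (cmod (lookup (lookup f (snd k)) (fst k)))\<^sup>2) summable_on UNIV"
proof -
  let ?h = "\<lambda>k. weight (fst k) * (cmod (lookup (lookup f (snd k)) (fst k)))\<^sup>2"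
  let ?S = "\<Union>j\<in>keys f. (\<lambda>\<alpha>. (\<alpha>, j)) ` keys (lookup f j)"
  have z: "?h k = 0" if "k \<notin> ?S" for k
  proof (cases k)
    case (Pair \<alpha> j)
    have "lookup (lookup f j) \<alpha> = 0"
    proof (cases "j \<in> keys f")
      case True
      with that Pair show ?thesis by (auto simp: in_keys_iff image_iff)
    qed (simp add: in_keys_iff)
    then show ?thesis by (simp add: Pair)
  qed
  have "?h summable_on ?S" by (rule summable_on_finite) simp
  also have "?h summable_on ?S \<longleftrightarrow> ?h summable_on UNIV"
    by (rule summable_on_cong_neutral) (use z in auto)
  finally show ?thesis .
qed

definition of_vpoly :: "vpoly \<Rightarrow> h2"
  where "of_vpoly f = Abs_h2 (\<lambda>k. lookup (lookup f (snd k)) (fst k))"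

lemma h2_coeff_of_vpoly: "h2_coeff (of_vpoly f) (\<alpha>, j) = lookup (lookup f j) \<alpha>"
  using of_vpoly_summable[of f] by (simp add: of_vpoly_def Abs_h2_inverse)

definition H2 :: "nat \<Rightarrow> nat \<Rightarrow> h2 set"
  where "H2 d r = closure (of_vpoly ` vpolys d r)"

lemma polys_mult: "a \<in> polys d \<Longrightarrow> b \<in> polys d \<Longrightarrow> a * b \<in> polys d"
proof -
  assume ab: "a \<in> polys d" "b \<in> polys d"
  have "keys \<gamma> \<subseteq> {..<d}" if "\<gamma> \<in> keys (a * b)" for \<gamma>
  proof -
    from that keys_mult[of a b] obtain \<alpha> \<beta>
      where *: "\<gamma> = \<alpha> + \<beta>" "\<alpha> \<in> keys a" "\<beta> \<in> keys b" by blast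
    then have "keys \<alpha> \<subseteq> {..<d}" "keys \<beta> \<subseteq> {..<d}" using ab by (simp_all add: polys_def)
    with keys_add[of \<alpha> \<beta>] show ?thesis unfolding *(1) by (meson Un_least order_trans)
  qed
  then show ?thesis by (simp add: polys_def)
qed

lemma lookup_vscale: "lookup (vscale a f) j = a * lookup f j"
  by (simp add: vscale_def Poly_Mapping.map.rep_eq when_def)

lemma polys_sum: "(\<And>x. x \<in> X \<Longrightarrow> a x \<in> polys d) \<Longrightarrow> (\<Sum>x\<in>X. a x) \<in> polys d"
  unfolding polys_def using keys_sum[of a X] by (simp add: subset_iff) blast

lemma poly_submodule_subset:
  assumes "F \<subseteq> vpolys d r"
  shows "poly_submodule d F \<subseteq> vpolys d r"
proof
  fix g
  assume "g \<in> poly_submodule d F"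
  then obtain G a where g: "g = (\<Sum>f\<in>G. vscale (a f) f)" and G: "G \<subseteq> F" "\<forall>f\<in>G. a f \<in> polys d"
    unfolding poly_submodule_def by blast
  have l: "lookup g j = (\<Sum>f\<in>G. a f * lookup f j)" for j
    by (simp add: g lookup_sum lookup_vscale)
  have "lookup g j \<in> polys d" for j
    unfolding l using G assms by (intro polys_sum polys_mult) (auto simp: vpolys_def)
  moreover have "keys g \<subseteq> {..<r}"
  proof
    fix j
    assume "j \<in> keys g"
    then have "(\<Sum>f\<in>G. a f * lookup f j) \<noteq> 0" by (simp add: in_keys_iff l)
    then obtain f where "f \<in> G" "a f * lookup f j \<noteq> 0" by (rule sum.not_neutral_contains_not_neutral)
    then have "j \<in> keys f" "f \<in> vpolys d r" using G assms by (auto simp: in_keys_iff)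
    then show "j \<in> {..<r}" by (auto simp: vpolys_def)
  qed
  ultimately show "g \<in> vpolys d r" by (simp add: vpolys_def)
qed

text \<open>The closure may be taken in the whole type, since \<open>H2 d r\<close> is closed.\<close>

definition generated_submodule :: "nat \<Rightarrow> vpoly set \<Rightarrow> h2 set"
  where "generated_submodule d F = closure (of_vpoly ` poly_submodule d F)"

lemma generated_submodule_subset: "F \<subseteq> vpolys d r \<Longrightarrow> generated_submodule d F \<subseteq> H2 d r"
  unfolding generated_submodule_def H2_def
  by (intro closure_mono image_mono poly_submodule_subset)

text \<open>In coefficients, \<open>z\<^sub>i z\<^sup>\<alpha> = z\<^sup>\<beta>\<close> with \<open>\<beta> = \<alpha> + single i 1\<close>.\<close>

definition Z_coeff :: "nat \<Rightarrow> h2 \<Rightarrow> mono \<times> nat \<Rightarrow> complex"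
  where "Z_coeff i f k = (if lookup (fst k) i = 0 then 0
    else h2_coeff f (fst k - Poly_Mapping.single i 1, snd k))"

lemma Z_summable: "(\<lambda>k. weight (fst k) * (cmod (Z_coeff i f k))\<^sup>2) summable_on UNIV"
proof -
  let ?f = "h2_coeff f"
  let ?s = "\<lambda>k :: mono \<times> nat. (fst k + Poly_Mapping.single i 1, snd k)"
  let ?g = "\<lambda>k. weight (fst k) *
    (cmod (Z_coeff i f k))\<^sup>2"
  have gs: "?g (?s k) = weight (fst k + Poly_Mapping.single i 1) * (cmod (?f k))\<^sup>2" for k
    by (simp add: Z_coeff_def lookup_add)
  have "(?g \<circ> ?s) summable_on UNIV"
  proof (rule summable_on_comparison_test[OF h2_summable[of f]])
    show "(?g \<circ> ?s) k \<le> weight (fst k) * (cmod (?f k))\<^sup>2" for k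
      unfolding o_def gs by (rule mult_right_mono[OF weight_add_single_le]) simp
    show "0 \<le> (?g \<circ> ?s) k" for k
      unfolding o_def gs by simp
  qed
  moreover have "inj ?s" by (auto simp: inj_on_def)
  ultimately have "?g summable_on range ?s" by (simp add: summable_on_reindex)
  also have "?g summable_on range ?s \<longleftrightarrow> ?g summable_on UNIV"
  proof (rule summable_on_cong_neutral)
    fix k
    assume k: "k \<in> UNIV - range ?s"
    obtain \<alpha> j where kk: "k = (\<alpha>, j)" by (cases k)
    have "lookup \<alpha> i = 0"
    proof (rule ccontr)
      assume "lookup \<alpha> i \<noteq> 0"
      then have "\<alpha> = \<alpha> - Poly_Mapping.single i 1 + Poly_Mapping.single i 1"
        by (intro poly_mapping_eqI) (auto simp: lookup_add lookup_minus lookup_single when_def)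
      then have "k = ?s (\<alpha> - Poly_Mapping.single i 1, j)" by (simp add: kk)
      then show False using k by blast
    qed
    then show "?g k = 0" by (simp add: kk Z_coeff_def)
  qed auto
  finally show ?thesis .
qed

definition Z :: "nat \<Rightarrow> h2 \<Rightarrow> h2"
  where "Z i f = Abs_h2 (Z_coeff i f)"

lemma h2_coeff_Z: "h2_coeff (Z i f) = Z_coeff i f"
  using Z_summable[of i f] by (simp add: Z_def Abs_h2_inverse)

lemma Z_of_vpoly:
  "Z i (of_vpoly f) = of_vpoly (vscale (Poly_Mapping.single (Poly_Mapping.single i 1) 1) f)"
proof -
  let ?e = "Poly_Mapping.single i 1 :: mono"
  have "Z_coeff i (of_vpoly f) (\<alpha>, j) = lookup (Poly_Mapping.single ?e 1 * lookup f j) \<alpha>" for \<alpha> j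
  proof -
    have "lookup (Poly_Mapping.single ?e 1 * b) \<alpha>
        = (if lookup \<alpha> i = 0 then 0 else lookup b (\<alpha> - ?e))" for b :: mpoly
    proof -
      have dec: "\<alpha> = ?e + q \<longleftrightarrow> lookup \<alpha> i \<noteq> 0 \<and> q = \<alpha> - ?e" for q
      proof
        assume "\<alpha> = ?e + q"
        then show "lookup \<alpha> i \<noteq> 0 \<and> q = \<alpha> - ?e" by (simp add: lookup_add)
      next
        assume "lookup \<alpha> i \<noteq> 0 \<and> q = \<alpha> - ?e"
        then show "\<alpha> = ?e + q"
          by (intro poly_mapping_eqI) (auto simp: lookup_add lookup_minus lookup_single when_def)
      qed
      have "lookup (Poly_Mapping.single ?e 1 * b) \<alpha>
          = (\<Sum>l. (1 when ?e = l) * (\<Sum>q. lookup b q when \<alpha> = l + q))"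
        by (simp only: lookup_mult lookup_single)
      also have "\<dots> = (\<Sum>l. (\<Sum>q. lookup b q when \<alpha> = l + q) when l = ?e)"
        by (intro Sum_any.cong) (auto simp: when_def)
      also have "\<dots> = (\<Sum>q. lookup b q when \<alpha> = ?e + q)" by simp
      also have "\<dots> = (\<Sum>q. (lookup b q when lookup \<alpha> i \<noteq> 0) when q = \<alpha> - ?e)"
        unfolding dec by (intro Sum_any.cong) (auto simp: when_def)
      also have "\<dots> = (if lookup \<alpha> i = 0 then 0 else lookup b (\<alpha> - ?e))"
        by (simp add: when_def)
      finally show ?thesis .
    qed
    then show ?thesis by (simp add: Z_coeff_def h2_coeff_of_vpoly)
  qed
  then show ?thesis
    by (simp add: h2_coeff_inject[symmetric] fun_eq_iff h2_coeff_Z h2_coeff_of_vpoly lookup_vscale)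
qed


section \<open>Operators on a closed subspace\<close>

text \<open>
  An operator on a closed subspace \<open>M\<close> is a function \<open>T :: h2 \<Rightarrow> h2\<close> mapping \<open>M\<close> to \<open>M\<close>, of which
  only the values on \<open>M\<close> are relevant; its adjoint is the adjoint as an operator on \<open>M\<close>.
\<close>

definition adj_on :: "h2 set \<Rightarrow> (h2 \<Rightarrow> h2) \<Rightarrow> h2 \<Rightarrow> h2"
  where "adj_on M T y = (THE w. w \<in> M \<and> (\<forall>x\<in>M. cinner (T x) y = cinner x w))"

definition compact_on :: "h2 set \<Rightarrow> (h2 \<Rightarrow> h2) \<Rightarrow> bool"
  where "compact_on M T \<longleftrightarrow> compact (closure (T ` (M \<inter> cball 0 1)))"

text \<open>
  The singular values of \<open>T\<close> are the square roots of the eigenvalues of \<open>T\<^sup>*T\<close>; for compact \<open>T\<close>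
  every nonzero one has finite multiplicity.
\<close>

definition singular_mult :: "h2 set \<Rightarrow> (h2 \<Rightarrow> h2) \<Rightarrow> real \<Rightarrow> nat"
  where "singular_mult M T s = h2.dim {x \<in> M. adj_on M T (T x) = of_real (s\<^sup>2) *\<^sub>C x}"

definition schatten_on :: "real \<Rightarrow> h2 set \<Rightarrow> (h2 \<Rightarrow> h2) \<Rightarrow> bool"
  where "schatten_on p M T \<longleftrightarrow>
    compact_on M T \<and> (\<lambda>s. real (singular_mult M T s) * s powr p) summable_on {0<..}"

text \<open>For \<open>A\<^sub>i\<close> the restriction of \<open>Z i\<close> to \<open>M\<close>, this is \<open>A\<^sub>i A\<^sub>j\<^sup>* - A\<^sub>j\<^sup>* A\<^sub>i\<close>.\<close>

definition cross_commutator :: "h2 set \<Rightarrow> nat \<Rightarrow> nat \<Rightarrow> h2 \<Rightarrow> h2"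
  where "cross_commutator M i j x = Z i (adj_on M (Z j) x) - adj_on M (Z j) (Z i x)"

definition p_essentially_normal :: "real \<Rightarrow> nat \<Rightarrow> h2 set \<Rightarrow> bool"
  where "p_essentially_normal p d M \<longleftrightarrow> (\<forall>i<d. \<forall>j<d. schatten_on p M (cross_commutator M i j))"

definition essentially_normal :: "nat \<Rightarrow> h2 set \<Rightarrow> bool"
  where "essentially_normal d M \<longleftrightarrow> (\<forall>i<d. \<forall>j<d. compact_on M (cross_commutator M i j))"

end

theory Submission
  imports Defs
begin

text \<open>
  Replacing \<open>z\<^sup>\<alpha> \<otimes> v\<^sub>j\<close> by the monomial \<open>z\<^sup>\<alpha> w\<^sub>j\<close>, where \<open>w\<^sub>j = z\<^bsub>d+j\<^esub>\<close> are \<open>r\<close> new variables, turns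
  linear polynomials with values in \<open>\<complex>\<^sup>r\<close> into quadratic polynomials in \<open>d + r\<close> variables. The part
  of bidegree \<open>(n, 1)\<close> of the ideal \<open>N\<close> which they generate is the image of the part of degree \<open>n\<close> of
  the given submodule \<open>M\<close>. On degree \<open>n\<close> the replacement map \<open>W\<close> multiplies inner products
  by \<open>1 / (n + 1)\<close>, it commutes with \<open>Z\<^sub>i\<close> for \<open>i < d\<close>, and it intertwines the adjoints up to the
  factor \<open>n / (n + 1)\<close>. Hence \<open>W\<close> intertwines the two cross-commutators up to an error of relative
  size at most \<open>2 / (n + 1)\<close> in degree \<open>n\<close>.

  All operators are block diagonal for the grading. Such an operator is compact iff the norms of its
  blocks tend to \<open>0\<close>, so compactness passes from \<open>N\<close> to \<open>M\<close>. For the Schatten class, evaluate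
  \<open>\<Sum>\<parallel>T e\<parallel>\<^sup>p\<close> along an orthonormal eigenbasis \<open>e\<close> of \<open>T\<^sup>*T\<close>. Since \<open>p > d + r \<ge> 2\<close>, Jensen's inequality bounds
  \<open>\<Sum>\<parallel>S g\<parallel>\<^sup>p\<close> along any orthonormal system \<open>g\<close> by the sum of the \<open>p\<close>-th powers of the singular values
  of \<open>S\<close>, and the errors contribute a constant times \<open>\<Sum>\<^sub>n r (n + 1)\<^sup>d (n + 1)\<^bsup>-p\<^esup>\<close>, which is finite.
\<close>

text \<open>The factor n/(n + 1) is the quotient of the scalings 1/(n + 1) and 1/n of
  \<open>W\<close> in two consecutive degrees, because the adjoint of \<open>Z i\<close> leads from
  degree n to degree n - 1. That it is correct for the adjoint taken in the whole of
  \<open>N\<close>, and not only for a compression to the image of \<open>W\<close>, rests on one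
  remark: a generator times a monomial containing a new variable has degree at least 2 in the new
  variables and is therefore orthogonal to that image.

  In general \<open>N\<close> is larger than the closure of its parts of bidegree (n, 1). The
  comparison is therefore asymmetric: estimates pass from \<open>N\<close> to \<open>M\<close>, and
  the orthonormal systems used in \<open>N\<close> may be incomplete.

  The Schatten class is given through multiplicities of eigenvalues. Every block is
  finite-dimensional, so eigenbases come from an extremal argument inside a block instead of a
  spectral theorem for compact operators. Jensen's inequality enters because \<open>W\<close> does
  not map eigenvectors for one commutator to eigenvectors for the other.

  The threshold d + r is the number of variables of the quadratic ideal; the sum of the errors asks
  for p > d + 1.\<close>

lemma h2_eqI: "(\<And>k. h2_coeff f k = h2_coeff g k) \<Longrightarrow> f = g"
  by (simp add: h2_coeff_inject[symmetric] fun_eq_iff)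

lemmas h2_coeff_simps = plus_h2.rep_eq scaleC.rep_eq zero_h2.rep_eq h2_coeff_diff

section \<open>Complex inner product: sesquilinearity, Cauchy-Schwarz, boundedness\<close>

lemma cinner_add_right: "cinner h (f + g) = cinner h f + cinner h g"
  using cinner_add_left[of f g h] by (metis cinner_commute complex_cnj_add)

lemma cinner_scaleC_right: "cinner f (c *\<^sub>C g) = cnj c * cinner f g"
  by (metis cinner_commute cinner_scaleC_left complex_cnj_mult)

lemma cinner_zero_left [simp]: "cinner 0 f = 0"
  using cinner_add_left[of 0 0 f] by simp

lemma cinner_zero_right [simp]: "cinner f 0 = 0"
  using cinner_add_right[of f 0 0] by simp

lemma cinner_diff_left: "cinner (f - g) h = cinner f h - cinner g h"
  using cinner_add_left[of "f - g" g h] by simp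

lemma cinner_diff_right: "cinner h (f - g) = cinner h f - cinner h g"
  using cinner_add_right[of h "f - g" g] by simp

lemma cinner_sum_left: "cinner (\<Sum>a\<in>A. f a) h = (\<Sum>a\<in>A. cinner (f a) h)"
  by (induction A rule: infinite_finite_induct) (simp_all add: cinner_add_left)

lemma cinner_sum_right: "cinner h (\<Sum>a\<in>A. f a) = (\<Sum>a\<in>A. cinner h (f a))"
  by (induction A rule: infinite_finite_induct) (simp_all add: cinner_add_right)

lemma cinner_self_norm: "cinner f f = of_real ((norm f)\<^sup>2)"
  by (simp add: cinner_self norm_h2_sq)

lemma norm_scaleC: "norm (c *\<^sub>C f) = cmod c * norm f"
proof -
  have "of_real ((norm (c *\<^sub>C f))\<^sup>2) = (of_real ((cmod c * norm f)\<^sup>2) :: complex)"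
    unfolding cinner_self_norm[symmetric] cinner_scaleC_left cinner_scaleC_right
    by (simp add: cinner_self_norm power_mult_distrib)
      (metis complex_norm_square mult.commute of_real_power)
  then have "(norm (c *\<^sub>C f))\<^sup>2 = (cmod c * norm f)\<^sup>2"
    using of_real_eq_iff by blast
  then show ?thesis by simp
qed

lemma cmod_cinner_commute: "cmod (cinner f g) = cmod (cinner g f)"
  by (metis cinner_commute complex_mod_cnj)

text \<open>The phase \<open>c\<close> rotates \<open>f\<close> so that the inner product becomes
  real and nonnegative; the real Cauchy-Schwarz inequality then applies.\<close>

lemma cmod_cinner_le: "cmod (cinner f g) \<le> norm f * norm g"
proof -
  define c where "c = cnj (sgn (cinner f g))"
  have "Re (c * cinner f g) = cmod (cinner f g)"
  proof (cases "cinner f g = 0")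
    case False
    have "c * cinner f g = of_real (cmod (cinner f g))"
      using False complex_norm_square[of "cinner f g"]
      by (simp add: c_def sgn_div_norm scaleR_conv_of_real field_simps power2_eq_square)
    then show ?thesis by simp
  qed simp
  moreover have "Re (c * cinner f g) \<le> norm (c *\<^sub>C f) * norm g"
    using norm_cauchy_schwarz[of "c *\<^sub>C f" g] by (simp add: inner_h2_def cinner_scaleC_left)
  moreover have "cmod c \<le> 1" by (simp add: c_def norm_sgn)
  then have "norm (c *\<^sub>C f) * norm g \<le> norm f * norm g"
    by (intro mult_right_mono) (auto simp: norm_scaleC mult_left_le_one_le)
  ultimately show ?thesis by linarith
qed

lemma norm_sq_add_orthogonal:
  assumes "cinner x y = 0"
  shows "(norm (x + y))\<^sup>2 = (norm x)\<^sup>2 + (norm y)\<^sup>2"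
  using assms by (simp add: power2_norm_eq_inner inner_add inner_commute[of y x]) (simp add: inner_h2_def)

lemma bounded_linear_cinner_left: "bounded_linear (\<lambda>x. cinner x y)"
  by (rule bounded_linear_intro[where K = "norm y"])
    (auto simp: cinner_add_left scaleR_scaleC cinner_scaleC_left scaleR_conv_of_real
      intro: cmod_cinner_le)

lemma bounded_linear_scaleC_right: "bounded_linear (scaleC c)"
  by (rule bounded_linear_intro[where K = "cmod c"])
    (auto simp: h2.scale_right_distrib scaleR_scaleC norm_scaleC mult.commute)

lemma bounded_linear_scaleC_left: "bounded_linear (\<lambda>c. scaleC c x)"
  by (rule bounded_linear_intro[where K = "norm x"])
    (auto simp: h2.scale_left_distrib scaleR_scaleC norm_scaleC scaleR_conv_of_real)

section \<open>Operators that relabel coefficients\<close>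

text \<open>The common form of the shifts \<open>Z i\<close>, the coordinate projections and the
  tensor map: each coefficient of the image is copied from at most one coefficient of the argument.
  The map \<open>h\<close> runs backwards, from the output index to the input index, with
  \<open>None\<close> for a zero coefficient.\<close>

definition reindex :: "(mono \<times> nat \<Rightarrow> (mono \<times> nat) option) \<Rightarrow> h2 \<Rightarrow> h2"
  where "reindex h f = Abs_h2 (\<lambda>k. case h k of None \<Rightarrow> 0 | Some k' \<Rightarrow> h2_coeff f k')"

text \<open>Injectivity means that no coefficient is copied twice, and the weights may grow by at
  most the factor \<open>C\<close>. Hence \<open>C\<close> bounds the square of the operator
  norm.\<close>

definition bounded_reindexing :: "real \<Rightarrow> (mono \<times> nat \<Rightarrow> (mono \<times> nat) option) \<Rightarrow> bool"
  where "bounded_reindexing C h \<longleftrightarrow> inj_on h (dom h) \<and>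
    (\<forall>k k'. h k = Some k' \<longrightarrow> weight (fst k) \<le> C * weight (fst k'))"

text \<open>Stated for finite sums because it serves twice: it shows that the relabelled family is
  square summable, so that \<open>Abs_h2\<close> may be undone, and then it bounds the norm.\<close>

lemma reindex_finite_sum_le:
  assumes h: "bounded_reindexing C h" and "0 \<le> C" "finite S"
  shows "(\<Sum>k\<in>S. weight (fst k) * (cmod (case h k of None \<Rightarrow> 0 | Some k' \<Rightarrow> h2_coeff f k'))\<^sup>2)
    \<le> C * (norm f)\<^sup>2"
proof -
  let ?g = "\<lambda>k. weight (fst k) * (cmod (case h k of None \<Rightarrow> 0 | Some k' \<Rightarrow> h2_coeff f k'))\<^sup>2"
  let ?S = "S \<inter> dom h"
  have inj: "inj_on (the \<circ> h) ?S"
    using h unfolding bounded_reindexing_def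
    by (intro comp_inj_on inj_onI) (auto dest: inj_onD)
  have "sum ?g S = sum ?g ?S"
    using \<open>finite S\<close> by (intro sum.mono_neutral_right) (auto split: option.splits)
  also have "\<dots> \<le> (\<Sum>k\<in>?S. C * (weight (fst (the (h k))) * (cmod (h2_coeff f (the (h k))))\<^sup>2))"
  proof (rule sum_mono)
    fix k
    assume "k \<in> ?S"
    then obtain k' where k': "h k = Some k'" by auto
    then have "weight (fst k) \<le> C * weight (fst k')"
      using h unfolding bounded_reindexing_def by blast
    then have "weight (fst k) * (cmod (h2_coeff f k'))\<^sup>2 \<le> C * weight (fst k') * (cmod (h2_coeff f k'))\<^sup>2"
      by (rule mult_right_mono) simp
    with k' show "?g k \<le> C * (weight (fst (the (h k))) * (cmod (h2_coeff f (the (h k))))\<^sup>2)"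
      by (simp add: mult.assoc)
  qed
  also have "\<dots> = C * (\<Sum>k\<in>(the \<circ> h) ` ?S. weight (fst k) * (cmod (h2_coeff f k))\<^sup>2)"
    by (simp only: sum.reindex[OF inj] sum_distrib_left comp_apply)
  also have "\<dots> \<le> C * (norm f)\<^sup>2"
    using assms by (intro mult_left_mono sum_le_norm_h2_sq) auto
  finally show ?thesis .
qed

lemma h2_coeff_reindex:
  assumes "bounded_reindexing C h" and "0 \<le> C"
  shows "h2_coeff (reindex h f) k = (case h k of None \<Rightarrow> 0 | Some k' \<Rightarrow> h2_coeff f k')"
proof -
  have "(\<lambda>k. weight (fst k) * (cmod (case h k of None \<Rightarrow> 0 | Some k' \<Rightarrow> h2_coeff f k'))\<^sup>2) summable_on UNIV"
    by (rule nonneg_bdd_above_summable_on)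
      (auto intro!: bdd_aboveI2[where M = "C * (norm f)\<^sup>2"] reindex_finite_sum_le[OF assms])
  then show ?thesis by (simp add: reindex_def Abs_h2_inverse)
qed

lemma norm_reindex_sq_le:
  assumes "bounded_reindexing C h" and "0 \<le> C"
  shows "(norm (reindex h f))\<^sup>2 \<le> C * (norm f)\<^sup>2"
  unfolding norm_h2_sq[of "reindex h f"]
  by (rule infsum_le_finite_sums[OF h2_summable])
    (simp add: h2_coeff_reindex[OF assms] reindex_finite_sum_le[OF assms])

lemma norm_reindex_le:
  assumes "bounded_reindexing C h" and "0 \<le> C"
  shows "norm (reindex h f) \<le> sqrt C * norm f"
  using real_sqrt_le_mono[OF norm_reindex_sq_le[OF assms, of f]] by (simp add: real_sqrt_mult)

lemma reindex_add:
  assumes "bounded_reindexing C h" and "0 \<le> C"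
  shows "reindex h (f + g) = reindex h f + reindex h g"
  by (rule h2_eqI) (simp add: h2_coeff_reindex[OF assms] h2_coeff_simps split: option.split)

lemma reindex_scaleC:
  assumes "bounded_reindexing C h" and "0 \<le> C"
  shows "reindex h (c *\<^sub>C f) = c *\<^sub>C reindex h f"
  by (rule h2_eqI) (simp add: h2_coeff_reindex[OF assms] h2_coeff_simps split: option.split)

lemma bounded_linear_reindex:
  assumes "bounded_reindexing C h" and "0 \<le> C"
  shows "bounded_linear (reindex h)"
  by (rule bounded_linear_intro[where K = "sqrt C"])
    (auto simp: reindex_add[OF assms] reindex_scaleC[OF assms] scaleR_scaleC mult.commute
      intro: order_trans[OF norm_reindex_le[OF assms]])

section \<open>Coordinate projections and the shifts as relabellings\<close>

definition proj :: "(mono \<times> nat) set \<Rightarrow> h2 \<Rightarrow> h2"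
  where "proj A = reindex (\<lambda>k. if k \<in> A then Some k else None)"

lemma proj_bounded_reindexing: "bounded_reindexing 1 (\<lambda>k. if k \<in> A then Some k else None)"
  by (auto simp: bounded_reindexing_def inj_on_def split: if_splits)

lemmas bounded_linear_proj = bounded_linear_reindex[OF proj_bounded_reindexing zero_le_one, folded proj_def]
lemmas proj_add = reindex_add[OF proj_bounded_reindexing zero_le_one, folded proj_def]
lemmas proj_scaleC = reindex_scaleC[OF proj_bounded_reindexing zero_le_one, folded proj_def]

lemma h2_coeff_proj: "h2_coeff (proj A f) k = (if k \<in> A then h2_coeff f k else 0)"
  unfolding proj_def by (simp add: h2_coeff_reindex[OF proj_bounded_reindexing])

lemma norm_proj_le: "norm (proj A f) \<le> norm f"
  using norm_reindex_le[OF proj_bounded_reindexing, of A f] by (simp add: proj_def)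

lemma proj_zero [simp]: "proj A 0 = 0"
  by (rule h2_eqI) (simp add: h2_coeff_proj h2_coeff_simps)

lemma proj_empty [simp]: "proj {} f = 0"
  by (rule h2_eqI) (simp add: h2_coeff_proj h2_coeff_simps)

lemma proj_proj: "proj A (proj B f) = proj (A \<inter> B) f"
  by (rule h2_eqI) (simp add: h2_coeff_proj)

lemma proj_idem [simp]: "proj A (proj A f) = proj A f"
  by (simp add: proj_proj)

lemma proj_Un_disjoint: "A \<inter> B = {} \<Longrightarrow> proj (A \<union> B) f = proj A f + proj B f"
  by (rule h2_eqI) (auto simp: h2_coeff_proj h2_coeff_simps)

lemma cinner_proj_left: "cinner (proj A f) g = cinner f (proj A g)"
  unfolding cinner_def by (intro infsum_cong) (simp add: h2_coeff_proj)

lemma Z_bounded_reindexing: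
  "bounded_reindexing 1 (\<lambda>k. if lookup (fst k) i = 0 then None else Some (fst k - Poly_Mapping.single i 1, snd k))"
    (is "bounded_reindexing 1 ?h")
proof -
  have dec: "a = (a - Poly_Mapping.single i 1) + Poly_Mapping.single i 1" if "lookup a i \<noteq> 0" for a :: mono
    using that by (intro poly_mapping_eqI) (auto simp: lookup_add lookup_minus lookup_single when_def)
  have "inj_on ?h (dom ?h)"
  proof (rule inj_onI)
    fix k l
    assume "k \<in> dom ?h" "l \<in> dom ?h" "?h k = ?h l"
    then have "lookup (fst k) i \<noteq> 0" "lookup (fst l) i \<noteq> 0"
      "fst k - Poly_Mapping.single i 1 = fst l - Poly_Mapping.single i 1" "snd k = snd l"
      by (auto split: if_splits)
    then show "k = l" using dec[of "fst k"] dec[of "fst l"] by (metis prod.collapse)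
  qed
  moreover have "weight a \<le> weight (a - Poly_Mapping.single i 1)" if "lookup a i \<noteq> 0" for a
    using weight_add_single_le[of "a - Poly_Mapping.single i 1" i] dec[OF that] by simp
  ultimately show ?thesis by (auto simp: bounded_reindexing_def)
qed

lemma Z_eq_reindex:
  "Z i = reindex (\<lambda>k. if lookup (fst k) i = 0 then None else Some (fst k - Poly_Mapping.single i 1, snd k))"
  by (intro ext h2_eqI) (simp add: h2_coeff_reindex[OF Z_bounded_reindexing] h2_coeff_Z Z_coeff_def)

lemmas bounded_linear_Z = bounded_linear_reindex[OF Z_bounded_reindexing zero_le_one, folded Z_eq_reindex]
lemmas Z_add = reindex_add[OF Z_bounded_reindexing zero_le_one, folded Z_eq_reindex]
lemmas Z_scaleC = reindex_scaleC[OF Z_bounded_reindexing zero_le_one, folded Z_eq_reindex]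

lemma norm_Z_le: "norm (Z i f) \<le> norm f"
  using norm_reindex_le[OF Z_bounded_reindexing, of i f] by (simp add: Z_eq_reindex)

lemma mono_cases_single:
  fixes a :: mono
  obtains "lookup a i = 0" | b where "a = b + Poly_Mapping.single i 1"
proof (cases "lookup a i = 0")
  case False
  have "a = (a - Poly_Mapping.single i 1) + Poly_Mapping.single i 1"
    using False by (intro poly_mapping_eqI) (auto simp: lookup_add lookup_minus lookup_single when_def)
  then show ?thesis using that by blast
qed (use that in blast)

lemma h2_coeff_Z_eq_0: "lookup a i = 0 \<Longrightarrow> h2_coeff (Z i f) (a, c) = 0"
  by (simp add: h2_coeff_Z Z_coeff_def)

lemma h2_coeff_Z_add_single: "h2_coeff (Z i f) (a + Poly_Mapping.single i 1, c) = h2_coeff f (a, c)"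
  by (simp add: h2_coeff_Z Z_coeff_def lookup_add)

text \<open>With \<open>A\<close> and \<open>B\<close> the indices of degree n and n + 1 this says
  that \<open>Z i\<close> raises the degree by one; with \<open>A = {}\<close> it says that the
  image of \<open>Z i\<close> has no part in the lowest degree.\<close>

lemma proj_Z:
  assumes "\<And>a c. (a + Poly_Mapping.single i 1, c) \<in> B \<longleftrightarrow> (a, c) \<in> A"
  shows "proj B (Z i f) = Z i (proj A f)"
proof (rule h2_eqI)
  fix k :: "mono \<times> nat"
  obtain a c where k: "k = (a, c)" by (cases k)
  show "h2_coeff (proj B (Z i f)) k = h2_coeff (Z i (proj A f)) k"
    by (cases a i rule: mono_cases_single)
      (simp_all add: k h2_coeff_proj h2_coeff_Z_eq_0 h2_coeff_Z_add_single[simplified] assms[simplified])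
qed

section \<open>Bounded operators on a closed subspace\<close>

definition csubspace :: "h2 set \<Rightarrow> bool"
  where "csubspace M \<longleftrightarrow> h2.subspace M \<and> closed M"

lemma csubspaceD:
  assumes "csubspace M"
  shows "0 \<in> M" "closed M" "h2.subspace M"
    "x \<in> M \<Longrightarrow> y \<in> M \<Longrightarrow> x + y \<in> M" "x \<in> M \<Longrightarrow> y \<in> M \<Longrightarrow> x - y \<in> M" "x \<in> M \<Longrightarrow> c *\<^sub>C x \<in> M"
    "x \<in> M \<Longrightarrow> t *\<^sub>R x \<in> M"
  using assms unfolding csubspace_def
  by (auto simp: h2.subspace_0 h2.subspace_add h2.subspace_diff h2.subspace_scale scaleR_scaleC)

definition bounded_on :: "h2 set \<Rightarrow> (h2 \<Rightarrow> h2) \<Rightarrow> bool"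
  where "bounded_on M T \<longleftrightarrow> (\<forall>x\<in>M. T x \<in> M) \<and> (\<forall>x\<in>M. \<forall>y\<in>M. T (x + y) = T x + T y)
    \<and> (\<forall>c. \<forall>x\<in>M. T (c *\<^sub>C x) = c *\<^sub>C T x) \<and> (\<exists>C. \<forall>x\<in>M. norm (T x) \<le> C * norm x)"

lemma bounded_onI:
  assumes "\<And>x. x \<in> M \<Longrightarrow> T x \<in> M" "\<And>x y. x \<in> M \<Longrightarrow> y \<in> M \<Longrightarrow> T (x + y) = T x + T y"
    "\<And>c x. x \<in> M \<Longrightarrow> T (c *\<^sub>C x) = c *\<^sub>C T x" "\<And>x. x \<in> M \<Longrightarrow> norm (T x) \<le> C * norm x"
  shows "bounded_on M T"
  using assms unfolding bounded_on_def by blast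

lemma bounded_onD:
  assumes "bounded_on M T" "x \<in> M"
  shows "T x \<in> M" "y \<in> M \<Longrightarrow> T (x + y) = T x + T y" "T (c *\<^sub>C x) = c *\<^sub>C T x"
  using assms unfolding bounded_on_def by auto

lemma bounded_on_bound:
  assumes "bounded_on M T"
  obtains C where "C \<ge> 0" "\<And>x. x \<in> M \<Longrightarrow> norm (T x) \<le> C * norm x"
proof -
  from assms obtain C where C: "\<And>x. x \<in> M \<Longrightarrow> norm (T x) \<le> C * norm x"
    unfolding bounded_on_def by blast
  have "norm (T x) \<le> \<bar>C\<bar> * norm x" if "x \<in> M" for x
    using C[OF that] by (meson abs_ge_self mult_right_mono norm_ge_zero order_trans)
  then show ?thesis using that[of "\<bar>C\<bar>"] by simp
qed

lemma bounded_on_diff_arg: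
  assumes "csubspace M" "bounded_on M T" "x \<in> M" "y \<in> M"
  shows "T (x - y) = T x - T y"
  using bounded_onD(2)[OF assms(2) csubspaceD(5)[OF assms(1,3,4)] assms(4)] by simp

lemma bounded_on_zero_arg:
  assumes "csubspace M" "bounded_on M T"
  shows "T 0 = 0"
  using bounded_on_diff_arg[OF assms, of 0 0] csubspaceD(1)[OF assms(1)] by simp

lemma bounded_on_compose:
  assumes S: "bounded_on M S" and T: "bounded_on M T"
  shows "bounded_on M (\<lambda>x. S (T x))"
proof -
  obtain C where C: "C \<ge> 0" "\<And>x. x \<in> M \<Longrightarrow> norm (S x) \<le> C * norm x"
    using bounded_on_bound[OF S] by blast
  obtain D where D: "D \<ge> 0" "\<And>x. x \<in> M \<Longrightarrow> norm (T x) \<le> D * norm x"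
    using bounded_on_bound[OF T] by blast
  show ?thesis
  proof (rule bounded_onI[where C = "C * D"])
    fix x
    assume x: "x \<in> M"
    show "norm (S (T x)) \<le> C * D * norm x"
      using C(2)[OF bounded_onD(1)[OF T x]] mult_left_mono[OF D(2)[OF x] C(1)] by simp
  qed (simp_all add: bounded_onD[OF S] bounded_onD[OF T])
qed

lemma bounded_on_diff:
  assumes M: "csubspace M" and S: "bounded_on M S" and T: "bounded_on M T"
  shows "bounded_on M (\<lambda>x. S x - T x)"
proof -
  obtain C where C: "\<And>x. x \<in> M \<Longrightarrow> norm (S x) \<le> C * norm x"
    using bounded_on_bound[OF S] by blast
  obtain D where D: "\<And>x. x \<in> M \<Longrightarrow> norm (T x) \<le> D * norm x"
    using bounded_on_bound[OF T] by blast
  show ?thesis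
  proof (rule bounded_onI[where C = "C + D"])
    fix x
    assume x: "x \<in> M"
    show "norm (S x - T x) \<le> (C + D) * norm x"
      using C[OF x] D[OF x] norm_triangle_ineq4[of "S x" "T x"] by (simp add: algebra_simps)
  qed (simp_all add: bounded_onD[OF S] bounded_onD[OF T] csubspaceD[OF M] h2.scale_right_diff_distrib)
qed

lemma bounded_on_continuous_on:
  assumes "csubspace M" "bounded_on M T"
  shows "continuous_on M T"
proof -
  obtain C where C: "C \<ge> 0" "\<And>x. x \<in> M \<Longrightarrow> norm (T x) \<le> C * norm x"
    using bounded_on_bound[OF assms(2)] by blast
  have "dist (T x) (T y) \<le> C * dist x y" if "x \<in> M" "y \<in> M" for x y
    using C(2)[OF csubspaceD(5)[OF assms(1) that]] bounded_on_diff_arg[OF assms that]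
    by (simp add: dist_norm)
  then have "C-lipschitz_on M T" using C(1) by (intro lipschitz_onI)
  then show ?thesis by (rule lipschitz_on_continuous_on)
qed

text \<open>The representing vector is the minimizer of \<open>\<parallel>x\<parallel>\<^sup>2 - 2 Re (\<phi> x)\<close>.\<close>

lemma linear_term_zero:
  fixes a b :: real
  assumes "\<And>t. 0 \<le> 2 * t * a + t\<^sup>2 * b"
  shows "a = 0"
proof (rule ccontr)
  assume "a \<noteq> 0"
  \<comment> \<open>At t = - a / c the quadratic equals (a / c)^2 * (b - 2 * c), which is negative
    as soon as c > 0 and b < 2 * c. This is the first-order condition at an extremum, used for the
    minimizer below and for the maximizing vector in a block.\<close>
  define c where "c = \<bar>b\<bar> + 1"
  have c: "c > 0" "b < c" by (auto simp: c_def)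
  have "2 * (- a / c) * a + (- a / c)\<^sup>2 * b = (a / c)\<^sup>2 * (b - 2 * c)"
    using c by (simp add: field_simps power2_eq_square)
  also have "\<dots> < 0" using \<open>a \<noteq> 0\<close> c by (intro mult_pos_neg) auto
  finally show False using assms[of "- a / c"] by linarith
qed

lemma riesz_representation:
  fixes \<phi> :: "h2 \<Rightarrow> complex"
  assumes M: "csubspace M" and add: "\<And>x y. x \<in> M \<Longrightarrow> y \<in> M \<Longrightarrow> \<phi> (x + y) = \<phi> x + \<phi> y"
    and scale: "\<And>c x. x \<in> M \<Longrightarrow> \<phi> (c *\<^sub>C x) = c * \<phi> x"
    and bound: "\<And>x. x \<in> M \<Longrightarrow> cmod (\<phi> x) \<le> C * norm x"
  obtains w where "w \<in> M" "\<And>x. x \<in> M \<Longrightarrow> \<phi> x = cinner x w"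
proof -
  note MD = csubspaceD[OF M]
  define J where "J x = (norm x)\<^sup>2 - 2 * Re (\<phi> x)" for x
  have sR: "\<phi> (t *\<^sub>R x) = of_real t * \<phi> x" if "x \<in> M" for t x
    using scale[OF that] by (simp add: scaleR_scaleC)
  have diff: "\<phi> (x - y) = \<phi> x - \<phi> y" if "x \<in> M" "y \<in> M" for x y
    using add[OF MD(5)[OF that] that(2)] by simp
  \<comment> \<open>Completing the square: \<open>J x\<close> is at least (norm x - C)^2 -
    C^2.\<close>
  have lb: "- C\<^sup>2 \<le> J x" if "x \<in> M" for x
  proof -
    have "2 * Re (\<phi> x) \<le> 2 * (C * norm x)"
      using bound[OF that] complex_Re_le_cmod[of "\<phi> x"] by linarith
    moreover have "0 \<le> (norm x - C)\<^sup>2" by simp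
    ultimately show ?thesis
      by (simp add: J_def power2_diff mult.commute)
  qed
  define I where "I = Inf (J ` M)"
  have bdd: "bdd_below (J ` M)" using lb by (intro bdd_belowI2)
  have I_le: "I \<le> J x" if "x \<in> M" for x
    unfolding I_def using that bdd by (intro cInf_lower) auto
  have "\<exists>x\<in>M. J x < I + e" if "e > 0" for e
    using cInf_lessD[of "J ` M" "I + e"] that MD(1) by (auto simp: I_def)
  then have "\<forall>n. \<exists>x. x \<in> M \<and> J x < I + 1 / real (Suc n)" by (metis divide_pos_pos of_nat_0_less_iff zero_less_Suc zero_less_one)
  then obtain X where X: "\<And>n. X n \<in> M" "\<And>n. J (X n) < I + 1 / real (Suc n)" by metis
  \<comment> \<open>The parallelogram identity: the midpoint \<open>m\<close> lies in
    \<open>M\<close>, so \<open>J m\<close> is at least \<open>I\<close>, and two near-minimizers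
    must be close to each other. This makes every minimizing sequence Cauchy.\<close>
  have par: "(norm (x - y))\<^sup>2 \<le> 2 * (J x - I) + 2 * (J y - I)" if "x \<in> M" "y \<in> M" for x y
  proof -
    define m where "m = (1/2) *\<^sub>R (x + y)"
    have m: "m \<in> M" using MD that by (simp add: m_def)
    have "\<phi> m = (\<phi> x + \<phi> y) / 2"
      using that MD by (simp add: m_def sR add)
    moreover have "4 * (norm m)\<^sup>2 = (norm (x + y))\<^sup>2"
      by (simp add: m_def power_divide)
    ultimately have "4 * J m = (norm (x + y))\<^sup>2 - 4 * (Re (\<phi> x) + Re (\<phi> y))"
      by (simp only: J_def Re_divide_numeral plus_complex.sel) (simp add: field_simps)
    then have "(norm (x - y))\<^sup>2 = 2 * J x + 2 * J y - 4 * J m"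
      by (simp add: J_def power2_norm_eq_inner inner_add inner_diff inner_commute)
    with I_le[OF m] show ?thesis by simp
  qed
  have "Cauchy X"
  proof (rule metric_CauchyI)
    fix e :: real
    assume "e > 0"
    then obtain N where N: "inverse (real (Suc N)) < e\<^sup>2 / 4"
      using reals_Archimedean[of "e\<^sup>2 / 4"] by auto
    have small: "J (X n) - I < e\<^sup>2 / 4" if "n \<ge> N" for n
    proof -
      have "1 / real (Suc n) \<le> inverse (real (Suc N))" using that by (simp add: field_simps)
      then show ?thesis using X(2)[of n] N by linarith
    qed
    have "dist (X m) (X n) < e" if "m \<ge> N" "n \<ge> N" for m n
    proof -
      have "(norm (X m - X n))\<^sup>2 < e\<^sup>2"
      proof -
        note par[OF X(1)[of m] X(1)[of n]]
        also have "2 * (J (X m) - I) + 2 * (J (X n) - I) < 2 * (e\<^sup>2 / 4) + 2 * (e\<^sup>2 / 4)"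
          by (intro add_strict_mono mult_strict_left_mono small that) simp_all
        finally show ?thesis by simp
      qed
      then show ?thesis using \<open>e > 0\<close> by (simp add: dist_norm power_less_imp_less_base)
    qed
    then show "\<exists>N. \<forall>m\<ge>N. \<forall>n\<ge>N. dist (X m) (X n) < e" by blast
  qed
  then obtain w where w: "X \<longlonglongrightarrow> w" using Cauchy_convergent convergent_def by blast
  have wM: "w \<in> M" using closed_sequentially[OF MD(2) X(1) w] .
  have "(\<lambda>n. \<phi> (X n)) \<longlonglongrightarrow> \<phi> w"
  proof (rule LIM_zero_cancel, rule Lim_null_comparison)
    show "\<forall>\<^sub>F n in sequentially. norm (\<phi> (X n) - \<phi> w) \<le> C * norm (X n - w)"
      using bound[OF MD(5)[OF X(1) wM]] diff[OF X(1) wM] by (intro always_eventually) simp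
    show "(\<lambda>n. C * norm (X n - w)) \<longlonglongrightarrow> 0"
      using tendsto_mult_right_zero[OF tendsto_norm_zero[OF LIM_zero[OF w]]] .
  qed
  then have "(\<lambda>n. J (X n)) \<longlonglongrightarrow> J w"
    unfolding J_def by (intro tendsto_intros w)
  moreover have "(\<lambda>n. I + 1 / real (Suc n)) \<longlonglongrightarrow> I + 0"
    by (intro tendsto_intros LIMSEQ_Suc[OF lim_1_over_n])
  ultimately have "J w \<le> I + 0"
    by (rule LIMSEQ_le) (use X(2) less_imp_le in blast)
  then have min: "J w \<le> J x" if "x \<in> M" for x using I_le[OF that] by simp
  have Re: "Re (\<phi> x) = Re (cinner x w)" if x: "x \<in> M" for x
  proof -
    define a where "a = Re (cinner x w) - Re (\<phi> x)"
    have le: "0 \<le> 2 * t * a + t\<^sup>2 * (norm x)\<^sup>2" for t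
    proof -
      have "J w \<le> J (w + t *\<^sub>R x)" using MD x wM by (intro min) simp
      also have "\<dots> = J w + 2 * t * a + t\<^sup>2 * (norm x)\<^sup>2"
        using MD x wM
        by (simp add: J_def a_def power2_norm_eq_inner inner_add add sR inner_commute[of w x])
          (simp add: inner_h2_def algebra_simps power2_eq_square)
      finally show ?thesis by simp
    qed
    then have "a = 0" by (rule linear_term_zero)
    then show ?thesis by (simp add: a_def)
  qed
  have "\<phi> x = cinner x w" if x: "x \<in> M" for x
  proof (rule complex_eqI)
    show "Re (\<phi> x) = Re (cinner x w)" by (rule Re[OF x])
    \<comment> \<open>The imaginary part is the identity of real parts at the vector i times
      \<open>x\<close>.\<close>
    show "Im (\<phi> x) = Im (cinner x w)"
      using Re[OF MD(6)[OF x, of \<i>]] by (simp add: scale[OF x] cinner_scaleC_left)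
  qed
  with wM that show ?thesis by blast
qed

section \<open>Adjoints on a closed subspace\<close>

lemma eq_if_cinner_eq:
  assumes "csubspace M" "v \<in> M" "w \<in> M" "\<And>x. x \<in> M \<Longrightarrow> cinner x v = cinner x w"
  shows "v = w"
proof -
  have "v - w \<in> M" using csubspaceD[OF assms(1)] assms(2,3) by blast
  then have "cinner (v - w) (v - w) = 0"
    using assms(4) by (simp add: cinner_diff_right)
  then show ?thesis by (simp add: cinner_self_norm)
qed

text \<open>Existence is Riesz representation inside \<open>M\<close>, uniqueness is nondegeneracy
  of the inner product on \<open>M\<close>. This discharges the definite description in
  \<open>adj_on\<close>, which is not unfolded again.\<close>

lemma adj_on_spec:
  assumes M: "csubspace M" and T: "bounded_on M T" and y: "y \<in> M"
  shows adj_on_mem: "adj_on M T y \<in> M"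
    and cinner_adj_on: "x \<in> M \<Longrightarrow> cinner (T x) y = cinner x (adj_on M T y)"
proof -
  obtain C where C: "C \<ge> 0" "\<And>x. x \<in> M \<Longrightarrow> norm (T x) \<le> C * norm x"
    using bounded_on_bound[OF T] by blast
  obtain w where w: "w \<in> M" "\<And>x. x \<in> M \<Longrightarrow> cinner (T x) y = cinner x w"
  proof (rule riesz_representation[OF M, where \<phi> = "\<lambda>x. cinner (T x) y" and C = "C * norm y"])
    fix x
    assume x: "x \<in> M"
    show "cmod (cinner (T x) y) \<le> C * norm y * norm x"
      using cmod_cinner_le[of "T x" y] mult_right_mono[OF C(2)[OF x] norm_ge_zero[of y]]
      by (simp add: ac_simps)
  qed (simp_all add: bounded_onD[OF T] cinner_add_left cinner_scaleC_left)
  have "\<exists>!w. w \<in> M \<and> (\<forall>x\<in>M. cinner (T x) y = cinner x w)"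
  proof (rule ex1I)
    show "w \<in> M \<and> (\<forall>x\<in>M. cinner (T x) y = cinner x w)" using w by blast
    show "v = w" if "v \<in> M \<and> (\<forall>x\<in>M. cinner (T x) y = cinner x v)" for v
      by (rule eq_if_cinner_eq[OF M]) (use that w in auto)
  qed
  from theI'[OF this]
  show "adj_on M T y \<in> M" and "x \<in> M \<Longrightarrow> cinner (T x) y = cinner x (adj_on M T y)"
    unfolding adj_on_def by blast+
qed

lemma adj_on_eqI:
  assumes "csubspace M" "bounded_on M T" "y \<in> M" "w \<in> M"
    "\<And>x. x \<in> M \<Longrightarrow> cinner (T x) y = cinner x w"
  shows "adj_on M T y = w"
  using assms(4,5) cinner_adj_on[OF assms(1-3)] adj_on_mem[OF assms(1-3)]
  by (intro eq_if_cinner_eq[OF assms(1)]) auto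

lemma cinner_adj_on_left:
  assumes "csubspace M" "bounded_on M T" "x \<in> M" "y \<in> M"
  shows "cinner (adj_on M T y) x = cinner y (T x)"
  using cinner_adj_on[OF assms(1,2,4,3)] by (metis cinner_commute)

lemma norm_adj_on_le:
  assumes M: "csubspace M" and T: "bounded_on M T" and y: "y \<in> M"
    and C: "\<And>x. x \<in> M \<Longrightarrow> norm (T x) \<le> C * norm x"
  shows "norm (adj_on M T y) \<le> C * norm y"
proof -
  let ?w = "adj_on M T y"
  have w: "?w \<in> M" by (rule adj_on_mem[OF M T y])
  have "(norm ?w)\<^sup>2 = cmod (cinner ?w ?w)" by (simp add: cinner_self_norm norm_power)
  also have "\<dots> = cmod (cinner (T ?w) y)" using cinner_adj_on[OF M T y w] by simp
  also have "\<dots> \<le> norm (T ?w) * norm y" by (rule cmod_cinner_le)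
  also have "\<dots> \<le> C * norm ?w * norm y" by (intro mult_right_mono C w) simp
  finally have *: "norm ?w * norm ?w \<le> norm ?w * (C * norm y)"
    by (simp add: power2_eq_square ac_simps)
  show ?thesis
  proof (cases "norm ?w = 0")
    case True
    have "0 \<le> C * norm y" using C[OF y] norm_ge_zero order_trans by blast
    with True show ?thesis by simp
  next
    case False
    with * show ?thesis by (simp add: mult_le_cancel_left_pos)
  qed
qed

lemma bounded_on_adj_on:
  assumes M: "csubspace M" and T: "bounded_on M T"
  shows "bounded_on M (adj_on M T)"
proof -
  note a = adj_on_mem[OF M T] cinner_adj_on[OF M T] csubspaceD[OF M]
  obtain C where C: "C \<ge> 0" "\<And>x. x \<in> M \<Longrightarrow> norm (T x) \<le> C * norm x"
    using bounded_on_bound[OF T] by blast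
  show ?thesis
  proof (rule bounded_onI[where C = C])
    fix x y
    assume "x \<in> M" "y \<in> M"
    then show "adj_on M T (x + y) = adj_on M T x + adj_on M T y"
      by (intro adj_on_eqI[OF M T]) (simp_all add: a cinner_add_right)
  next
    fix c x
    assume "x \<in> M"
    then show "adj_on M T (c *\<^sub>C x) = c *\<^sub>C adj_on M T x"
      by (intro adj_on_eqI[OF M T]) (simp_all add: a cinner_scaleC_right)
  qed (simp_all add: a norm_adj_on_le[OF M T _ C(2)])
qed

text \<open>Coordinate projections are self-adjoint, so the adjoint moves a grading in the direction
  opposite to \<open>T\<close>. Two index sets are needed because \<open>Z i\<close> changes the
  degree; \<open>B = {}\<close> covers the lowest degree, where the adjoint of \<open>Z i\<close>
  vanishes.\<close>

lemma adj_on_intertwine: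
  assumes M: "csubspace M" and T: "bounded_on M T" and y: "y \<in> M"
    and A: "\<And>x. x \<in> M \<Longrightarrow> proj A x \<in> M" and B: "\<And>x. x \<in> M \<Longrightarrow> proj B x \<in> M"
    and AB: "\<And>x. x \<in> M \<Longrightarrow> proj A (T x) = T (proj B x)"
  shows "proj B (adj_on M T y) = adj_on M T (proj A y)"
proof (rule eq_if_cinner_eq[OF M])
  fix x
  assume x: "x \<in> M"
  have "cinner x (proj B (adj_on M T y)) = cinner (proj B x) (adj_on M T y)"
    by (simp add: cinner_proj_left)
  also have "\<dots> = cinner (T (proj B x)) y" by (simp add: cinner_adj_on[OF M T y B[OF x]])
  also have "\<dots> = cinner (T x) (proj A y)" by (simp add: AB[OF x, symmetric] cinner_proj_left)
  also have "\<dots> = cinner x (adj_on M T (proj A y))" by (rule cinner_adj_on[OF M T A[OF y] x])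
  finally show "cinner x (proj B (adj_on M T y)) = cinner x (adj_on M T (proj A y))" .
qed (simp_all add: A B y adj_on_mem[OF M T])

section \<open>Orthonormal systems\<close>

definition orthonormal :: "h2 set \<Rightarrow> bool"
  where "orthonormal E \<longleftrightarrow> (\<forall>e\<in>E. norm e = 1) \<and> (\<forall>e\<in>E. \<forall>f\<in>E. e \<noteq> f \<longrightarrow> cinner e f = 0)"

lemma orthonormal_subset: "orthonormal E \<Longrightarrow> F \<subseteq> E \<Longrightarrow> orthonormal F"
  by (auto simp: orthonormal_def)

lemma orthonormal_cinner:
  "orthonormal E \<Longrightarrow> e \<in> E \<Longrightarrow> f \<in> E \<Longrightarrow> cinner e f = (if e = f then 1 else 0)"
  by (auto simp: orthonormal_def cinner_self_norm)

lemma orthonormal_expansion_cinner: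
  assumes "orthonormal E" "finite E" "e \<in> E"
  shows "cinner (\<Sum>f\<in>E. c f *\<^sub>C f) e = c e"
proof -
  have "cinner (\<Sum>f\<in>E. c f *\<^sub>C f) e = (\<Sum>f\<in>E. if f = e then c f else 0)"
    unfolding cinner_sum_left cinner_scaleC_left
    using orthonormal_cinner[OF assms(1) _ assms(3)] by (intro sum.cong) auto
  then show ?thesis using assms by simp
qed

lemma orthonormal_independent:
  assumes "orthonormal E"
  shows "h2.independent E"
  unfolding h2.independent_explicit_module
proof (intro allI impI)
  fix t u v
  assume t: "finite t" "t \<subseteq> E" "(\<Sum>v\<in>t. u v *\<^sub>C v) = 0" "v \<in> t"
  then show "u v = 0"
    using orthonormal_expansion_cinner[OF orthonormal_subset[OF assms t(2)] t(1,4), of u] by simp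
qed

lemma orthonormal_residual:
  assumes "orthonormal E" "finite E" "e \<in> E"
  shows "cinner (x - (\<Sum>f\<in>E. cinner x f *\<^sub>C f)) e = 0"
  by (simp add: cinner_diff_left orthonormal_expansion_cinner[OF assms])

lemma norm_sum_orthonormal_sq:
  assumes "orthonormal E" "finite E"
  shows "(norm (\<Sum>f\<in>E. c f *\<^sub>C f))\<^sup>2 = (\<Sum>f\<in>E. (cmod (c f))\<^sup>2)"
proof -
  let ?s = "\<Sum>f\<in>E. c f *\<^sub>C f"
  have "of_real ((norm ?s)\<^sup>2) = cinner ?s ?s" by (simp only: cinner_self_norm)
  also have "\<dots> = (\<Sum>f\<in>E. cnj (c f) * cinner ?s f)"
    unfolding cinner_sum_right[of ?s] cinner_scaleC_right ..
  also have "\<dots> = (\<Sum>f\<in>E. cnj (c f) * c f)"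
    using orthonormal_expansion_cinner[OF assms] by (intro sum.cong) auto
  also have "\<dots> = of_real (\<Sum>f\<in>E. (cmod (c f))\<^sup>2)"
    unfolding of_real_sum complex_norm_square by (simp add: mult.commute)
  finally show ?thesis using of_real_eq_iff by blast
qed

lemma bessel:
  assumes "orthonormal E" "finite E"
  shows "(\<Sum>e\<in>E. (cmod (cinner x e))\<^sup>2) \<le> (norm x)\<^sup>2"
proof -
  let ?s = "\<Sum>f\<in>E. cinner x f *\<^sub>C f"
  have "cinner (x - ?s) ?s = 0"
    unfolding cinner_sum_right cinner_scaleC_right
    using orthonormal_residual[OF assms] by (intro sum.neutral) simp
  from norm_sq_add_orthogonal[OF this]
  have "(norm x)\<^sup>2 = (norm (x - ?s))\<^sup>2 + (norm ?s)\<^sup>2" by simp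
  then show ?thesis by (simp add: norm_sum_orthonormal_sq[OF assms])
qed

lemma orthonormal_span_expansion:
  assumes "orthonormal E" "finite E" "x \<in> h2.span E"
  shows "x = (\<Sum>e\<in>E. cinner x e *\<^sub>C e)"
proof -
  obtain u where u: "x = (\<Sum>e\<in>E. u e *\<^sub>C e)"
    using assms(2,3) by (auto simp: h2.span_finite)
  have "(\<Sum>e\<in>E. cinner x e *\<^sub>C e) = (\<Sum>e\<in>E. u e *\<^sub>C e)"
    using orthonormal_expansion_cinner[OF assms(1,2), of _ u] unfolding u
    by (intro sum.cong) auto
  then show ?thesis using u by simp
qed

lemma parseval:
  assumes "orthonormal E" "finite E" "x \<in> h2.span E"
  shows "(\<Sum>e\<in>E. (cmod (cinner x e))\<^sup>2) = (norm x)\<^sup>2"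
  using norm_sum_orthonormal_sq[OF assms(1,2), of "cinner x"] orthonormal_span_expansion[OF assms]
  by simp

text \<open>An orthonormal set of largest cardinality with the property \<Phi> exists by
  \<open>bound\<close>, and by \<open>step\<close> it must span. It is used with trivial \<Phi> for
  eigenspaces, where compactness gives the bound, and with \<Phi> saying "eigenvector" for blocks,
  where the finite support gives it.\<close>

lemma orthonormal_basis_exists:
  assumes bound: "\<And>E. finite E \<Longrightarrow> orthonormal E \<Longrightarrow> E \<subseteq> V \<Longrightarrow> card E \<le> n"
    and step: "\<And>E. finite E \<Longrightarrow> orthonormal E \<Longrightarrow> E \<subseteq> V \<Longrightarrow> \<forall>e\<in>E. \<Phi> e \<Longrightarrow> \<not> V \<subseteq> h2.span E \<Longrightarrow>
      \<exists>v\<in>V. norm v = 1 \<and> (\<forall>e\<in>E. cinner v e = 0) \<and> \<Phi> v"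
  obtains E where "finite E" "orthonormal E" "E \<subseteq> V" "\<forall>e\<in>E. \<Phi> e" "V \<subseteq> h2.span E"
proof -
  define P where "P E \<longleftrightarrow> finite E \<and> orthonormal E \<and> E \<subseteq> V \<and> (\<forall>e\<in>E. \<Phi> e)" for E
  have "P {}" by (simp add: P_def orthonormal_def)
  moreover have "\<forall>E. P E \<longrightarrow> card E < Suc n" using bound by (simp add: P_def less_Suc_eq_le)
  ultimately obtain E where E: "P E" and max: "\<And>F. P F \<Longrightarrow> card F \<le> card E"
    using ex_has_greatest_nat[of P "{}" card "Suc n"] by blast
  have "V \<subseteq> h2.span E"
  proof (rule ccontr)
    assume "\<not> V \<subseteq> h2.span E"
    then obtain v where v: "v \<in> V" "norm v = 1" "\<forall>e\<in>E. cinner v e = 0" "\<Phi> v"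
      using step[of E] E by (auto simp: P_def)
    have "v \<notin> E" using v by (auto simp: cinner_self_norm)
    moreover have "cinner e v = 0" if "e \<in> E" for e
      using v(3) that by (subst cinner_commute) simp
    then have "P (insert v E)" using E v by (auto simp: P_def orthonormal_def)
    ultimately show False using max[of "insert v E"] E by (simp add: P_def)
  qed
  with E that show ?thesis unfolding P_def by blast
qed

lemma exists_unit_vector_orthogonal:
  assumes V: "h2.subspace V" and E: "orthonormal E" "finite E" "E \<subseteq> V" and "\<not> V \<subseteq> h2.span E"
  obtains v where "v \<in> V" "norm v = 1" "\<forall>e\<in>E. cinner v e = 0"
proof -
  obtain x where x: "x \<in> V" "x \<notin> h2.span E" using assms by blast
  define s where "s = (\<Sum>f\<in>E. cinner x f *\<^sub>C f)"
  have sE: "s \<in> h2.span E"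
    unfolding s_def by (intro h2.span_sum h2.span_scale h2.span_base)
  have "s \<in> V"
    unfolding s_def using V E(3) by (intro h2.subspace_sum h2.subspace_scale) auto
  then have y: "x - s \<in> V" "x - s \<noteq> 0" using h2.subspace_diff[OF V x(1)] x(2) sE by auto
  show ?thesis
  proof (rule that[of "of_real (1 / norm (x - s)) *\<^sub>C (x - s)"])
    show "of_real (1 / norm (x - s)) *\<^sub>C (x - s) \<in> V" using y V by (simp add: h2.subspace_scale)
    show "norm (of_real (1 / norm (x - s)) *\<^sub>C (x - s)) = 1"
      using y(2) by (simp add: norm_scaleC norm_divide)
    show "\<forall>e\<in>E. cinner (of_real (1 / norm (x - s)) *\<^sub>C (x - s)) e = 0"
      using orthonormal_residual[OF E(1,2)] by (simp add: cinner_scaleC_left s_def)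
  qed
qed

text \<open>The point 0 has to be included because \<open>T\<close> may annihilate eigenvectors. If
  one of the two points is 0, convexity reduces to s powr q \<le> s for 0 < s < 1.\<close>

lemma powr_convex_nonneg:
  fixes q :: real
  assumes "q \<ge> 1"
  shows "convex_on {0..} (\<lambda>x. x powr q)"
proof (rule convex_onI)
  fix t x y :: real
  assume t: "0 < t" "t < 1" and xy: "x \<in> {0..}" "y \<in> {0..}"
  have *: "(s * z) powr q \<le> s * z powr q" if "0 < s" "s < 1" "0 \<le> z" for s z :: real
  proof -
    have "s powr q \<le> s" using that assms powr_mono'[of 1 q s] by simp
    then show ?thesis using that by (simp add: powr_mult mult_right_mono)
  qed
  show "((1 - t) *\<^sub>R x + t *\<^sub>R y) powr q \<le> (1 - t) * x powr q + t * y powr q"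
  proof (cases "x = 0 \<or> y = 0")
    case True
    then show ?thesis using *[of t y] *[of "1 - t" x] t xy by auto
  next
    case False
    with xy have "x \<in> {0<..}" "y \<in> {0<..}" by auto
    from convex_onD[OF powr_convex[OF assms] _ _ this, of t] t show ?thesis by simp
  qed
qed simp

section \<open>Orthonormal systems of eigenvectors of \<open>T\<^sup>*T\<close>\<close>

definition eigensystem :: "h2 set \<Rightarrow> (h2 \<Rightarrow> h2) \<Rightarrow> h2 set \<Rightarrow> bool"
  where "eigensystem M T E \<longleftrightarrow> orthonormal E \<and> E \<subseteq> M \<and>
    (\<forall>e\<in>E. adj_on M T (T e) = of_real ((norm (T e))\<^sup>2) *\<^sub>C e)"

lemma eigensystem_subset: "eigensystem M T E \<Longrightarrow> F \<subseteq> E \<Longrightarrow> eigensystem M T F"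
  using orthonormal_subset by (auto simp: eigensystem_def)

lemma cinner_eigensystem:
  assumes M: "csubspace M" and T: "bounded_on M T" and E: "eigensystem M T E" "e \<in> E" and x: "x \<in> M"
  shows "cinner (T x) (T e) = of_real ((norm (T e))\<^sup>2) * cinner x e"
proof -
  have "e \<in> M" using E by (auto simp: eigensystem_def)
  then have "cinner (T x) (T e) = cinner x (adj_on M T (T e))"
    by (intro cinner_adj_on[OF M T _ x] bounded_onD(1)[OF T])
  then show ?thesis using E by (simp add: eigensystem_def cinner_scaleC_right)
qed

lemma norm_image_eigenexpansion_sq:
  assumes M: "csubspace M" and T: "bounded_on M T" and E: "eigensystem M T E" "finite E"
    and x: "x \<in> h2.span E"
  shows "(norm (T x))\<^sup>2 = (\<Sum>e\<in>E. (cmod (cinner x e))\<^sup>2 * (norm (T e))\<^sup>2)"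
proof -
  have on: "orthonormal E" and EM: "E \<subseteq> M" using E by (auto simp: eigensystem_def)
  have "h2.span E \<subseteq> M" using csubspaceD(3)[OF M] EM by (rule h2.span_minimal[rotated])
  then have xM: "x \<in> M" using x by blast
  have TE: "T (\<Sum>e\<in>F. c e *\<^sub>C e) = (\<Sum>e\<in>F. c e *\<^sub>C T e) \<and> (\<Sum>e\<in>F. c e *\<^sub>C e) \<in> M"
    if "finite F" "F \<subseteq> E" for F c
    using that
  proof induction
    case empty
    then show ?case using bounded_on_zero_arg[OF M T] csubspaceD(1)[OF M] by simp
  next
    case (insert e F)
    then have "e \<in> M" using EM by auto
    with insert show ?case by (simp add: bounded_onD[OF T] csubspaceD[OF M])
  qed
  have Tx: "T x = (\<Sum>e\<in>E. cinner x e *\<^sub>C T e)"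
    using TE[OF E(2) subset_refl, of "cinner x"] orthonormal_span_expansion[OF on E(2) x] by simp
  have "of_real ((norm (T x))\<^sup>2) = cinner (T x) (T x)" by (simp only: cinner_self_norm)
  also have "\<dots> = (\<Sum>e\<in>E. cnj (cinner x e) * cinner (T x) (T e))"
    by (subst (2) Tx) (simp add: cinner_sum_right cinner_scaleC_right)
  also have "\<dots> = (\<Sum>e\<in>E. of_real ((cmod (cinner x e))\<^sup>2 * (norm (T e))\<^sup>2))"
  proof (rule sum.cong[OF refl])
    fix e
    assume e: "e \<in> E"
    show "cnj (cinner x e) * cinner (T x) (T e) = of_real ((cmod (cinner x e))\<^sup>2 * (norm (T e))\<^sup>2)"
      unfolding cinner_eigensystem[OF M T E(1) e xM] of_real_mult complex_norm_square by simp
  qed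
  finally show ?thesis using of_real_eq_iff unfolding of_real_sum[symmetric] by blast
qed

text \<open>
  Jensen's inequality, with the weights \<open>\<bar>\<langle>g, f\<rangle>\<bar>\<^sup>2\<close>, which have sum \<open>1\<close> over \<open>f\<close> and at most \<open>1\<close> over \<open>g\<close>.
\<close>

lemma sum_norm_powr_le_eigensystem:
  assumes M: "csubspace M" and T: "bounded_on M T" and E: "eigensystem M T E" "finite E"
    and G: "finite G" "orthonormal G" "G \<subseteq> h2.span E" and p: "2 \<le> p"
  shows "(\<Sum>g\<in>G. norm (T g) powr p) \<le> (\<Sum>e\<in>E. norm (T e) powr p)"
proof -
  have on: "orthonormal E" using E by (auto simp: eigensystem_def)
  have sq: "(y\<^sup>2) powr (p / 2) = y powr p" if "0 \<le> y" for y :: real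
    using powr_powr[of y 2 "p / 2"] that by (cases "y = 0") auto
  have commute: "(cmod (cinner e g))\<^sup>2 = (cmod (cinner g e))\<^sup>2" if "g \<in> G" "e \<in> E" for e g
    by (simp only: cmod_cinner_commute[of e g])
  have le: "norm (T g) powr p \<le> (\<Sum>e\<in>E. (cmod (cinner g e))\<^sup>2 * norm (T e) powr p)" if g: "g \<in> G" for g
  proof -
    have gE: "g \<in> h2.span E" and g1: "norm g = 1" using g G by (auto simp: orthonormal_def)
    have w: "(\<Sum>e\<in>E. (cmod (cinner g e))\<^sup>2) = 1" using parseval[OF on E(2) gE] g1 by simp
    then have "E \<noteq> {}" by auto
    \<comment> \<open>Expansion along \<open>E\<close> is quadratic, so Jensen is applied to squared
      norms with the exponent p / 2. Convexity of that power is what 2 \<le> p provides.\<close>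
    have "norm (T g) powr p = ((norm (T g))\<^sup>2) powr (p / 2)" by (simp add: sq)
    also have "\<dots> = (\<Sum>e\<in>E. (cmod (cinner g e))\<^sup>2 *\<^sub>R (norm (T e))\<^sup>2) powr (p / 2)"
      by (simp add: norm_image_eigenexpansion_sq[OF M T E gE])
    also have "\<dots> \<le> (\<Sum>e\<in>E. (cmod (cinner g e))\<^sup>2 * ((norm (T e))\<^sup>2) powr (p / 2))"
      using p by (intro convex_on_sum[OF E(2) \<open>E \<noteq> {}\<close> powr_convex_nonneg w]) auto
    finally show ?thesis by (simp add: sq)
  qed
  have "(\<Sum>g\<in>G. norm (T g) powr p) \<le> (\<Sum>g\<in>G. \<Sum>e\<in>E. (cmod (cinner g e))\<^sup>2 * norm (T e) powr p)"
    by (intro sum_mono le)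
  also have "\<dots> = (\<Sum>e\<in>E. (\<Sum>g\<in>G. (cmod (cinner e g))\<^sup>2) * norm (T e) powr p)"
    unfolding sum_distrib_right by (subst sum.swap) (intro sum.cong refl, simp only: commute)
  also have "\<dots> \<le> (\<Sum>e\<in>E. 1 * norm (T e) powr p)"
  proof (intro sum_mono mult_right_mono)
    fix e
    assume "e \<in> E"
    then have "norm e = 1" using on by (auto simp: orthonormal_def)
    then show "(\<Sum>g\<in>G. (cmod (cinner e g))\<^sup>2) \<le> 1" using bessel[OF G(2,1), of e] by simp
  qed simp
  finally show ?thesis by simp
qed

section \<open>Compactness and Schatten norms\<close>

text \<open>Total boundedness and the pigeonhole principle: a ball of radius \<delta> / 2 contains
  at most one of a family of \<delta>-separated images. All consequences of compactness are drawn
  from this bound.\<close>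

lemma compact_on_separated_card_bound:
  assumes "compact_on M T" "0 < \<delta>"
  obtains b where "\<forall>X. finite X \<and> X \<subseteq> M \<and> (\<forall>x\<in>X. norm x \<le> 1) \<and>
    (\<forall>x\<in>X. \<forall>y\<in>X. x \<noteq> y \<longrightarrow> \<delta> \<le> dist (T x) (T y)) \<longrightarrow> card X \<le> b"
proof -
  have "0 < \<delta> / 2" using assms by simp
  with assms(1) obtain k where k: "finite k" "closure (T ` (M \<inter> cball 0 1)) \<subseteq> (\<Union>x\<in>k. ball x (\<delta> / 2))"
    unfolding compact_on_def compact_eq_totally_bounded by blast
  show ?thesis
  proof (rule that, intro allI impI, elim conjE)
    fix X
    assume X: "finite X" "X \<subseteq> M" "\<forall>x\<in>X. norm x \<le> 1"
      and sep: "\<forall>x\<in>X. \<forall>y\<in>X. x \<noteq> y \<longrightarrow> \<delta> \<le> dist (T x) (T y)"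
    have "\<exists>c\<in>k. dist c (T x) < \<delta> / 2" if "x \<in> X" for x
    proof -
      have "T x \<in> closure (T ` (M \<inter> cball 0 1))"
        using that X by (intro subsetD[OF closure_subset]) auto
      then have "T x \<in> (\<Union>x\<in>k. ball x (\<delta> / 2))" using k(2) by blast
      then show ?thesis by auto
    qed
    then obtain c where c: "\<And>x. x \<in> X \<Longrightarrow> c x \<in> k" "\<And>x. x \<in> X \<Longrightarrow> dist (c x) (T x) < \<delta> / 2"
      by metis
    have "inj_on c X"
    proof (rule inj_onI, rule ccontr)
      fix x y
      assume xy: "x \<in> X" "y \<in> X" "c x = c y" "x \<noteq> y"
      have "dist (T x) (T y) \<le> dist (c x) (T x) + dist (c x) (T y)"
        by (simp add: dist_triangle3)
      moreover have "\<delta> \<le> dist (T x) (T y)" using sep xy by blast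
      ultimately show False using c(2)[OF xy(1)] c(2)[OF xy(2)] xy(3) by simp
    qed
    then show "card X \<le> card k" using c(1) k(1) by (intro card_inj_on_le[of c]) auto
  qed
qed

section \<open>Singular values and multiplicities\<close>

definition eigenspace :: "h2 set \<Rightarrow> (h2 \<Rightarrow> h2) \<Rightarrow> real \<Rightarrow> h2 set"
  where "eigenspace M T s = {x \<in> M. adj_on M T (T x) = of_real (s\<^sup>2) *\<^sub>C x}"

lemma singular_mult_eq: "singular_mult M T s = h2.dim (eigenspace M T s)"
  by (simp add: singular_mult_def eigenspace_def)

lemma subspace_eigenspace:
  assumes M: "csubspace M" and T: "bounded_on M T"
  shows "h2.subspace (eigenspace M T s)"
proof -
  have Q: "bounded_on M (\<lambda>x. adj_on M T (T x))"
    by (rule bounded_on_compose[OF bounded_on_adj_on[OF M T] T])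
  show ?thesis
  proof (rule h2.subspaceI)
    show "0 \<in> eigenspace M T s"
      using bounded_on_zero_arg[OF M Q] csubspaceD(1)[OF M] by (simp add: eigenspace_def)
  next
    fix x y
    assume "x \<in> eigenspace M T s" "y \<in> eigenspace M T s"
    then show "x + y \<in> eigenspace M T s"
      using bounded_onD(2)[OF Q, of x y] csubspaceD(4)[OF M, of x y]
      by (simp add: eigenspace_def h2.scale_right_distrib)
  next
    fix c x
    assume "x \<in> eigenspace M T s"
    then have x: "x \<in> M" "adj_on M T (T x) = of_real (s\<^sup>2) *\<^sub>C x" by (auto simp: eigenspace_def)
    have "adj_on M T (T (c *\<^sub>C x)) = c *\<^sub>C of_real (s\<^sup>2) *\<^sub>C x"
      unfolding bounded_onD(3)[OF Q x(1)] x(2) ..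
    also have "\<dots> = of_real (s\<^sup>2) *\<^sub>C c *\<^sub>C x" by (rule h2.scale_left_commute)
    finally show "c *\<^sub>C x \<in> eigenspace M T s"
      using csubspaceD(6)[OF M x(1)] by (simp only: eigenspace_def mem_Collect_eq)
  qed
qed

text \<open>On the eigenspace \<open>T\<close> multiplies norms by \<open>s\<close>, so orthonormal
  vectors have images at distance s * sqrt 2, which is at least s, and compactness bounds their
  number. Finiteness matters because \<open>h2.dim\<close> of an infinite-dimensional space is 0 and
  would not count eigenvectors.\<close>

lemma eigenspace_finite_dim:
  assumes M: "csubspace M" and T: "bounded_on M T" and c: "compact_on M T" and s: "0 < s"
  obtains B where "finite B" "h2.independent B" "B \<subseteq> eigenspace M T s" "eigenspace M T s \<subseteq> h2.span B"
proof -
  obtain b where b: "\<forall>X. finite X \<and> X \<subseteq> M \<and> (\<forall>x\<in>X. norm x \<le> 1) \<and>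
      (\<forall>x\<in>X. \<forall>y\<in>X. x \<noteq> y \<longrightarrow> s \<le> dist (T x) (T y)) \<longrightarrow> card X \<le> b"
    by (rule compact_on_separated_card_bound[OF c s])
  note V = subspace_eigenspace[OF M T, of s]
  show ?thesis
  proof (rule orthonormal_basis_exists[where V = "eigenspace M T s" and n = b and \<Phi> = "\<lambda>_. True"])
    fix E
    assume E: "finite E" "orthonormal E" "E \<subseteq> eigenspace M T s"
    show "card E \<le> b"
    proof (rule b[rule_format], intro conjI ballI impI)
      show "finite E" by (rule E(1))
      show EM: "E \<subseteq> M" using E by (auto simp: eigenspace_def)
      show "norm x \<le> 1" if "x \<in> E" for x using that E by (simp add: orthonormal_def)
      fix x y
      assume xy: "x \<in> E" "y \<in> E" "x \<noteq> y"
      have d: "x - y \<in> eigenspace M T s" "x - y \<in> M"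
        using h2.subspace_diff[OF V] csubspaceD(5)[OF M] xy(1,2) E(3) EM by blast+
      have "cinner (T (x - y)) (T (x - y)) = cinner (x - y) (adj_on M T (T (x - y)))"
        by (intro cinner_adj_on[OF M T] bounded_onD(1)[OF T] d)
      also have "\<dots> = of_real (s\<^sup>2) * cinner (x - y) (x - y)"
        using d(1) by (simp add: eigenspace_def cinner_scaleC_right)
      finally have "of_real ((norm (T (x - y)))\<^sup>2) = (of_real (s\<^sup>2 * (norm (x - y))\<^sup>2) :: complex)"
        by (simp only: cinner_self_norm of_real_mult)
      then have "(norm (T (x - y)))\<^sup>2 = s\<^sup>2 * (norm (x - y))\<^sup>2"
        using of_real_eq_iff by blast
      also have "(norm (x - y))\<^sup>2 = 2"
      proof -
        have "cinner x (- y) = 0"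
          using cinner_diff_right[of x 0 y] xy E(2) by (simp add: orthonormal_def)
        from norm_sq_add_orthogonal[OF this] show ?thesis
          using xy E(2) by (simp add: orthonormal_def)
      qed
      finally have "s\<^sup>2 \<le> (norm (T (x - y)))\<^sup>2" by simp
      then have "s \<le> norm (T (x - y))" by (rule power2_le_imp_le) simp
      moreover have "T (x - y) = T x - T y" using bounded_on_diff_arg[OF M T] xy EM by blast
      ultimately show "s \<le> dist (T x) (T y)" by (simp add: dist_norm)
    qed
  next
    fix E
    assume "finite E" "orthonormal E" "E \<subseteq> eigenspace M T s" "\<not> eigenspace M T s \<subseteq> h2.span E"
    then show "\<exists>v\<in>eigenspace M T s. norm v = 1 \<and> (\<forall>e\<in>E. cinner v e = 0) \<and> True"
      using exists_unit_vector_orthogonal[OF V, of E] by metis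
  qed (use that orthonormal_independent in blast)
qed

lemma sum_norm_powr_group:
  assumes "finite E"
  shows "(\<Sum>e\<in>E. norm (T e) powr p)
    = (\<Sum>s\<in>(\<lambda>e. norm (T e)) ` E - {0}. real (card {e\<in>E. norm (T e) = s}) * s powr p)"
proof -
  have "(\<Sum>e\<in>E. norm (T e) powr p)
      = (\<Sum>s\<in>(\<lambda>e. norm (T e)) ` E. \<Sum>e\<in>{e\<in>E. norm (T e) = s}. norm (T e) powr p)"
    by (rule sum.image_gen[OF assms])
  also have "\<dots> = (\<Sum>s\<in>(\<lambda>e. norm (T e)) ` E. real (card {e\<in>E. norm (T e) = s}) * s powr p)"
    by (intro sum.cong) simp_all
  \<comment> \<open>The value 0 may be dropped since 0 powr p = 0; this matches the summation over
    positive singular values.\<close>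
  also have "\<dots> = (\<Sum>s\<in>(\<lambda>e. norm (T e)) ` E - {0}. real (card {e\<in>E. norm (T e) = s}) * s powr p)"
    using assms by (intro sum.mono_neutral_right) auto
  finally show ?thesis .
qed

text \<open>The vectors of \<open>E\<close> with the same positive value \<open>norm (T e)\<close>
  are independent in one eigenspace, so the multiplicity bounds their number. This gives only an
  inequality, since \<open>E\<close> may be incomplete.\<close>

lemma schatten_on_sum_eigensystem_le:
  assumes M: "csubspace M" and T: "bounded_on M T" and sch: "schatten_on p M T"
    and E: "eigensystem M T E" "finite E"
  shows "(\<Sum>e\<in>E. norm (T e) powr p) \<le> (\<Sum>\<^sub>\<infinity>s\<in>{0<..}. real (singular_mult M T s) * s powr p)"
proof -
  have on: "orthonormal E" and EM: "E \<subseteq> M" using E by (auto simp: eigensystem_def)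
  have c: "compact_on M T" and sm: "(\<lambda>s. real (singular_mult M T s) * s powr p) summable_on {0<..}"
    using sch by (auto simp: schatten_on_def)
  have card_le: "card {e\<in>E. norm (T e) = s} \<le> singular_mult M T s" if s: "0 < s" for s
  proof -
    obtain B where B: "finite B" "h2.independent B" "B \<subseteq> eigenspace M T s" "eigenspace M T s \<subseteq> h2.span B"
      using eigenspace_finite_dim[OF M T c s] by blast
    have "{e\<in>E. norm (T e) = s} \<subseteq> eigenspace M T s"
      using E by (auto simp: eigensystem_def eigenspace_def)
    then have "card {e\<in>E. norm (T e) = s} \<le> card B"
      using h2.independent_span_bound[OF B(1) orthonormal_independent[OF orthonormal_subset[OF on]]] B(4)
      by (metis (no_types, lifting) mem_Collect_eq subset_iff)
    also have "card B = singular_mult M T s"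
      unfolding singular_mult_eq using h2.basis_card_eq_dim[OF B(3,4,2)] .
    finally show ?thesis .
  qed
  let ?S = "(\<lambda>e. norm (T e)) ` E - {0}"
  have pos: "0 < s" if "s \<in> ?S" for s using that by auto
  have "(\<Sum>e\<in>E. norm (T e) powr p) = (\<Sum>s\<in>?S. real (card {e\<in>E. norm (T e) = s}) * s powr p)"
    by (rule sum_norm_powr_group[OF E(2)])
  also have "\<dots> \<le> (\<Sum>s\<in>?S. real (singular_mult M T s) * s powr p)"
    by (intro sum_mono mult_right_mono) (use card_le pos in auto)
  also have "\<dots> \<le> (\<Sum>\<^sub>\<infinity>s\<in>{0<..}. real (singular_mult M T s) * s powr p)"
    using E(2) pos by (intro finite_sum_le_infsum[OF sm]) auto
  finally show ?thesis .
qed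

text \<open>The converse direction, where completeness of \<open>E\<close> is essential: it forces
  the eigenspace for \<open>s\<close> to be spanned by those \<open>e\<close> with
  \<open>norm (T e) = s\<close>, so the multiplicity is at most their number.\<close>

lemma singular_values_summable_if_eigensystem:
  assumes M: "csubspace M" and T: "bounded_on M T" and E: "eigensystem M T E"
    and total: "\<And>x. x \<in> M \<Longrightarrow> (\<And>e. e \<in> E \<Longrightarrow> cinner x e = 0) \<Longrightarrow> x = 0"
    and bound: "\<And>F. finite F \<Longrightarrow> F \<subseteq> E \<Longrightarrow> (\<Sum>e\<in>F. norm (T e) powr p) \<le> B"
  shows "(\<lambda>s. real (singular_mult M T s) * s powr p) summable_on {0<..}"
proof -
  have on: "orthonormal E" and EM: "E \<subseteq> M" using E by (auto simp: eigensystem_def)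
  define Es where "Es s = {e\<in>E. norm (T e) = s}" for s
  \<comment> \<open>Each vector of \<open>Es s\<close> contributes s powr p to a sum bounded by
    \<open>B\<close>, so finiteness follows from the bound without compactness.\<close>
  have fin: "finite (Es s)" if s: "0 < s" for s
  proof (rule finite_if_finite_subsets_card_bdd[THEN conjunct1])
    fix F
    assume F: "F \<subseteq> Es s" "finite F"
    then have "(\<Sum>e\<in>F. norm (T e) powr p) = real (card F) * s powr p"
      by (simp add: Es_def subset_iff)
    moreover have "(\<Sum>e\<in>F. norm (T e) powr p) \<le> B"
      using F by (intro bound) (auto simp: Es_def)
    ultimately have "real (card F) \<le> B / s powr p" using s by (simp add: field_simps)
    then show "card F \<le> nat \<lfloor>B / s powr p\<rfloor>" by (simp add: le_nat_floor)
  qed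
  have mult_le: "singular_mult M T s \<le> card (Es s)" if s: "0 < s" for s
    unfolding singular_mult_eq
  proof (rule h2.dim_le_card[OF subsetI fin[OF s]])
    fix x
    assume "x \<in> eigenspace M T s"
    then have x: "x \<in> M" "adj_on M T (T x) = of_real (s\<^sup>2) *\<^sub>C x" by (auto simp: eigenspace_def)
    define y where "y = x - (\<Sum>f\<in>Es s. cinner x f *\<^sub>C f)"
    have sub: "Es s \<subseteq> E" by (auto simp: Es_def)
    have "(\<Sum>f\<in>Es s. cinner x f *\<^sub>C f) \<in> M"
      using sub EM csubspaceD[OF M] by (intro h2.subspace_sum) auto
    then have yM: "y \<in> M" using x csubspaceD[OF M] by (simp add: y_def)
    have "y = 0"
    proof (rule total[OF yM])
      fix e
      assume e: "e \<in> E"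
      then have eM: "e \<in> M" using EM by blast
      show "cinner y e = 0"
      proof (cases "norm (T e) = s")
        case True
        then show ?thesis
          using orthonormal_residual[OF orthonormal_subset[OF on sub] fin[OF s]] e
          by (simp add: y_def Es_def)
      next
        case False
        \<comment> \<open>Eigenvectors for different eigenvalues are orthogonal: the inner product
          of \<open>T x\<close> and \<open>T e\<close> is evaluated once by moving \<open>T\<close>
          away from \<open>e\<close> and once by moving it away from \<open>x\<close>.\<close>
        have "cinner (T x) (T e) = of_real ((norm (T e))\<^sup>2) * cinner x e"
          by (rule cinner_eigensystem[OF M T E e x(1)])
        moreover have "cinner (T x) (T e) = of_real (s\<^sup>2) * cinner x e"
          using cinner_adj_on_left[OF M T eM bounded_onD(1)[OF T x(1)]] x(2)
          by (simp add: cinner_scaleC_left)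
        ultimately have "(of_real ((norm (T e))\<^sup>2) - of_real (s\<^sup>2)) * cinner x e = 0"
          unfolding left_diff_distrib by (metis eq_iff_diff_eq_0)
        moreover have "(norm (T e))\<^sup>2 \<noteq> s\<^sup>2"
          using False s by (simp add: power2_eq_iff_nonneg)
        then have "(of_real ((norm (T e))\<^sup>2) :: complex) \<noteq> of_real (s\<^sup>2)"
          using of_real_eq_iff by blast
        ultimately have "cinner x e = 0" by (metis eq_iff_diff_eq_0 mult_eq_0_iff)
        moreover have "cinner (\<Sum>f\<in>Es s. cinner x f *\<^sub>C f) e = 0"
          unfolding cinner_sum_left cinner_scaleC_left
          using on e False by (intro sum.neutral) (auto simp: orthonormal_def Es_def)
        ultimately show ?thesis by (simp add: y_def cinner_diff_left)
      qed
    qed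
    then have "x = (\<Sum>f\<in>Es s. cinner x f *\<^sub>C f)" by (simp add: y_def)
    also have "\<dots> \<in> h2.span (Es s)" by (intro h2.span_sum h2.span_scale h2.span_base)
    finally show "x \<in> h2.span (Es s)" .
  qed
  show ?thesis
  proof (rule nonneg_bdd_above_summable_on)
    show "bdd_above (sum (\<lambda>s. real (singular_mult M T s) * s powr p) ` {S. S \<subseteq> {0<..} \<and> finite S})"
    proof (rule bdd_aboveI2[where M = B])
      fix S :: "real set"
      assume "S \<in> {S. S \<subseteq> {0<..} \<and> finite S}"
      then have S: "finite S" "\<And>s. s \<in> S \<Longrightarrow> 0 < s" by auto
      have "(\<Sum>s\<in>S. real (singular_mult M T s) * s powr p) \<le> (\<Sum>s\<in>S. real (card (Es s)) * s powr p)"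
        by (intro sum_mono mult_right_mono) (use S mult_le in auto)
      also have "\<dots> = (\<Sum>s\<in>S. \<Sum>e\<in>Es s. norm (T e) powr p)"
        by (intro sum.cong) (simp_all add: Es_def)
      also have "\<dots> = (\<Sum>e\<in>(\<Union>s\<in>S. Es s). norm (T e) powr p)"
        by (subst sum.UNION_disjoint) (use S fin in \<open>auto simp: Es_def\<close>)
      also have "\<dots> \<le> B" by (intro bound) (use S fin in \<open>auto simp: Es_def\<close>)
      finally show "(\<Sum>s\<in>S. real (singular_mult M T s) * s powr p) \<le> B" .
    qed
  qed simp
qed

section \<open>Block diagonal operators\<close>

text \<open>The monomial basis vector with coefficient 1. Its norm is the square root of its weight,
  so these vectors are orthogonal but not normalized.\<close>

definition unit_h2 :: "mono \<times> nat \<Rightarrow> h2"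
  where "unit_h2 k = Abs_h2 (\<lambda>l. if l = k then 1 else 0)"

lemma h2_coeff_unit: "h2_coeff (unit_h2 k) l = (if l = k then 1 else 0)"
proof -
  let ?g = "\<lambda>l. weight (fst l) * (cmod (if l = k then 1 else 0))\<^sup>2"
  have "?g summable_on {k}" by simp
  also have "?g summable_on {k} \<longleftrightarrow> ?g summable_on UNIV"
    by (rule summable_on_cong_neutral) auto
  finally show ?thesis by (simp add: unit_h2_def Abs_h2_inverse)
qed

lemma h2_coeff_sum: "h2_coeff (\<Sum>a\<in>A. f a) k = (\<Sum>a\<in>A. h2_coeff (f a) k)"
  by (induction A rule: infinite_finite_induct) (simp_all add: h2_coeff_simps)

lemma finite_support_expansion:
  assumes "finite K" "proj K x = x"
  shows "x = (\<Sum>k\<in>K. h2_coeff x k *\<^sub>C unit_h2 k)"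
proof (rule h2_eqI)
  fix l
  have "h2_coeff x l = (if l \<in> K then h2_coeff x l else 0)"
    using assms(2) h2_coeff_proj[of K x l] by metis
  also have "\<dots> = (\<Sum>k\<in>K. if l = k then h2_coeff x k else 0)" using assms(1) by simp
  also have "\<dots> = h2_coeff (\<Sum>k\<in>K. h2_coeff x k *\<^sub>C unit_h2 k) l"
    unfolding h2_coeff_sum h2_coeff_simps h2_coeff_unit by (intro sum.cong) auto
  finally show "h2_coeff x l = h2_coeff (\<Sum>k\<in>K. h2_coeff x k *\<^sub>C unit_h2 k) l" .
qed

lemma independent_finite_support:
  assumes "finite K" "h2.independent E" "\<And>x. x \<in> E \<Longrightarrow> proj K x = x"
  shows "card E \<le> card K"
proof -
  have "E \<subseteq> h2.span (unit_h2 ` K)"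
  proof
    fix x
    assume "x \<in> E"
    show "x \<in> h2.span (unit_h2 ` K)"
      by (subst finite_support_expansion[OF assms(1) assms(3)[OF \<open>x \<in> E\<close>]])
        (intro h2.span_sum h2.span_scale h2.span_base imageI)
  qed
  then have "card E \<le> card (unit_h2 ` K)"
    using h2.independent_span_bound assms(1,2) by blast
  also have "\<dots> \<le> card K" using assms(1) by (rule card_image_le)
  finally show ?thesis .
qed

lemma closed_proj_eq: "closed {x. proj K x = x}"
  by (intro closed_Collect_eq linear_continuous_on[OF bounded_linear_proj] continuous_on_id)

text \<open>Heine-Borel for finitely many coordinates, by induction on their number: the new
  coordinate runs through a compact disc, the set lies in a sum of two compact sets, and it is
  closed.\<close>

lemma compact_finite_support:
  assumes "finite K"
  shows "compact {x. proj K x = x \<and> norm x \<le> R}"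
  using assms
proof induction
  case empty
  have "{x :: h2. proj {} x = x \<and> norm x \<le> R} \<subseteq> {0}" by auto
  then show ?case by (meson finite.emptyI finite.insertI finite_imp_compact finite_subset)
next
  case (insert k K)
  \<comment> \<open>A single coefficient satisfies sqrt(weight) * |coefficient| \<le> norm x \<le>
    R.\<close>
  define Q where "Q = R / sqrt (weight (fst k))"
  define A where "A = (\<lambda>c. c *\<^sub>C unit_h2 k) ` cball 0 Q"
  define S where "S = {a + y |a y. a \<in> A \<and> y \<in> {x. proj K x = x \<and> norm x \<le> R}}"
  have "compact A"
    unfolding A_def
    by (intro compact_continuous_image linear_continuous_on bounded_linear_scaleC_left compact_cball)
  then have "compact S" unfolding S_def by (intro compact_sums insert.IH)
  moreover have "{x. proj (insert k K) x = x \<and> norm x \<le> R} \<subseteq> S"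
  proof
    fix x
    assume "x \<in> {x. proj (insert k K) x = x \<and> norm x \<le> R}"
    then have x: "proj (insert k K) x = x" "norm x \<le> R" by auto
    have "x = proj ({k} \<union> K) x" using x(1) by simp
    also have "\<dots> = proj {k} x + proj K x"
      using insert.hyps by (intro proj_Un_disjoint) auto
    also have "proj {k} x = h2_coeff x k *\<^sub>C unit_h2 k"
      by (rule h2_eqI) (simp add: h2_coeff_proj h2_coeff_simps h2_coeff_unit)
    finally have dec: "x = h2_coeff x k *\<^sub>C unit_h2 k + proj K x" .
    have "weight (fst k) * (cmod (h2_coeff x k))\<^sup>2 \<le> (norm x)\<^sup>2"
      using sum_le_norm_h2_sq[of "{k}" x] by simp
    also have "\<dots> \<le> R\<^sup>2" using x(2) by (intro power_mono) auto
    finally have "sqrt (weight (fst k) * (cmod (h2_coeff x k))\<^sup>2) \<le> sqrt (R\<^sup>2)"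
      by (rule real_sqrt_le_mono)
    then have "sqrt (weight (fst k)) * cmod (h2_coeff x k) \<le> R"
      using order_trans[OF norm_ge_zero x(2)] by (simp add: real_sqrt_mult)
    then have "cmod (h2_coeff x k) \<le> Q"
      using weight_pos[of "fst k"] by (simp add: Q_def field_simps)
    then have "h2_coeff x k *\<^sub>C unit_h2 k \<in> A" unfolding A_def by (intro imageI) simp
    moreover have "norm (proj K x) \<le> R" using norm_proj_le x(2) order_trans by blast
    ultimately show "x \<in> S"
      unfolding S_def mem_Collect_eq
      by (intro exI[of _ "h2_coeff x k *\<^sub>C unit_h2 k"] exI[of _ "proj K x"] conjI dec proj_idem)
  qed
  moreover have "closed {x. proj (insert k K) x = x \<and> norm x \<le> R}"
    by (intro closed_Collect_conj closed_proj_eq closed_Collect_le continuous_intros)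
  ultimately show ?case
    using compact_Int_closed[of S "{x. proj (insert k K) x = x \<and> norm x \<le> R}"]
    by (simp add: Int_absorb1)
qed

text \<open>The sets \<open>\<kappa> n\<close> need not cover all indices. For the quadratic ideal
  they describe only the part that is linear in the new variables.\<close>

locale graded =
  fixes M :: "h2 set" and \<kappa> :: "nat \<Rightarrow> (mono \<times> nat) set"
  assumes csubspace: "csubspace M"
    and proj_mem: "x \<in> M \<Longrightarrow> proj (\<kappa> n) x \<in> M"
    and finite_supp: "finite (\<kappa> n)"
    and disjoint_supp: "m \<noteq> n \<Longrightarrow> \<kappa> m \<inter> \<kappa> n = {}"
begin

definition block :: "nat \<Rightarrow> h2 set"
  where "block n = {x \<in> M. proj (\<kappa> n) x = x}"

lemma blockD: "x \<in> block n \<Longrightarrow> x \<in> M" "x \<in> block n \<Longrightarrow> proj (\<kappa> n) x = x"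
  by (simp_all add: block_def)

lemma proj_in_block: "x \<in> M \<Longrightarrow> proj (\<kappa> n) x \<in> block n"
  by (simp add: block_def proj_mem)

lemma csubspace_block: "csubspace (block n)"
proof -
  have "h2.subspace (block n)"
    by (rule h2.subspaceI) (auto simp: block_def csubspaceD[OF csubspace] proj_add proj_scaleC)
  moreover have "closed (block n)"
    using closed_Int[OF csubspaceD(2)[OF csubspace] closed_proj_eq[of "\<kappa> n"]]
    by (simp add: block_def Int_def)
  ultimately show ?thesis by (simp add: csubspace_def)
qed

lemma cinner_blocks:
  assumes "x \<in> block m" "y \<in> block n" "m \<noteq> n"
  shows "cinner x y = 0"
proof -
  have "cinner x y = cinner (proj (\<kappa> m) x) (proj (\<kappa> n) y)" using assms by (simp add: blockD)
  also have "\<dots> = cinner x (proj (\<kappa> m \<inter> \<kappa> n) y)" by (simp add: cinner_proj_left proj_proj)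
  finally show ?thesis by (simp add: disjoint_supp[OF assms(3)])
qed

lemma proj_partial_mem: "x \<in> M \<Longrightarrow> proj (\<Union>n<m. \<kappa> n) x \<in> M"
  and norm_proj_partial_sq: "(norm (proj (\<Union>n<m. \<kappa> n) x))\<^sup>2 = (\<Sum>n<m. (norm (proj (\<kappa> n) x))\<^sup>2)"
proof -
  have step: "proj (\<Union>n<Suc m. \<kappa> n) y = proj (\<Union>n<m. \<kappa> n) y + proj (\<kappa> m) y" for y m
  proof -
    have "(\<Union>n<m. \<kappa> n) \<inter> \<kappa> m = {}" using disjoint_supp by (fastforce dest: less_imp_neq)
    then show ?thesis by (simp add: lessThan_Suc Un_commute proj_Un_disjoint[symmetric])
  qed
  show "x \<in> M \<Longrightarrow> proj (\<Union>n<m. \<kappa> n) x \<in> M"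
    by (induction m) (simp_all add: step csubspaceD[OF csubspace] proj_mem)
  show "(norm (proj (\<Union>n<m. \<kappa> n) x))\<^sup>2 = (\<Sum>n<m. (norm (proj (\<kappa> n) x))\<^sup>2)"
  proof (induction m)
    case (Suc m)
    have "(\<Union>n<m. \<kappa> n) \<inter> \<kappa> m = {}" using disjoint_supp by (fastforce dest: less_imp_neq)
    then have "cinner (proj (\<Union>n<m. \<kappa> n) x) (proj (\<kappa> m) x) = 0"
      by (simp add: cinner_proj_left proj_proj)
    from norm_sq_add_orthogonal[OF this] show ?case by (simp add: step Suc)
  qed simp
qed

end

locale graded_operator = graded +
  fixes T :: "h2 \<Rightarrow> h2"
  assumes bounded: "bounded_on M T"
    and proj_T: "x \<in> M \<Longrightarrow> proj (\<kappa> n) (T x) = T (proj (\<kappa> n) x)"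
begin

lemma T_block: "x \<in> block n \<Longrightarrow> T x \<in> block n"
  using proj_T[of x n] bounded_onD(1)[OF bounded] by (simp add: block_def)

lemma adj_T_block: "x \<in> block n \<Longrightarrow> adj_on M T x \<in> block n"
  using adj_on_intertwine[OF csubspace bounded _ proj_mem proj_mem proj_T, of x n]
    adj_on_mem[OF csubspace bounded]
  by (simp add: block_def)

text \<open>An eigenvector orthogonal to the previous ones maximizes \<open>\<parallel>T v\<parallel>\<close> on the unit sphere.\<close>

lemma block_eigensystem_exists:
  obtains E where "finite E" "eigensystem M T E" "E \<subseteq> block n" "block n \<subseteq> h2.span E"
proof -
  let ?Q = "\<lambda>x. adj_on M T (T x)"
  note V = csubspaceD[OF csubspace_block[of n]]
  note inM = blockD(1)
  have selfadj: "cinner x (?Q y) = cinner (T x) (T y)" if "x \<in> M" "y \<in> M" for x y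
    using cinner_adj_on[OF csubspace bounded bounded_onD(1)[OF bounded that(2)] that(1)] by simp
  show ?thesis
  proof (rule orthonormal_basis_exists[where V = "block n" and n = "card (\<kappa> n)"
      and \<Phi> = "\<lambda>e. ?Q e = of_real ((norm (T e))\<^sup>2) *\<^sub>C e"])
    show "card E \<le> card (\<kappa> n)" if "finite E" "orthonormal E" "E \<subseteq> block n" for E
      using that blockD by (intro independent_finite_support[OF finite_supp] orthonormal_independent) auto
  next
    fix E
    assume E: "finite E" "orthonormal E" "E \<subseteq> block n"
      "\<forall>e\<in>E. ?Q e = of_real ((norm (T e))\<^sup>2) *\<^sub>C e" "\<not> block n \<subseteq> h2.span E"
    \<comment> \<open>The orthogonal complement of the vectors found so far. Its unit sphere is
      compact by finite support, so \<open>norm (T x)\<close> attains its maximum there.\<close>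
    define W where "W = {x \<in> block n. \<forall>e\<in>E. cinner x e = 0}"
    have W_closed: "closed W"
    proof -
      have "closed {x. cinner x e = 0}" for e
        by (intro closed_Collect_eq linear_continuous_on[OF bounded_linear_cinner_left] continuous_on_const)
      then have "closed (block n \<inter> (\<Inter>e\<in>E. {x. cinner x e = 0}))"
        using V(2) by (intro closed_Int closed_INT) auto
      also have "block n \<inter> (\<Inter>e\<in>E. {x. cinner x e = 0}) = W" by (auto simp: W_def)
      finally show ?thesis .
    qed
    have "compact (W \<inter> sphere 0 1)"
    proof -
      have "compact ({x. proj (\<kappa> n) x = x \<and> norm x \<le> 1} \<inter> (W \<inter> sphere 0 1))"
        by (intro compact_Int_closed compact_finite_support finite_supp closed_Int W_closed)
          (simp add: sphere_def closed_Collect_eq continuous_intros)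
      also have "{x. proj (\<kappa> n) x = x \<and> norm x \<le> 1} \<inter> (W \<inter> sphere 0 1) = W \<inter> sphere 0 1"
        by (auto simp: W_def block_def)
      finally show ?thesis .
    qed
    moreover obtain v0 where "v0 \<in> block n" "norm v0 = 1" "\<forall>e\<in>E. cinner v0 e = 0"
      using exists_unit_vector_orthogonal[OF V(3) E(2,1,3,5)] by blast
    then have "W \<inter> sphere 0 1 \<noteq> {}" by (auto simp: W_def)
    moreover have "continuous_on (W \<inter> sphere 0 1) (\<lambda>x. norm (T x))"
      by (intro continuous_on_norm continuous_on_subset[OF bounded_on_continuous_on[OF csubspace bounded]])
        (auto simp: W_def block_def)
    ultimately obtain v where v: "v \<in> W" "norm v = 1"
      and max: "\<forall>x\<in>W \<inter> sphere 0 1. norm (T x) \<le> norm (T v)"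
      using continuous_attains_sup[of "W \<inter> sphere 0 1" "\<lambda>x. norm (T x)"] by auto
    define s where "s = norm (T v)"
    have W_sub: "x + y \<in> W" "c *\<^sub>C x \<in> W" if "x \<in> W" "y \<in> W" for x y c
      using that V(4,6) by (auto simp: W_def cinner_add_left cinner_scaleC_left)
    have WM: "x \<in> M" if "x \<in> W" for x using that inM by (auto simp: W_def)
    have bound: "(norm (T x))\<^sup>2 \<le> s\<^sup>2 * (norm x)\<^sup>2" if x: "x \<in> W" for x
    proof (cases "x = 0")
      case True
      then show ?thesis using bounded_on_zero_arg[OF csubspace bounded] by simp
    next
      case False
      define c where "c = complex_of_real (1 / norm x)"
      have c: "cmod c = 1 / norm x" by (simp add: c_def norm_divide)
      have "norm (T (c *\<^sub>C x)) \<le> s"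
        unfolding s_def using W_sub(2)[OF x x] False by (intro max[rule_format]) (simp add: norm_scaleC c)
      then have "norm (T x) \<le> s * norm x"
        using False by (simp add: bounded_onD(3)[OF bounded WM[OF x]] norm_scaleC c field_simps)
      then have "(norm (T x))\<^sup>2 \<le> (s * norm x)\<^sup>2" by (intro power_mono) auto
      then show ?thesis by (simp add: power_mult_distrib)
    qed
    \<comment> \<open>The defect of the eigenvector equation for \<open>v\<close>. It is again
      orthogonal to \<open>E\<close> because the members of \<open>E\<close> are already
      eigenvectors, so it is an admissible direction of variation.\<close>
    define u where "u = of_real (s\<^sup>2) *\<^sub>C v - ?Q v"
    have vB: "v \<in> block n" using v by (simp add: W_def)
    have uB: "u \<in> block n"
      unfolding u_def using vB by (intro V(5,6) adj_T_block T_block)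
    have "u \<in> W"
    proof -
      have "cinner u e = 0" if "e \<in> E" for e
      proof -
        have eM: "e \<in> M" using that E inM by blast
        have "cinner (?Q v) e = cinner (T v) (T e)"
          by (rule cinner_adj_on_left[OF csubspace bounded eM bounded_onD(1)[OF bounded WM[OF v(1)]]])
        also have "\<dots> = cinner v (?Q e)" by (rule selfadj[symmetric, OF WM[OF v(1)] eM])
        also have "\<dots> = 0" using E(4) that v(1) by (simp add: cinner_scaleC_right W_def)
        finally show ?thesis
          using that v(1) by (simp add: u_def cinner_diff_left cinner_scaleC_left W_def)
      qed
      then show ?thesis using uB by (simp add: W_def)
    qed
    \<comment> \<open>On \<open>W\<close> the form s^2 * (norm x)^2 - (norm (T x))^2 is nonnegative
      and it vanishes at \<open>v\<close>. Along v + t * u its linear coefficient is 2 * (norm u)^2,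
      which must be 0.\<close>
    have "(norm u)\<^sup>2 = 0"
    proof (rule linear_term_zero)
      fix t :: real
      have tu: "t *\<^sub>R u \<in> W" using W_sub(2)[OF \<open>u \<in> W\<close> \<open>u \<in> W\<close>] by (simp add: scaleR_scaleC)
      have T_eq: "T (v + t *\<^sub>R u) = T v + t *\<^sub>R T u"
        using bounded_onD[OF bounded] WM[OF v(1)] WM[OF \<open>u \<in> W\<close>] WM[OF tu] by (simp add: scaleR_scaleC)
      have "inner (T u) (T v) = inner u (?Q v)"
        using selfadj[OF WM[OF \<open>u \<in> W\<close>] WM[OF v(1)]] by (simp add: inner_h2_def)
      then have ip: "s\<^sup>2 * inner v u - inner (T v) (T u) = (norm u)\<^sup>2"
      proof -
        have u: "u = s\<^sup>2 *\<^sub>R v - ?Q v" by (simp add: u_def scaleR_scaleC)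
        have "inner u u = s\<^sup>2 * inner u v - inner u (?Q v)"
          by (subst (2) u) (simp add: inner_diff_right)
        then show ?thesis
          using \<open>inner (T u) (T v) = inner u (?Q v)\<close>
          by (simp add: power2_norm_eq_inner inner_commute)
      qed
      have "(norm (T (v + t *\<^sub>R u)))\<^sup>2 \<le> s\<^sup>2 * (norm (v + t *\<^sub>R u))\<^sup>2"
        by (rule bound[OF W_sub(1)[OF v(1) tu]])
      moreover have "(norm (T (v + t *\<^sub>R u)))\<^sup>2 = s\<^sup>2 + 2 * t * inner (T v) (T u) + t\<^sup>2 * (norm (T u))\<^sup>2"
        unfolding T_eq s_def
        by (simp add: power2_norm_eq_inner inner_add inner_commute power2_eq_square[of t])
      moreover have "(norm (v + t *\<^sub>R u))\<^sup>2 = 1 + 2 * t * inner v u + t\<^sup>2 * (norm u)\<^sup>2"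
        using v(2) dot_square_norm[of v]
        by (simp add: power2_norm_eq_inner inner_add inner_commute power2_eq_square[of t])
      ultimately have "0 \<le> 2 * t * (s\<^sup>2 * inner v u - inner (T v) (T u))
          + t\<^sup>2 * (s\<^sup>2 * (norm u)\<^sup>2 - (norm (T u))\<^sup>2)"
        by (simp add: algebra_simps)
      then show "0 \<le> 2 * t * (norm u)\<^sup>2 + t\<^sup>2 * (s\<^sup>2 * (norm u)\<^sup>2 - (norm (T u))\<^sup>2)"
        unfolding ip .
    qed
    then have "?Q v = of_real ((norm (T v))\<^sup>2) *\<^sub>C v" by (simp add: u_def s_def)
    with v show "\<exists>v\<in>block n. norm v = 1 \<and> (\<forall>e\<in>E. cinner v e = 0) \<and>
        ?Q v = of_real ((norm (T v))\<^sup>2) *\<^sub>C v"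
      by (auto simp: W_def)
  next
    fix E
    assume E: "finite E" "orthonormal E" "E \<subseteq> block n" "block n \<subseteq> h2.span E"
      "\<forall>e\<in>E. ?Q e = of_real ((norm (T e))\<^sup>2) *\<^sub>C e"
    then have "eigensystem M T E" using inM by (auto simp: eigensystem_def)
    with E show thesis using that by blast
  qed
qed

lemma eigensystem_Union:
  assumes "\<And>n. eigensystem M T (E n)" "\<And>n. E n \<subseteq> block n"
  shows "eigensystem M T (\<Union>n. E n)"
proof -
  have "cinner e f = 0" if "e \<in> E m" "f \<in> E n" "e \<noteq> f" for e f m n
  proof (cases "m = n")
    case True
    then show ?thesis using that assms(1)[of n] by (simp add: eigensystem_def orthonormal_def)
  next
    case False
    then show ?thesis using that assms(2) cinner_blocks by blast
  qed
  moreover have "(\<Union>n. E n) \<subseteq> M" using assms(1) unfolding eigensystem_def by blast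
  ultimately show ?thesis using assms(1) by (auto simp: eigensystem_def orthonormal_def simp del: UN_subset_iff)
qed

lemma eigensystem_blocks_disjoint:
  assumes "\<And>n. eigensystem M T (E n)" "\<And>n. E n \<subseteq> block n" "m \<noteq> n"
  shows "E m \<inter> E n = {}"
proof (rule equals0I)
  fix e
  assume e: "e \<in> E m \<inter> E n"
  then have "cinner e e = 0" using assms cinner_blocks by blast
  moreover have "norm e = 1" using assms(1)[of m] e by (auto simp: eigensystem_def orthonormal_def)
  ultimately show False by (simp add: cinner_self_norm)
qed

text \<open>Unit vectors from distinct blocks with images longer than \<epsilon> have mutually
  orthogonal images, which are therefore \<epsilon>-separated. Compactness allows only finitely many
  blocks of this kind.\<close>

lemma compact_on_blocks_vanish:
  assumes c: "compact_on M T" and \<epsilon>: "0 < \<epsilon>"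
  obtains N where "\<And>n x. N \<le> n \<Longrightarrow> x \<in> block n \<Longrightarrow> norm (T x) \<le> \<epsilon> * norm x"
proof -
  define bad where "bad = {n. \<exists>x\<in>block n. norm x = 1 \<and> \<epsilon> < norm (T x)}"
  have "\<forall>n. \<exists>x. n \<in> bad \<longrightarrow> x \<in> block n \<and> norm x = 1 \<and> \<epsilon> < norm (T x)" by (auto simp: bad_def)
  from choice[OF this] obtain X
    where X: "\<And>n. n \<in> bad \<Longrightarrow> X n \<in> block n \<and> norm (X n) = 1 \<and> \<epsilon> < norm (T (X n))" by blast
  obtain b where b: "\<forall>A. finite A \<and> A \<subseteq> M \<and> (\<forall>x\<in>A. norm x \<le> 1) \<and>
      (\<forall>x\<in>A. \<forall>y\<in>A. x \<noteq> y \<longrightarrow> \<epsilon> \<le> dist (T x) (T y)) \<longrightarrow> card A \<le> b"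
    by (rule compact_on_separated_card_bound[OF c \<epsilon>])
  have far: "\<epsilon> \<le> dist (T (X m)) (T (X n))" if mn: "m \<in> bad" "n \<in> bad" "m \<noteq> n" for m n
  proof -
    have "T (X m) \<in> block m" "T (X n) \<in> block n" using X mn T_block by auto
    then have "cinner (T (X m)) (T (X n)) = 0" using cinner_blocks mn(3) by blast
    then have "cinner (T (X m)) (- T (X n)) = 0"
      using cinner_diff_right[of "T (X m)" 0 "T (X n)"] by simp
    from norm_sq_add_orthogonal[OF this]
    have "(norm (T (X m)))\<^sup>2 \<le> (dist (T (X m)) (T (X n)))\<^sup>2" by (simp add: dist_norm)
    then have "norm (T (X m)) \<le> dist (T (X m)) (T (X n))" by (rule power2_le_imp_le) simp
    then show ?thesis using X[OF mn(1)] by linarith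
  qed
  have inj: "inj_on X bad"
  proof (rule inj_onI, rule ccontr)
    fix m n
    assume "m \<in> bad" "n \<in> bad" "X m = X n" "m \<noteq> n"
    then show False using far[of m n] \<epsilon> by simp
  qed
  have "finite bad"
  proof (rule finite_if_finite_subsets_card_bdd[THEN conjunct1])
    fix F
    assume F: "F \<subseteq> bad" "finite F"
    have "card (X ` F) \<le> b"
    proof (rule b[rule_format], intro conjI ballI impI)
      show "finite (X ` F)" using F by simp
      show "X ` F \<subseteq> M" using F X blockD(1) by blast
      show "norm x \<le> 1" if "x \<in> X ` F" for x using that F X by fastforce
      show "\<epsilon> \<le> dist (T x) (T y)" if "x \<in> X ` F" "y \<in> X ` F" "x \<noteq> y" for x y
        using that F far by blast
    qed
    then show "card F \<le> b" using card_image[OF inj_on_subset[OF inj F(1)]] by simp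
  qed
  then obtain N where N: "\<forall>n\<in>bad. n < N" unfolding finite_nat_set_iff_bounded by blast
  show ?thesis
  proof (rule that[of N])
    fix n x
    assume n: "N \<le> n" and x: "x \<in> block n"
    show "norm (T x) \<le> \<epsilon> * norm x"
    proof (cases "x = 0")
      case True
      then show ?thesis using bounded_on_zero_arg[OF csubspace bounded] by simp
    next
      case False
      define c where "c = complex_of_real (1 / norm x)"
      have c: "cmod c = 1 / norm x" by (simp add: c_def norm_divide)
      have "n \<notin> bad" using N n by fastforce
      moreover have "c *\<^sub>C x \<in> block n" "norm (c *\<^sub>C x) = 1"
        using csubspaceD(6)[OF csubspace_block x] False by (simp_all add: norm_scaleC c)
      ultimately have "norm (T (c *\<^sub>C x)) \<le> \<epsilon>" by (force simp: bad_def)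
      then show ?thesis
        using False by (simp add: bounded_onD(3)[OF bounded blockD(1)[OF x]] norm_scaleC c field_simps)
    qed
  qed
qed

end

text \<open>Exhaustion lets estimates on blocks control the whole operator. It is demanded only of
  the operator to which properties are transferred.\<close>

locale full_graded_operator = graded_operator +
  assumes exhaust: "x \<in> M \<Longrightarrow> proj (\<Union>n. \<kappa> n) x = x"
begin

text \<open>The square of the norm is a supremum of finite coefficient sums, and a finite set of
  indices meets only finitely many \<open>\<kappa> n\<close>; no convergence of the partial
  projections is used.\<close>

lemma norm_le_if_partial:
  assumes x: "x \<in> M" and le: "\<And>m. norm (proj (\<Union>n<m. \<kappa> n) x) \<le> C" and C: "0 \<le> C"
  shows "norm x \<le> C"
proof -
  have "(norm x)\<^sup>2 \<le> C\<^sup>2"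
    unfolding norm_h2_sq
  proof (rule infsum_le_finite_sums[OF h2_summable])
    fix S :: "(mono \<times> nat) set"
    assume S: "finite S"
    have "\<exists>m. S \<inter> (\<Union>n. \<kappa> n) \<subseteq> (\<Union>n<m. \<kappa> n)"
      using S
    proof induction
      case (insert k S)
      then obtain m where m: "S \<inter> (\<Union>n. \<kappa> n) \<subseteq> (\<Union>n<m. \<kappa> n)" by blast
      show ?case
      proof (cases "k \<in> (\<Union>n. \<kappa> n)")
        case True
        then obtain n where n: "k \<in> \<kappa> n" by blast
        have "insert k S \<inter> (\<Union>n. \<kappa> n) \<subseteq> (\<Union>i<max m (Suc n). \<kappa> i)"
        proof
          fix l
          assume l: "l \<in> insert k S \<inter> (\<Union>n. \<kappa> n)"
          show "l \<in> (\<Union>i<max m (Suc n). \<kappa> i)"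
          proof (cases "l = k")
            case False
            then obtain i where "i < m" "l \<in> \<kappa> i" using l m by blast
            then show ?thesis by (auto intro!: bexI[of _ i])
          qed (use n in \<open>auto intro!: bexI[of _ n]\<close>)
        qed
        then show ?thesis by blast
      qed (use m in auto)
    qed auto
    then obtain m where m: "S \<inter> (\<Union>n. \<kappa> n) \<subseteq> (\<Union>n<m. \<kappa> n)" by blast
    have z: "h2_coeff x k = 0" if "k \<notin> (\<Union>n. \<kappa> n)" for k
      using h2_coeff_proj[of "\<Union>n. \<kappa> n" x k] exhaust[OF x] that by simp
    have "(\<Sum>k\<in>S. weight (fst k) * (cmod (h2_coeff x k))\<^sup>2)
        = (\<Sum>k\<in>S. weight (fst k) * (cmod (h2_coeff (proj (\<Union>n<m. \<kappa> n) x) k))\<^sup>2)"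
    proof (rule sum.cong[OF refl])
      fix k
      assume "k \<in> S"
      then have "h2_coeff (proj (\<Union>n<m. \<kappa> n) x) k = h2_coeff x k"
        using m z[of k] by (cases "k \<in> (\<Union>n. \<kappa> n)") (auto simp: h2_coeff_proj)
      then show "weight (fst k) * (cmod (h2_coeff x k))\<^sup>2
          = weight (fst k) * (cmod (h2_coeff (proj (\<Union>n<m. \<kappa> n) x) k))\<^sup>2" by simp
    qed
    also have "\<dots> \<le> (norm (proj (\<Union>n<m. \<kappa> n) x))\<^sup>2" by (rule sum_le_norm_h2_sq[OF S])
    also have "\<dots> \<le> C\<^sup>2" by (intro power_mono le) simp
    finally show "(\<Sum>k\<in>S. weight (fst k) * (cmod (h2_coeff x k))\<^sup>2) \<le> C\<^sup>2" .
  qed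
  then show ?thesis using C by (rule power2_le_imp_le)
qed

lemma norm_T_le_if_blocks:
  assumes x: "x \<in> M" and le: "\<And>n. norm (T (proj (\<kappa> n) x)) \<le> C * norm (proj (\<kappa> n) x)" and C: "0 \<le> C"
  shows "norm (T x) \<le> C * norm x"
proof (rule norm_le_if_partial)
  show "T x \<in> M" by (rule bounded_onD(1)[OF bounded x])
  show "0 \<le> C * norm x" using C by simp
  fix m
  have "(norm (proj (\<Union>n<m. \<kappa> n) (T x)))\<^sup>2 = (\<Sum>n<m. (norm (T (proj (\<kappa> n) x)))\<^sup>2)"
    by (simp add: norm_proj_partial_sq proj_T[OF x])
  also have "\<dots> \<le> (\<Sum>n<m. (C * norm (proj (\<kappa> n) x))\<^sup>2)"
    by (intro sum_mono power_mono le) simp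
  also have "\<dots> = (C * norm (proj (\<Union>n<m. \<kappa> n) x))\<^sup>2"
    by (simp add: power_mult_distrib norm_proj_partial_sq sum_distrib_left)
  finally have "norm (proj (\<Union>n<m. \<kappa> n) (T x)) \<le> C * norm (proj (\<Union>n<m. \<kappa> n) x)"
    by (rule power2_le_imp_le) (simp add: C)
  also have "\<dots> \<le> C * norm x" by (intro mult_left_mono norm_proj_le C)
  finally show "norm (proj (\<Union>n<m. \<kappa> n) (T x)) \<le> C * norm x" .
qed

text \<open>Total boundedness of the image of the unit ball: the finitely many low blocks form a
  finite-dimensional piece with compact image, and the remaining blocks contribute a uniformly small
  error.\<close>

lemma compact_onI_blocks:
  assumes vanish: "\<And>\<epsilon>. 0 < \<epsilon> \<Longrightarrow> \<exists>N. \<forall>n\<ge>N. \<forall>x\<in>block n. norm (T x) \<le> \<epsilon> * norm x"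
  shows "compact_on M T"
proof -
  have "\<exists>k. finite k \<and> closure (T ` (M \<inter> cball 0 1)) \<subseteq> (\<Union>x\<in>k. ball x e)" if e: "0 < e" for e
  proof -
    \<comment> \<open>The net costs \<epsilon> and the tail 2 * \<epsilon>, as
      \<open>norm (x - P x)\<close> is at most 2. The closed balls of radius 3 * \<epsilon> contain
      the closure of the image and lie in open balls of radius 4 * \<epsilon>.\<close>
    define \<epsilon> where "\<epsilon> = e / 4"
    have \<epsilon>: "0 < \<epsilon>" using e by (simp add: \<epsilon>_def)
    obtain N where N: "\<And>n x. N \<le> n \<Longrightarrow> x \<in> block n \<Longrightarrow> norm (T x) \<le> \<epsilon> * norm x"
      using vanish[OF \<epsilon>] by blast
    define P where "P = proj (\<Union>n<N. \<kappa> n)"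
    define C where "C = {x. proj (\<Union>n<N. \<kappa> n) x = x \<and> norm x \<le> 1} \<inter> M"
    have "compact C"
      unfolding C_def using csubspaceD(2)[OF csubspace]
      by (intro compact_Int_closed compact_finite_support) (auto simp: finite_supp)
    moreover have "continuous_on C T"
      by (rule continuous_on_subset[OF bounded_on_continuous_on[OF csubspace bounded]]) (simp add: C_def)
    ultimately have "compact (T ` C)" by (rule compact_continuous_image[rotated])
    then obtain k where k: "finite k" "T ` C \<subseteq> (\<Union>x\<in>k. ball x \<epsilon>)"
      using \<epsilon> unfolding compact_eq_totally_bounded by blast
    have near: "T ` (M \<inter> cball 0 1) \<subseteq> (\<Union>x\<in>k. cball x (3 * \<epsilon>))"
    proof
      fix z
      assume "z \<in> T ` (M \<inter> cball 0 1)"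
      then obtain x where x: "x \<in> M" "norm x \<le> 1" "z = T x" by auto
      have Px: "P x \<in> C"
        using x norm_proj_le[of _ x] order_trans proj_partial_mem by (fastforce simp: C_def P_def)
      have PM: "P x \<in> M" using Px by (simp add: C_def)
      obtain c where c: "c \<in> k" "dist c (T (P x)) < \<epsilon>" using k(2) Px by auto
      have yM: "x - P x \<in> M" by (rule csubspaceD(5)[OF csubspace x(1) PM])
      have split: "T x - T (P x) = T (x - P x)"
        using bounded_on_diff_arg[OF csubspace bounded x(1) PM] by simp
      have "norm (T (x - P x)) \<le> \<epsilon> * norm (x - P x)"
      proof (rule norm_T_le_if_blocks[OF yM])
        fix n
        show "norm (T (proj (\<kappa> n) (x - P x))) \<le> \<epsilon> * norm (proj (\<kappa> n) (x - P x))"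
        proof (cases "N \<le> n")
          case True
          then show ?thesis by (rule N[OF _ proj_in_block[OF yM]])
        next
          case False
          then have "proj (\<kappa> n) (x - P x) = 0"
            by (intro h2_eqI) (auto simp: h2_coeff_proj h2_coeff_simps P_def)
          then show ?thesis using bounded_on_zero_arg[OF csubspace bounded] by simp
        qed
      qed (use \<epsilon> in simp)
      also have "norm (x - P x) \<le> 2"
        using norm_triangle_ineq4[of x "P x"] norm_proj_le[of "\<Union>n<N. \<kappa> n" x] x(2) by (simp add: P_def)
      finally have "dist (T (P x)) (T x) \<le> \<epsilon> * 2"
        using \<epsilon> by (simp add: dist_norm split norm_minus_commute[of "T (P x)"])
      then have "dist c (T x) \<le> 3 * \<epsilon>"
        using dist_triangle[of c "T x" "T (P x)"] c(2) by simp
      with c(1) x(3) show "z \<in> (\<Union>x\<in>k. cball x (3 * \<epsilon>))" by auto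
    qed
    have "closure (T ` (M \<inter> cball 0 1)) \<subseteq> (\<Union>x\<in>k. cball x (3 * \<epsilon>))"
      by (rule closure_minimal[OF near]) (use k(1) in auto)
    also have "\<dots> \<subseteq> (\<Union>x\<in>k. ball x e)"
      using e by (force simp: \<epsilon>_def)
    finally show ?thesis using k(1) by blast
  qed
  then show ?thesis
    unfolding compact_on_def compact_eq_totally_bounded by (simp add: complete_eq_closed)
qed

text \<open>Such an \<open>x\<close> is orthogonal to each of its own block parts. Since
  \<open>proj\<close> is a self-adjoint idempotent, this inner product is the squared norm of the
  part, so all parts vanish.\<close>

lemma eigensystem_Union_total:
  assumes "\<And>n. block n \<subseteq> h2.span (E n)" "x \<in> M" "\<And>e. e \<in> (\<Union>n. E n) \<Longrightarrow> cinner x e = 0"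
  shows "x = 0"
proof -
  have z: "proj (\<kappa> n) x = 0" for n
  proof -
    have "h2.span (E n) \<subseteq> {y. cinner x y = 0}"
      using assms(3)
      by (intro h2.span_minimal h2.subspaceI) (auto simp: cinner_add_right cinner_scaleC_right)
    moreover have "proj (\<kappa> n) x \<in> h2.span (E n)" using assms(1) proj_in_block[OF assms(2)] by blast
    ultimately have "cinner x (proj (\<kappa> n) (proj (\<kappa> n) x)) = 0" by auto
    then have "cinner (proj (\<kappa> n) x) (proj (\<kappa> n) x) = 0" by (simp only: cinner_proj_left)
    then show ?thesis by (simp add: cinner_self_norm)
  qed
  have "norm x \<le> 0"
  proof (rule norm_le_if_partial[OF assms(2)])
    fix m
    have "(norm (proj (\<Union>n<m. \<kappa> n) x))\<^sup>2 = 0" by (simp add: norm_proj_partial_sq z)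
    then show "norm (proj (\<Union>n<m. \<kappa> n) x) \<le> 0" by simp
  qed simp
  then show ?thesis by simp
qed

end

section \<open>Comparison of two block diagonal operators\<close>

lemma powr_add_le:
  fixes a b p :: real
  assumes "0 \<le> a" "0 \<le> b" "0 \<le> p"
  shows "(a + b) powr p \<le> 2 powr p * (a powr p + b powr p)"
proof -
  have "(a + b) powr p \<le> (2 * max a b) powr p" using assms by (intro powr_mono2) auto
  also have "\<dots> = 2 powr p * max a b powr p" using assms by (simp add: powr_mult)
  also have "max a b powr p \<le> a powr p + b powr p" by (simp add: max_def)
  finally show ?thesis by simp
qed

text \<open>The scaling of \<open>W\<close> depends on the degree, hence \<open>cinner_W\<close> is
  stated block by block. The error in \<open>close\<close> is relative to \<open>norm (W x)\<close>,
  so multiplication by sqrt(n + 1) carries the estimate back to \<open>M\<close> with the same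
  factor c / (n + 1).\<close>

locale comparison =
  A: full_graded_operator M \<kappa> T + B: graded_operator N \<mu> S
  for M \<kappa> T N \<mu> S +
  fixes W :: "h2 \<Rightarrow> h2" and c :: real
  assumes W_scaleC: "W (a *\<^sub>C x) = a *\<^sub>C W x"
    and W_block: "x \<in> A.block n \<Longrightarrow> W x \<in> B.block n"
    and cinner_W: "x \<in> A.block n \<Longrightarrow> y \<in> A.block n \<Longrightarrow> cinner (W x) (W y) = cinner x y / of_nat (Suc n)"
    and close: "x \<in> A.block n \<Longrightarrow> norm (W (T x) - S (W x)) \<le> c / real (Suc n) * norm (W x)"
    and c_nonneg: "0 \<le> c"
begin

lemma norm_eq_norm_W:
  assumes "x \<in> A.block n"
  shows "norm x = sqrt (real (Suc n)) * norm (W x)"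
proof -
  have "complex_of_real ((norm (W x))\<^sup>2) = of_real ((norm x)\<^sup>2 / real (Suc n))"
    using cinner_W[OF assms assms] unfolding cinner_self_norm by simp
  then have "(norm (W x))\<^sup>2 = (norm x)\<^sup>2 / real (Suc n)" using of_real_eq_iff by blast
  then have "(norm x)\<^sup>2 = real (Suc n) * (norm (W x))\<^sup>2" by (simp add: field_simps)
  then have "sqrt ((norm x)\<^sup>2) = sqrt (real (Suc n) * (norm (W x))\<^sup>2)" by (rule arg_cong)
  then show ?thesis unfolding real_sqrt_mult by simp
qed

lemma norm_T_le:
  assumes x: "x \<in> A.block n"
  shows "norm (T x) \<le> sqrt (real (Suc n)) * norm (S (W x)) + c / real (Suc n) * norm x"
proof -
  have "norm (W (T x)) \<le> norm (S (W x)) + norm (W (T x) - S (W x))"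
    using norm_triangle_ineq[of "S (W x)" "W (T x) - S (W x)"] by simp
  also have "\<dots> \<le> norm (S (W x)) + c / real (Suc n) * norm (W x)" using close[OF x] by simp
  finally have "sqrt (real (Suc n)) * norm (W (T x))
      \<le> sqrt (real (Suc n)) * (norm (S (W x)) + c / real (Suc n) * norm (W x))"
    by (rule mult_left_mono) simp
  then show ?thesis
    unfolding norm_eq_norm_W[OF A.T_block[OF x]] norm_eq_norm_W[OF x] by (simp add: algebra_simps)
qed

lemma compact_on_transfer:
  assumes "compact_on N S"
  shows "compact_on M T"
proof (rule A.compact_onI_blocks)
  fix \<epsilon> :: real
  assume \<epsilon>: "0 < \<epsilon>"
  then have "0 < \<epsilon> / 2" by simp
  then obtain N1 where N1: "\<And>n y. N1 \<le> n \<Longrightarrow> y \<in> B.block n \<Longrightarrow> norm (S y) \<le> \<epsilon> / 2 * norm y"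
    using B.compact_on_blocks_vanish[OF assms] by metis
  obtain N2 where N2: "c / (\<epsilon> / 2) < real N2" using reals_Archimedean2 by blast
  have "norm (T x) \<le> \<epsilon> * norm x" if n: "max N1 N2 \<le> n" and x: "x \<in> A.block n" for n x
  proof -
    have "c / real (Suc n) \<le> \<epsilon> / 2"
    proof -
      have "c / (\<epsilon> / 2) \<le> real (Suc n)" using N2 n by simp
      then show ?thesis using \<epsilon> by (simp add: field_simps)
    qed
    then have "c / real (Suc n) * norm x \<le> \<epsilon> / 2 * norm x" by (rule mult_right_mono) simp
    moreover have "sqrt (real (Suc n)) * norm (S (W x)) \<le> sqrt (real (Suc n)) * (\<epsilon> / 2 * norm (W x))"
      using n by (intro mult_left_mono N1[OF _ W_block[OF x]]) auto
    then have "sqrt (real (Suc n)) * norm (S (W x)) \<le> \<epsilon> / 2 * norm x"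
      by (simp add: norm_eq_norm_W[OF x])
    ultimately show ?thesis using norm_T_le[OF x] by linarith
  qed
  then show "\<exists>N. \<forall>n\<ge>N. \<forall>x\<in>A.block n. norm (T x) \<le> \<epsilon> * norm x" by blast
qed

lemma schatten_on_transfer:
  assumes sch: "schatten_on p N S" and p: "2 \<le> p"
    and dims: "summable (\<lambda>n. real (card (\<kappa> n)) * (1 / real (Suc n)) powr p)"
  shows "schatten_on p M T"
proof -
  have "\<forall>n. \<exists>E. finite E \<and> eigensystem M T E \<and> E \<subseteq> A.block n \<and> A.block n \<subseteq> h2.span E"
    using A.block_eigensystem_exists by metis
  from choice[OF this] obtain E where E: "\<And>n. finite (E n)" "\<And>n. eigensystem M T (E n)"
    "\<And>n. E n \<subseteq> A.block n" "\<And>n. A.block n \<subseteq> h2.span (E n)" by blast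
  have "\<forall>n. \<exists>C. finite C \<and> eigensystem N S C \<and> C \<subseteq> B.block n \<and> B.block n \<subseteq> h2.span C"
    using B.block_eigensystem_exists by metis
  from choice[OF this] obtain C where C: "\<And>n. finite (C n)" "\<And>n. eigensystem N S (C n)"
    "\<And>n. C n \<subseteq> B.block n" "\<And>n. B.block n \<subseteq> h2.span (C n)" by blast
  have on: "orthonormal (E n)" for n using E(2) by (simp add: eigensystem_def)
  define tot where "tot = (\<Sum>\<^sub>\<infinity>s\<in>{0<..}. real (singular_mult N S s) * s powr p)"
  define dim where "dim n = real (card (\<kappa> n)) * (1 / real (Suc n)) powr p" for n
  \<comment> \<open>The factor 2 powr p comes from splitting the power of a sum, \<open>tot\<close>
    pays for the singular values of \<open>S\<close>, and the series pays for the errors (c / (n +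
    1)) powr p, one for each dimension of block n.\<close>
  define D where "D = 2 powr p * (tot + c powr p * suminf dim)"

  have one: "(\<Sum>e\<in>E n. norm (T e) powr p)
      \<le> 2 powr p * ((\<Sum>f\<in>C n. norm (S f) powr p) + c powr p * dim n)" for n
  proof -
    \<comment> \<open>Rescaling by sqrt(n + 1) makes \<open>W\<close> preserve inner products on
      block n, so the image of an orthonormal system is orthonormal.\<close>
    define V where "V e = of_real (sqrt (real (Suc n))) *\<^sub>C W e" for e
    have V_cinner: "cinner (V x) (V y) = cinner x y" if "x \<in> E n" "y \<in> E n" for x y
    proof -
      have xy: "x \<in> A.block n" "y \<in> A.block n" using that E(3) by auto
      have "cinner (V x) (V y) = of_real (sqrt (real (Suc n)) * sqrt (real (Suc n))) * cinner (W x) (W y)"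
        unfolding V_def cinner_scaleC_left cinner_scaleC_right
        by (simp only: of_real_mult complex_cnj_complex_of_real mult.assoc)
      also have "sqrt (real (Suc n)) * sqrt (real (Suc n)) = real (Suc n)" by simp
      finally show ?thesis unfolding cinner_W[OF xy] by (simp del: of_nat_Suc)
    qed
    have inj: "inj_on V (E n)"
    proof (rule inj_onI)
      fix x y
      assume xy: "x \<in> E n" "y \<in> E n" "V x = V y"
      then have "cinner x y = cinner x x" using V_cinner by metis
      then show "x = y" using orthonormal_cinner[OF on xy(1)] xy by (auto split: if_splits)
    qed
    have V_norm: "norm (V x) = 1" if "x \<in> E n" for x
    proof -
      have "x \<in> A.block n" "norm x = 1" using that E(3) on[of n] by (auto simp: orthonormal_def)
      then show ?thesis using norm_eq_norm_W[of x n] by (simp add: V_def norm_scaleC)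
    qed
    have G_on: "orthonormal (V ` E n)"
      using V_cinner V_norm on[of n] by (auto simp: orthonormal_def)
    have "V e \<in> B.block n" if "e \<in> E n" for e
      unfolding V_def using W_block E(3) that by (intro csubspaceD(6)[OF B.csubspace_block]) auto
    then have G_span: "V ` E n \<subseteq> h2.span (C n)" using C(4) by blast
    have T_le: "norm (T e) \<le> norm (S (V e)) + c / real (Suc n)" if e: "e \<in> E n" for e
    proof -
      have eb: "e \<in> A.block n" "norm e = 1" using e E(3) on[of n] by (auto simp: orthonormal_def)
      have "W e \<in> N" using W_block[OF eb(1)] B.blockD(1) by blast
      then have "norm (S (V e)) = sqrt (real (Suc n)) * norm (S (W e))"
        by (simp add: V_def bounded_onD(3)[OF B.bounded] norm_scaleC)
      then show ?thesis using norm_T_le[OF eb(1)] eb(2) by simp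
    qed
    have "(\<Sum>e\<in>E n. norm (T e) powr p)
        \<le> (\<Sum>e\<in>E n. 2 powr p * (norm (S (V e)) powr p + (c / real (Suc n)) powr p))"
    proof (rule sum_mono)
      fix e
      assume "e \<in> E n"
      then have "norm (T e) powr p \<le> (norm (S (V e)) + c / real (Suc n)) powr p"
        using p by (intro powr_mono2 T_le) auto
      also have "\<dots> \<le> 2 powr p * (norm (S (V e)) powr p + (c / real (Suc n)) powr p)"
        using p c_nonneg by (intro powr_add_le) auto
      finally show "norm (T e) powr p \<le> 2 powr p * (norm (S (V e)) powr p + (c / real (Suc n)) powr p)" .
    qed
    also have "\<dots> = 2 powr p * ((\<Sum>e\<in>E n. norm (S (V e)) powr p)
        + real (card (E n)) * (c / real (Suc n)) powr p)"
      unfolding sum_distrib_left[symmetric] sum.distrib by simp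
    also have "\<dots> \<le> 2 powr p * ((\<Sum>f\<in>C n. norm (S f) powr p) + c powr p * dim n)"
    proof (intro mult_left_mono add_mono)
      have "(\<Sum>e\<in>E n. norm (S (V e)) powr p) = (\<Sum>g\<in>V ` E n. norm (S g) powr p)"
        by (simp add: sum.reindex[OF inj])
      also have "\<dots> \<le> (\<Sum>f\<in>C n. norm (S f) powr p)"
        by (rule sum_norm_powr_le_eigensystem[OF B.csubspace B.bounded C(2,1) _ G_on G_span p])
          (simp add: E(1))
      finally show "(\<Sum>e\<in>E n. norm (S (V e)) powr p) \<le> (\<Sum>f\<in>C n. norm (S f) powr p)" .
      have "card (E n) \<le> card (\<kappa> n)"
        using E(3) A.blockD(2)
        by (intro independent_finite_support[OF A.finite_supp orthonormal_independent[OF on]]) blast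
      then have "real (card (E n)) * (c / real (Suc n)) powr p
          \<le> real (card (\<kappa> n)) * (c / real (Suc n)) powr p"
        by (intro mult_right_mono) auto
      also have "\<dots> = c powr p * dim n"
        using c_nonneg powr_mult[of c "1 / real (Suc n)" p] by (simp add: dim_def)
      finally show "real (card (E n)) * (c / real (Suc n)) powr p \<le> c powr p * dim n" .
    qed simp
    finally show ?thesis .
  qed

  have partial: "(\<Sum>n<m. \<Sum>e\<in>E n. norm (T e) powr p) \<le> D" for m
  proof -
    have "(\<Sum>n<m. \<Sum>e\<in>E n. norm (T e) powr p)
        \<le> (\<Sum>n<m. 2 powr p * ((\<Sum>f\<in>C n. norm (S f) powr p) + c powr p * dim n))"
      by (intro sum_mono one)
    also have "\<dots> = 2 powr p * ((\<Sum>n<m. \<Sum>f\<in>C n. norm (S f) powr p) + c powr p * (\<Sum>n<m. dim n))"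
      by (simp only: sum_distrib_left[symmetric] sum.distrib)
    also have "\<dots> \<le> D"
      unfolding D_def
    proof (intro mult_left_mono add_mono)
      have "(\<Sum>n<m. \<Sum>f\<in>C n. norm (S f) powr p) = (\<Sum>f\<in>(\<Union>n<m. C n). norm (S f) powr p)"
        using C(1) B.eigensystem_blocks_disjoint[OF C(2,3)]
        by (intro sum.UNION_disjoint[symmetric]) auto
      \<comment> \<open>The eigenbases of finitely many blocks together form one finite eigensystem
        of \<open>S\<close>, so the total over all singular values bounds their joint contribution,
        uniformly in \<open>m\<close>.\<close>
      also have "\<dots> \<le> tot"
        unfolding tot_def
      proof (rule schatten_on_sum_eigensystem_le[OF B.csubspace B.bounded sch])
        show "eigensystem N S (\<Union>n<m. C n)"
          by (rule eigensystem_subset[OF B.eigensystem_Union[OF C(2,3)]]) blast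
      qed (use C(1) in auto)
      finally show "(\<Sum>n<m. \<Sum>f\<in>C n. norm (S f) powr p) \<le> tot" .
      have "summable dim" using dims unfolding dim_def .
      from sum_le_suminf[OF this] show "(\<Sum>n<m. dim n) \<le> suminf dim"
        by (auto simp: dim_def)
    qed simp_all
    finally show ?thesis .
  qed

  have "(\<lambda>s. real (singular_mult M T s) * s powr p) summable_on {0<..}"
  proof (rule singular_values_summable_if_eigensystem[OF A.csubspace A.bounded A.eigensystem_Union[OF E(2,3)]])
    fix F
    assume F: "finite F" "F \<subseteq> (\<Union>n. E n)"
    then obtain I where I: "finite I" "F \<subseteq> (\<Union>n\<in>I. E n)"
      using finite_subset_Union[of F "range E"] by (metis finite_subset_image)
    obtain m where m: "I \<subseteq> {..<m}" using I(1) finite_nat_iff_bounded by blast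
    have "(\<Sum>e\<in>F. norm (T e) powr p) \<le> (\<Sum>e\<in>(\<Union>n<m. E n). norm (T e) powr p)"
    proof (rule sum_mono2)
      show "F \<subseteq> (\<Union>n<m. E n)" using I(2) m by blast
    qed (use E(1) in auto)
    also have "\<dots> = (\<Sum>n<m. \<Sum>e\<in>E n. norm (T e) powr p)"
      using E(1) A.eigensystem_blocks_disjoint[OF E(2,3)]
      by (intro sum.UNION_disjoint) auto
    also have "\<dots> \<le> D" by (rule partial)
    finally show "(\<Sum>e\<in>F. norm (T e) powr p) \<le> D" .
  qed (rule A.eigensystem_Union_total[OF E(4)])
  moreover have "compact_on M T" using sch by (intro compact_on_transfer) (simp add: schatten_on_def)
  ultimately show ?thesis by (simp add: schatten_on_def)
qed

end

section \<open>Graded submodules\<close>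

text \<open>Here \<open>d\<close> counts the shifts that respect the grading. It stays the same for
  the ideal in d + r variables, where multiplication by a new variable would leave the part linear
  in the new variables.\<close>

locale shift_graded = graded +
  fixes d :: nat
  assumes Z_mem: "i < d \<Longrightarrow> x \<in> M \<Longrightarrow> Z i x \<in> M"
    and proj_Suc_Z: "i < d \<Longrightarrow> proj (\<kappa> (Suc n)) (Z i x) = Z i (proj (\<kappa> n) x)"
    and proj_0_Z: "i < d \<Longrightarrow> proj (\<kappa> 0) (Z i x) = 0"
begin

lemma bounded_on_Z: "i < d \<Longrightarrow> bounded_on M (Z i)"
  by (rule bounded_onI[where C = 1]) (simp_all add: Z_mem Z_add Z_scaleC norm_Z_le)

lemma Z_zero_arg: "Z i 0 = 0"
  using Z_scaleC[of i 0 0] by simp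

lemma bounded_on_adj_Z: "i < d \<Longrightarrow> bounded_on M (adj_on M (Z i))"
  by (rule bounded_on_adj_on[OF csubspace bounded_on_Z])

lemma proj_adj_Z:
  assumes "i < d" "x \<in> M"
  shows "proj (\<kappa> n) (adj_on M (Z i) x) = adj_on M (Z i) (proj (\<kappa> (Suc n)) x)"
  by (rule adj_on_intertwine[OF csubspace bounded_on_Z[OF assms(1)] assms(2) proj_mem proj_mem])
    (simp_all add: proj_Suc_Z assms)

lemma adj_Z_proj_0:
  assumes "i < d" "x \<in> M"
  shows "adj_on M (Z i) (proj (\<kappa> 0) x) = 0"
  using adj_on_intertwine[OF csubspace bounded_on_Z[OF assms(1)] assms(2), of "\<kappa> 0" "{}"]
  by (simp add: proj_0_Z assms proj_mem csubspaceD[OF csubspace] Z_zero_arg)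

lemma Z_block: "i < d \<Longrightarrow> x \<in> block n \<Longrightarrow> Z i x \<in> block (Suc n)"
  by (simp add: block_def Z_mem proj_Suc_Z)

lemma adj_Z_block: "i < d \<Longrightarrow> x \<in> block (Suc n) \<Longrightarrow> adj_on M (Z i) x \<in> block n"
  by (simp add: block_def adj_on_mem[OF csubspace bounded_on_Z] proj_adj_Z)

lemma adj_Z_block_0: "i < d \<Longrightarrow> x \<in> block 0 \<Longrightarrow> adj_on M (Z i) x = 0"
  using adj_Z_proj_0[of i x] by (simp add: block_def)

lemma norm_adj_Z_le: "i < d \<Longrightarrow> x \<in> M \<Longrightarrow> norm (adj_on M (Z i) x) \<le> norm x"
  using norm_adj_on_le[OF csubspace bounded_on_Z, of i x 1] by (simp add: norm_Z_le)

lemma graded_operator_cross_commutator: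
  assumes i: "i < d" and j: "j < d"
  shows "graded_operator M \<kappa> (cross_commutator M i j)"
proof (intro graded_operator.intro graded_operator_axioms.intro)
  show "graded M \<kappa>" by (rule graded_axioms)
  note Zi = bounded_on_Z[OF i] and Aj = bounded_on_adj_Z[OF j]
  have "cross_commutator M i j = (\<lambda>x. Z i (adj_on M (Z j) x) - adj_on M (Z j) (Z i x))"
    by (simp add: fun_eq_iff cross_commutator_def)
  then show "bounded_on M (cross_commutator M i j)"
    using bounded_on_diff[OF csubspace bounded_on_compose[OF Zi Aj] bounded_on_compose[OF Aj Zi]]
    by simp
  fix x n
  assume x: "x \<in> M"
  have "proj (\<kappa> n) (Z i (adj_on M (Z j) x)) = Z i (adj_on M (Z j) (proj (\<kappa> n) x))"
  proof (cases n)
    case 0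
    then show ?thesis by (simp add: proj_0_Z i adj_Z_proj_0 j x Z_zero_arg)
  next
    case (Suc m)
    then show ?thesis by (simp add: proj_Suc_Z i proj_adj_Z j x)
  qed
  moreover have "proj (\<kappa> n) (adj_on M (Z j) (Z i x)) = adj_on M (Z j) (Z i (proj (\<kappa> n) x))"
    by (simp add: proj_adj_Z j Z_mem i x proj_Suc_Z)
  moreover have "proj A (u - v) = proj A u - proj A v" for A u v
    by (rule h2_eqI) (simp add: h2_coeff_proj h2_coeff_simps)
  ultimately show "proj (\<kappa> n) (cross_commutator M i j x) = cross_commutator M i j (proj (\<kappa> n) x)"
    by (simp add: cross_commutator_def)
qed

end

subsection \<open>Generators\<close>

definition generator :: "mono \<Rightarrow> vpoly \<Rightarrow> h2"
  where "generator \<alpha> f = of_vpoly (vscale (Poly_Mapping.single \<alpha> 1) f)"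

lemma of_vpoly_add: "of_vpoly (f + g) = of_vpoly f + of_vpoly g"
proof (rule h2_eqI)
  fix k :: "mono \<times> nat"
  show "h2_coeff (of_vpoly (f + g)) k = h2_coeff (of_vpoly f + of_vpoly g) k"
    by (cases k) (simp add: h2_coeff_of_vpoly h2_coeff_simps lookup_add)
qed

lemma of_vpoly_zero: "of_vpoly 0 = 0"
  using of_vpoly_add[of 0 0] by simp

lemma of_vpoly_sum: "of_vpoly (\<Sum>a\<in>A. f a) = (\<Sum>a\<in>A. of_vpoly (f a))"
  by (induction A rule: infinite_finite_induct) (simp_all add: of_vpoly_add of_vpoly_zero)

lemma vscale_add_left: "vscale (a + b) f = vscale a f + vscale b f"
  by (rule poly_mapping_eqI) (simp add: lookup_vscale lookup_add distrib_right)

lemma vscale_sum_left: "vscale (\<Sum>a\<in>A. g a) f = (\<Sum>a\<in>A. vscale (g a) f)"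
proof (induction A rule: infinite_finite_induct)
  case (insert a A)
  then show ?case by (simp add: vscale_add_left)
qed (auto intro: poly_mapping_eqI simp: lookup_vscale)

lemma vscale_vscale: "vscale a (vscale b f) = vscale (a * b) f"
  by (rule poly_mapping_eqI) (simp add: lookup_vscale mult.assoc)

lemma lookup_single_0_mult: "lookup (Poly_Mapping.single 0 c * a) \<alpha> = c * lookup (a :: mpoly) \<alpha>"
  by (simp add: lookup_mult lookup_single when_mult Sum_any_when_equal)

lemma of_vpoly_vscale_const: "of_vpoly (vscale (Poly_Mapping.single 0 c) f) = c *\<^sub>C of_vpoly f"
proof (rule h2_eqI)
  fix k :: "mono \<times> nat"
  show "h2_coeff (of_vpoly (vscale (Poly_Mapping.single 0 c) f)) k = h2_coeff (c *\<^sub>C of_vpoly f) k"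
    by (cases k) (simp add: h2_coeff_of_vpoly h2_coeff_simps lookup_vscale lookup_single_0_mult)
qed

lemma of_vpoly_vscale: "of_vpoly (vscale a f) = (\<Sum>\<alpha>\<in>keys a. lookup a \<alpha> *\<^sub>C generator \<alpha> f)"
proof -
  have "a = (\<Sum>\<alpha>\<in>keys a. Poly_Mapping.single \<alpha> (lookup a \<alpha>))"
    by (intro poly_mapping_eqI) (simp add: lookup_sum lookup_single when_def in_keys_iff)
  also have "\<dots> = (\<Sum>\<alpha>\<in>keys a. Poly_Mapping.single 0 (lookup a \<alpha>) * Poly_Mapping.single \<alpha> 1)"
    by (simp add: mult_single)
  finally have "of_vpoly (vscale a f)
      = of_vpoly (vscale (\<Sum>\<alpha>\<in>keys a. Poly_Mapping.single 0 (lookup a \<alpha>) * Poly_Mapping.single \<alpha> 1) f)"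
    by simp
  then show ?thesis
    by (simp only: vscale_sum_left of_vpoly_sum vscale_vscale[symmetric] of_vpoly_vscale_const generator_def)
qed

lemma Z_generator: "Z i (generator \<alpha> f) = generator (\<alpha> + Poly_Mapping.single i 1) f"
  by (simp add: generator_def Z_of_vpoly vscale_vscale mult_single add.commute)

definition generators :: "nat \<Rightarrow> vpoly set \<Rightarrow> h2 set"
  where "generators d F = {generator \<alpha> f |\<alpha> f. keys \<alpha> \<subseteq> {..<d} \<and> f \<in> F}"

lemma subspace_of_vpoly_poly_submodule: "h2.subspace (of_vpoly ` poly_submodule d F)"
proof (rule h2.subspaceI)
  have "0 \<in> poly_submodule d F"
    unfolding poly_submodule_def by (auto intro!: exI[of _ "{}"])
  then show "0 \<in> of_vpoly ` poly_submodule d F" using of_vpoly_zero by (metis imageI)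
next
  fix x y
  assume "x \<in> of_vpoly ` poly_submodule d F" "y \<in> of_vpoly ` poly_submodule d F"
  then obtain G a H b
    where x: "x = of_vpoly (\<Sum>f\<in>G. vscale (a f) f)" "finite G" "G \<subseteq> F" "\<forall>f\<in>G. a f \<in> polys d"
      and y: "y = of_vpoly (\<Sum>f\<in>H. vscale (b f) f)" "finite H" "H \<subseteq> F" "\<forall>f\<in>H. b f \<in> polys d"
    unfolding poly_submodule_def by blast
  \<comment> \<open>The two representations use different finite sets of generators; extending the
    coefficients by 0 puts both on the union.\<close>
  define a' where "a' f = (if f \<in> G then a f else 0)" for f
  define b' where "b' f = (if f \<in> H then b f else 0)" for f
  have v0: "vscale 0 f = 0" for f by (rule poly_mapping_eqI) (simp add: lookup_vscale)
  have "(\<Sum>f\<in>G. vscale (a f) f) = (\<Sum>f\<in>G \<union> H. vscale (a' f) f)"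
    using x(2) y(2) by (intro sum.mono_neutral_cong_left) (auto simp: a'_def v0)
  moreover have "(\<Sum>f\<in>H. vscale (b f) f) = (\<Sum>f\<in>G \<union> H. vscale (b' f) f)"
    using x(2) y(2) by (intro sum.mono_neutral_cong_left) (auto simp: b'_def v0)
  ultimately have "x + y = of_vpoly (\<Sum>f\<in>G \<union> H. vscale (a' f + b' f) f)"
    by (simp add: x(1) y(1) of_vpoly_add[symmetric] sum.distrib vscale_add_left)
  moreover have "a' f + b' f \<in> polys d" if "f \<in> G \<union> H" for f
  proof -
    have "a' f \<in> polys d" "b' f \<in> polys d"
      using that x(4) y(4) by (auto simp: a'_def b'_def polys_def)
    then show ?thesis using keys_add[of "a' f" "b' f"] by (auto simp: polys_def)
  qed
  then have "(\<Sum>f\<in>G \<union> H. vscale (a' f + b' f) f) \<in> poly_submodule d F"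
    using x(2,3) y(2,3) unfolding poly_submodule_def
    by (intro CollectI exI[of _ "G \<union> H"] exI[of _ "\<lambda>f. a' f + b' f"]) auto
  ultimately show "x + y \<in> of_vpoly ` poly_submodule d F" by blast
next
  fix c x
  assume "x \<in> of_vpoly ` poly_submodule d F"
  then obtain G a
    where x: "x = of_vpoly (\<Sum>f\<in>G. vscale (a f) f)" "finite G" "G \<subseteq> F" "\<forall>f\<in>G. a f \<in> polys d"
    unfolding poly_submodule_def by blast
  let ?c = "Poly_Mapping.single 0 c :: mpoly"
  have "c *\<^sub>C x = of_vpoly (\<Sum>f\<in>G. vscale (?c * a f) f)"
    unfolding x(1) of_vpoly_sum vscale_vscale[symmetric] of_vpoly_vscale_const
    by (rule h2.scale_sum_right)
  moreover have "?c \<in> polys d" by (auto simp: polys_def)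
  then have "(\<Sum>f\<in>G. vscale (?c * a f) f) \<in> poly_submodule d F"
    using x(2-4) unfolding poly_submodule_def
    by (intro CollectI exI[of _ G] exI[of _ "\<lambda>f. ?c * a f"]) (auto intro: polys_mult)
  ultimately show "c *\<^sub>C x \<in> of_vpoly ` poly_submodule d F" by blast
qed

lemma subspace_closure:
  assumes "h2.subspace V"
  shows "h2.subspace (closure V)"
proof (rule h2.subspaceI)
  show "0 \<in> closure V" using h2.subspace_0[OF assms] closure_subset by blast
next
  fix x y
  assume "x \<in> closure V" "y \<in> closure V"
  then obtain X Y where "\<And>n. X n \<in> V" "X \<longlonglongrightarrow> x" "\<And>n. Y n \<in> V" "Y \<longlonglongrightarrow> y"
    unfolding closure_sequential by blast
  then have "\<forall>n. X n + Y n \<in> V" "(\<lambda>n. X n + Y n) \<longlonglongrightarrow> x + y"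
    using h2.subspace_add[OF assms] tendsto_add by blast+
  then show "x + y \<in> closure V" unfolding closure_sequential by (intro exI[of _ "\<lambda>n. X n + Y n"] conjI)
next
  fix c x
  assume "x \<in> closure V"
  then obtain X where "\<And>n. X n \<in> V" "X \<longlonglongrightarrow> x"
    unfolding closure_sequential by blast
  then have "\<forall>n. c *\<^sub>C X n \<in> V" "(\<lambda>n. c *\<^sub>C X n) \<longlonglongrightarrow> c *\<^sub>C x"
    using h2.subspace_scale[OF assms] bounded_linear.tendsto[OF bounded_linear_scaleC_right] by blast+
  then show "c *\<^sub>C x \<in> closure V" unfolding closure_sequential by (intro exI[of _ "\<lambda>n. c *\<^sub>C X n"] conjI)
qed

lemma csubspace_generated_submodule: "csubspace (generated_submodule d F)"
  unfolding csubspace_def generated_submodule_def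
  by (simp add: subspace_closure subspace_of_vpoly_poly_submodule)

lemma generators_subset: "generators d F \<subseteq> generated_submodule d F"
proof
  fix x
  assume "x \<in> generators d F"
  then obtain \<alpha> f where x: "x = of_vpoly (vscale (Poly_Mapping.single \<alpha> 1) f)" "keys \<alpha> \<subseteq> {..<d}" "f \<in> F"
    by (auto simp: generators_def generator_def)
  have "(Poly_Mapping.single \<alpha> 1 :: mpoly) \<in> polys d" using x(2) by (simp add: polys_def)
  then have "vscale (Poly_Mapping.single \<alpha> 1) f \<in> poly_submodule d F"
    unfolding poly_submodule_def using x(3)
    by (intro CollectI exI[of _ "{f}"] exI[of _ "\<lambda>_. Poly_Mapping.single \<alpha> 1"]) auto
  then show "x \<in> generated_submodule d F"
    unfolding generated_submodule_def x(1) by (intro subsetD[OF closure_subset] imageI)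
qed

lemma generator_mem: "keys \<alpha> \<subseteq> {..<d} \<Longrightarrow> f \<in> F \<Longrightarrow> generator \<alpha> f \<in> generated_submodule d F"
  using generators_subset unfolding generators_def by blast

text \<open>The induction principle for generated submodules: a condition that cuts out a closed
  subspace needs checking only on monomial multiples of generators. Invariance under shifts and
  projections, the mapping property of \<open>W\<close> and the formula for adjoints are all
  obtained in this way.\<close>

lemma generated_submodule_minimal:
  assumes V: "csubspace V" and gen: "generators d F \<subseteq> V"
  shows "generated_submodule d F \<subseteq> V"
  unfolding generated_submodule_def
proof (rule closure_minimal)
  show "of_vpoly ` poly_submodule d F \<subseteq> V"
  proof
    fix x
    assume "x \<in> of_vpoly ` poly_submodule d F"
    then obtain G a
      where x: "x = of_vpoly (\<Sum>f\<in>G. vscale (a f) f)" "finite G" "G \<subseteq> F" "\<forall>f\<in>G. a f \<in> polys d"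
      unfolding poly_submodule_def by blast
    have "lookup (a f) \<alpha> *\<^sub>C generator \<alpha> f \<in> V" if "f \<in> G" "\<alpha> \<in> keys (a f)" for f \<alpha>
      using that x gen by (intro csubspaceD(6)[OF V]) (fastforce simp: generators_def polys_def)
    then show "x \<in> V"
      unfolding x(1) of_vpoly_sum of_vpoly_vscale by (intro h2.subspace_sum csubspaceD(3)[OF V])
  qed
  show "closed V" by (rule csubspaceD(2)[OF V])
qed

lemma csubspace_vimage:
  assumes "csubspace M" "bounded_linear T" "\<And>c x. T (c *\<^sub>C x) = c *\<^sub>C T x"
  shows "csubspace {x. T x \<in> M}"
proof -
  interpret T: bounded_linear T by fact
  have "closed (T -` M)"
    by (intro closed_vimage csubspaceD(2)[OF assms(1)] linear_continuous_on assms(2))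
  moreover have "h2.subspace {x. T x \<in> M}"
    by (rule h2.subspaceI) (simp_all add: T.zero T.add assms(3) csubspaceD[OF assms(1)])
  ultimately show ?thesis by (simp add: csubspace_def vimage_def)
qed

lemma csubspace_fixed_proj: "csubspace {x. proj A x = x}"
  unfolding csubspace_def
  by (intro conjI closed_proj_eq h2.subspaceI) (simp_all add: proj_add proj_scaleC)

lemma Z_generated_submodule:
  assumes "i < d" "x \<in> generated_submodule d F"
  shows "Z i x \<in> generated_submodule d F"
proof -
  have "generated_submodule d F \<subseteq> {x. Z i x \<in> generated_submodule d F}"
  proof (rule generated_submodule_minimal)
    show "csubspace {x. Z i x \<in> generated_submodule d F}"
      by (intro csubspace_vimage csubspace_generated_submodule bounded_linear_Z Z_scaleC)
    have "Z i (generator \<alpha> f) \<in> generators d F" if "keys \<alpha> \<subseteq> {..<d}" "f \<in> F" for \<alpha> f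
      unfolding generators_def Z_generator
      using that assms(1) keys_add[of \<alpha> "Poly_Mapping.single i 1"]
      by (intro CollectI exI[of _ "\<alpha> + Poly_Mapping.single i 1"] exI[of _ f]) auto
    then show "generators d F \<subseteq> {x. Z i x \<in> generated_submodule d F}"
      using generators_subset by (fastforce simp: generators_def)
  qed
  with assms(2) show ?thesis by blast
qed

lemma h2_coeff_generator_nonzero:
  assumes "h2_coeff (generator \<alpha> f) (\<gamma>, j) \<noteq> 0"
  obtains \<delta> where "\<gamma> = \<alpha> + \<delta>" "\<delta> \<in> keys (lookup f j)"
proof -
  have "\<gamma> \<in> keys (Poly_Mapping.single \<alpha> 1 * lookup f j)"
    using assms by (simp add: generator_def h2_coeff_of_vpoly lookup_vscale in_keys_iff)
  then have "\<gamma> \<in> {a + b |a b. a \<in> keys (Poly_Mapping.single \<alpha> (1::complex)) \<and> b \<in> keys (lookup f j)}"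
    by (rule subsetD[OF keys_mult])
  then show ?thesis using that by auto
qed

lemma proj_eq_self: "(\<And>k. h2_coeff x k \<noteq> 0 \<Longrightarrow> k \<in> A) \<Longrightarrow> proj A x = x"
  by (rule h2_eqI) (auto simp: h2_coeff_proj)

lemma proj_eq_zero: "(\<And>k. h2_coeff x k \<noteq> 0 \<Longrightarrow> k \<notin> A) \<Longrightarrow> proj A x = 0"
  by (rule h2_eqI) (auto simp: h2_coeff_proj h2_coeff_simps)

subsection \<open>Homogeneous components\<close>

definition component :: "nat \<Rightarrow> nat \<Rightarrow> nat \<Rightarrow> (mono \<times> nat) set"
  where "component d r n = {(\<alpha>, j). keys \<alpha> \<subseteq> {..<d} \<and> mdeg \<alpha> = n \<and> j < r}"

lemma mdeg_add: "mdeg (\<alpha> + \<beta>) = mdeg \<alpha> + mdeg \<beta>"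
proof -
  let ?S = "keys \<alpha> \<union> keys \<beta>"
  have "mdeg (\<alpha> + \<beta>) = (\<Sum>i\<in>?S. lookup (\<alpha> + \<beta>) i)"
    by (rule mdeg_superset) (simp_all add: keys_add)
  then show ?thesis
    using mdeg_superset[of ?S \<alpha>] mdeg_superset[of ?S \<beta>] by (simp add: lookup_add sum.distrib)
qed

lemma mdeg_single [simp]: "mdeg (Poly_Mapping.single i n) = n"
  by (simp add: mdeg_def)

lemma keys_add_mono: "keys (\<alpha> + \<beta>) = keys \<alpha> \<union> keys (\<beta> :: mono)"
  by (auto simp: in_keys_iff lookup_add)

text \<open>An index is determined by d exponents, each at most n, and by j. The true growth is of
  order n^(d - 1); the cruder power d is affordable because p exceeds d + r, which is at least d +
  1.\<close>

lemma finite_component: "finite (component d r n)"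
  and card_component_le: "card (component d r n) \<le> r * Suc n ^ d"
proof -
  let ?\<psi> = "\<lambda>(\<alpha> :: mono, j :: nat). (restrict (lookup \<alpha>) {..<d}, j)"
  let ?P = "(PiE {..<d} (\<lambda>_. {..n})) \<times> {..<r}"
  have inj: "inj_on ?\<psi> (component d r n)"
  proof (rule inj_onI)
    fix k l
    assume kl: "k \<in> component d r n" "l \<in> component d r n" "?\<psi> k = ?\<psi> l"
    obtain \<alpha> i \<beta> j where [simp]: "k = (\<alpha>, i)" "l = (\<beta>, j)" by (cases k, cases l)
    have "lookup \<alpha> m = lookup \<beta> m" for m
    proof (cases "m < d")
      case True
      have "restrict (lookup \<alpha>) {..<d} m = restrict (lookup \<beta>) {..<d} m" using kl(3) by simp
      then show ?thesis using True by simp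
    next
      case False
      then have "m \<notin> keys \<alpha>" "m \<notin> keys \<beta>" using kl(1,2) by (auto simp: component_def)
      then show ?thesis by (simp add: in_keys_iff)
    qed
    then have "\<alpha> = \<beta>" by (rule poly_mapping_eqI)
    then show "k = l" using kl(3) by simp
  qed
  have sub: "?\<psi> ` component d r n \<subseteq> ?P"
  proof (rule image_subsetI)
    fix k
    assume "k \<in> component d r n"
    then show "?\<psi> k \<in> ?P"
      using lookup_le_mdeg by (cases k) (auto simp only: component_def split_conv mem_Collect_eq
        mem_Sigma_iff restrict_PiE_iff atMost_iff lessThan_iff)
  qed
  have fin: "finite ?P" by (intro finite_cartesian_product finite_PiE) auto
  show "finite (component d r n)" using finite_imageD[OF finite_subset[OF sub fin] inj] .
  have "card (component d r n) \<le> card ?P" by (rule card_inj_on_le[OF inj sub fin])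
  also have "\<dots> = r * Suc n ^ d" by (simp add: card_cartesian_product card_PiE)
  finally show "card (component d r n) \<le> r * Suc n ^ d" .
qed

lemma component_shift:
  assumes "i < d"
  shows "(\<alpha> + Poly_Mapping.single i 1, j) \<in> component d r (Suc n) \<longleftrightarrow> (\<alpha>, j) \<in> component d r n"
    and "(\<alpha> + Poly_Mapping.single i 1, j) \<notin> component d r 0"
  using assms by (auto simp: component_def mdeg_add keys_add_mono)

lemma component_disjoint: "m \<noteq> n \<Longrightarrow> component d r m \<inter> component d r n = {}"
  by (auto simp: component_def)

context
  fixes d r :: nat and F :: "vpoly set"
  assumes F: "F \<subseteq> homogeneous_vpolys d r 1"
begin

text \<open>The successor is the degree 1 of the linear polynomial \<open>f\<close>, added to the
  degree of the monomial.\<close>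

lemma generator_support:
  assumes "keys \<alpha> \<subseteq> {..<d}" "f \<in> F" "h2_coeff (generator \<alpha> f) k \<noteq> 0"
  shows "k \<in> component d r (Suc (mdeg \<alpha>))"
proof -
  obtain \<gamma> j where k: "k = (\<gamma>, j)" by (cases k)
  from assms(3) obtain \<delta> where \<delta>: "\<gamma> = \<alpha> + \<delta>" "\<delta> \<in> keys (lookup f j)"
    unfolding k by (rule h2_coeff_generator_nonzero)
  have f: "f \<in> homogeneous_vpolys d r 1" using F assms(2) by blast
  have "j \<in> keys f" using \<delta>(2) by (auto simp: in_keys_iff)
  then show ?thesis
    using f \<delta> assms(1) unfolding k
    by (auto simp: component_def homogeneous_vpolys_def vpolys_def polys_def mdeg_add keys_add_mono)
qed

lemma proj_generator:
  assumes "keys \<alpha> \<subseteq> {..<d}" "f \<in> F"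
  shows "proj (component d r n) (generator \<alpha> f) = (if n = Suc (mdeg \<alpha>) then generator \<alpha> f else 0)"
proof (cases "n = Suc (mdeg \<alpha>)")
  case True
  then show ?thesis using generator_support[OF assms] by (simp add: proj_eq_self)
next
  case False
  then have "proj (component d r n) (generator \<alpha> f) = 0"
    using generator_support[OF assms] component_disjoint[OF False] by (intro proj_eq_zero) blast
  with False show ?thesis by simp
qed

lemma shift_graded_linear: "shift_graded (generated_submodule d F) (component d r) d"
proof (intro shift_graded.intro graded.intro shift_graded_axioms.intro)
  let ?M = "generated_submodule d F"
  show "csubspace ?M" by (rule csubspace_generated_submodule)
  show "finite (component d r n)" for n by (rule finite_component)
  show "component d r m \<inter> component d r n = {}" if "m \<noteq> n" for m n by (rule component_disjoint[OF that])
  show "Z i x \<in> ?M" if "i < d" "x \<in> ?M" for i x using that by (rule Z_generated_submodule)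
  show "proj (component d r (Suc n)) (Z i x) = Z i (proj (component d r n) x)" if "i < d" for i n x
    by (rule proj_Z) (rule component_shift(1)[OF that])
  show "proj (component d r 0) (Z i x) = 0" if "i < d" for i x
  proof -
    have "proj (component d r 0) (Z i x) = Z i (proj {} x)"
      by (rule proj_Z) (use component_shift(2)[OF that] in blast)
    also have "\<dots> = 0" using Z_scaleC[of i 0 0] by simp
    finally show ?thesis .
  qed
  fix x n
  assume x: "x \<in> ?M"
  have "?M \<subseteq> {x. proj (component d r n) x \<in> ?M}"
  proof (rule generated_submodule_minimal)
    show "csubspace {x. proj (component d r n) x \<in> ?M}"
      by (intro csubspace_vimage csubspace_generated_submodule bounded_linear_proj proj_scaleC)
    show "generators d F \<subseteq> {x. proj (component d r n) x \<in> ?M}"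
      using csubspaceD(1)[OF csubspace_generated_submodule[of d F]]
      by (auto simp: generators_def proj_generator generator_mem)
  qed
  then show "proj (component d r n) x \<in> ?M" using x by blast
qed

lemma proj_Union_component:
  assumes "x \<in> generated_submodule d F"
  shows "proj (\<Union>n. component d r n) x = x"
proof -
  have "generated_submodule d F \<subseteq> {x. proj (\<Union>n. component d r n) x = x}"
  proof (rule generated_submodule_minimal[OF csubspace_fixed_proj])
    show "generators d F \<subseteq> {x. proj (\<Union>n. component d r n) x = x}"
      using generator_support unfolding generators_def by (blast intro: proj_eq_self)
  qed
  with assms show ?thesis by blast
qed

end

section \<open>Vector-valued linear polynomials as scalar quadratic polynomials\<close>

text \<open>The new variables carry the numbers d + j. The second entry 0 is the single basis index
  of the scalar case.\<close>

definition tensor_index :: "nat \<Rightarrow> mono \<times> nat \<Rightarrow> mono \<times> nat"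
  where "tensor_index d = (\<lambda>(\<alpha>, j). (\<alpha> + Poly_Mapping.single (d + j) 1, 0))"

definition vindices :: "nat \<Rightarrow> nat \<Rightarrow> (mono \<times> nat) set"
  where "vindices d r = {(\<alpha>, j). keys \<alpha> \<subseteq> {..<d} \<and> j < r}"

lemma lookup_eq_0_if_keys: "keys \<alpha> \<subseteq> {..<d} \<Longrightarrow> d \<le> i \<Longrightarrow> lookup (\<alpha> :: mono) i = 0"
  using in_keys_iff[of i \<alpha>] by auto

lemma lookup_tensor_index:
  fixes \<alpha> :: mono
  assumes "keys \<alpha> \<subseteq> {..<d}" "d \<le> i"
  shows "lookup (\<alpha> + Poly_Mapping.single (d + j) 1) i = (if i = d + j then 1 else 0)"
  by (simp add: lookup_add lookup_eq_0_if_keys[OF assms] lookup_single when_def)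

text \<open>On \<open>vindices\<close> the exponent \<alpha> involves only old variables, so the one
  new variable in the image reveals j.\<close>

lemma inj_on_tensor_index: "inj_on (tensor_index d) (vindices d r)"
proof (rule inj_onI)
  fix k l
  assume kl: "k \<in> vindices d r" "l \<in> vindices d r" "tensor_index d k = tensor_index d l"
  obtain \<alpha> i \<beta> j where [simp]: "k = (\<alpha>, i)" "l = (\<beta>, j)" by (cases k, cases l)
  have sub: "keys \<alpha> \<subseteq> {..<d}" "keys \<beta> \<subseteq> {..<d}" using kl by (auto simp: vindices_def)
  have eq: "\<alpha> + Poly_Mapping.single (d + i) 1 = \<beta> + Poly_Mapping.single (d + j) 1"
    using kl(3) by (simp add: tensor_index_def)
  from lookup_tensor_index[OF sub(1), of "d + i" i] lookup_tensor_index[OF sub(2), of "d + i" j]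
  have "i = j" unfolding eq by (auto split: if_splits)
  with eq show "k = l" by simp
qed

lemma tensor_bounded_reindexing:
  "bounded_reindexing 1 (\<lambda>k. if k \<in> tensor_index d ` vindices d r
    then Some (inv_into (vindices d r) (tensor_index d) k) else None)" (is "bounded_reindexing 1 ?h")
proof -
  have "inj_on ?h (dom ?h)"
    by (rule inj_onI) (auto split: if_splits dest: inv_into_injective)
  moreover have "weight (fst k) \<le> 1 * weight (fst k')" if "?h k = Some k'" for k k'
  proof -
    from that have k: "k \<in> tensor_index d ` vindices d r" and k': "k' = inv_into (vindices d r) (tensor_index d) k"
      by (auto split: if_splits)
    then have "k = tensor_index d k'" by (simp add: f_inv_into_f)
    then show ?thesis using weight_add_single_le by (cases k') (simp add: tensor_index_def)
  qed
  ultimately show ?thesis unfolding bounded_reindexing_def by blast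
qed

text \<open>Sends \<open>z\<^sup>\<alpha> \<otimes> v\<^sub>j\<close> to \<open>z\<^sup>\<alpha> z\<^bsub>d+j\<^esub>\<close>.\<close>

definition tensor_map :: "nat \<Rightarrow> nat \<Rightarrow> h2 \<Rightarrow> h2"
  where "tensor_map d r = reindex (\<lambda>k. if k \<in> tensor_index d ` vindices d r
    then Some (inv_into (vindices d r) (tensor_index d) k) else None)"

lemmas bounded_linear_tensor_map =
  bounded_linear_reindex[OF tensor_bounded_reindexing zero_le_one, folded tensor_map_def]
lemmas tensor_map_add = reindex_add[OF tensor_bounded_reindexing zero_le_one, folded tensor_map_def]
lemmas tensor_map_scaleC = reindex_scaleC[OF tensor_bounded_reindexing zero_le_one, folded tensor_map_def]

lemma h2_coeff_tensor_map:
  "k \<in> vindices d r \<Longrightarrow> h2_coeff (tensor_map d r x) (tensor_index d k) = h2_coeff x k"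
  unfolding tensor_map_def
  by (simp add: h2_coeff_reindex[OF tensor_bounded_reindexing] inv_into_f_f[OF inj_on_tensor_index])

lemma h2_coeff_tensor_map_eq_0:
  "k \<notin> tensor_index d ` vindices d r \<Longrightarrow> h2_coeff (tensor_map d r x) k = 0"
  unfolding tensor_map_def by (simp add: h2_coeff_reindex[OF tensor_bounded_reindexing])

lemma component_subset_vindices: "component d r n \<subseteq> vindices d r"
  by (auto simp: component_def vindices_def)

lemma proj_tensor_map:
  "proj (tensor_index d ` component d r n) (tensor_map d r x) = tensor_map d r (proj (component d r n) x)"
proof (rule h2_eqI)
  fix k
  show "h2_coeff (proj (tensor_index d ` component d r n) (tensor_map d r x)) k
      = h2_coeff (tensor_map d r (proj (component d r n) x)) k"
  proof (cases "k \<in> tensor_index d ` vindices d r")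
    case True
    then obtain l where l: "l \<in> vindices d r" "k = tensor_index d l" by blast
    have "k \<in> tensor_index d ` component d r n \<longleftrightarrow> l \<in> component d r n"
      unfolding l(2) by (rule inj_on_image_mem_iff[OF inj_on_tensor_index l(1) component_subset_vindices])
    then show ?thesis by (simp add: h2_coeff_proj l h2_coeff_tensor_map)
  next
    case False
    then show ?thesis by (simp add: h2_coeff_proj h2_coeff_tensor_map_eq_0)
  qed
qed

text \<open>Multiplication by an old variable commutes with attaching a new one. Coefficients are
  compared at \<beta>: both vanish if \<open>Z i\<close> cannot reach \<beta>, and otherwise lying
  in the range of \<open>tensor_index\<close> is unaffected by removing one factor of the variable
  i.\<close>

lemma tensor_map_Z:
  assumes i: "i < d"
  shows "tensor_map d r (Z i x) = Z i (tensor_map d r x)"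
proof (rule h2_eqI)
  fix k :: "mono \<times> nat"
  obtain \<beta> c where k: "k = (\<beta>, c)" by (cases k)
  show "h2_coeff (tensor_map d r (Z i x)) k = h2_coeff (Z i (tensor_map d r x)) k"
  proof (cases \<beta> i rule: mono_cases_single)
    case 1
    have "h2_coeff (tensor_map d r (Z i x)) k = 0"
    proof (cases "k \<in> tensor_index d ` vindices d r")
      case True
      then obtain \<alpha> j where l: "(\<alpha>, j) \<in> vindices d r" "k = tensor_index d (\<alpha>, j)" by auto
      then have "lookup \<alpha> i = 0" using 1 k by (simp add: tensor_index_def lookup_add)
      then show ?thesis unfolding l(2) h2_coeff_tensor_map[OF l(1)] by (rule h2_coeff_Z_eq_0)
    qed (rule h2_coeff_tensor_map_eq_0)
    then show ?thesis using h2_coeff_Z_eq_0[OF 1] k by simp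
  next
    case (2 \<gamma>)
    have shift: "tensor_index d (\<alpha> + Poly_Mapping.single i 1, j) = (\<delta> + Poly_Mapping.single i 1, c')
      \<longleftrightarrow> tensor_index d (\<alpha>, j) = (\<delta>, c')" for \<alpha> \<delta> j c'
    proof -
      have "\<alpha> + Poly_Mapping.single i 1 + Poly_Mapping.single (d + j) 1
          = (\<alpha> + Poly_Mapping.single (d + j) 1) + Poly_Mapping.single i 1"
        by (simp only: add.assoc add.commute[of "Poly_Mapping.single i 1"])
      then show ?thesis by (simp only: tensor_index_def split_conv prod.inject add_right_cancel)
    qed
    have vshift: "(\<alpha> + Poly_Mapping.single i 1, j) \<in> vindices d r \<longleftrightarrow> (\<alpha>, j) \<in> vindices d r" for \<alpha> j
      using i by (auto simp: vindices_def keys_add_mono)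
    show ?thesis
    proof (cases "(\<gamma>, c) \<in> tensor_index d ` vindices d r")
      case True
      then obtain \<alpha> j where l: "(\<alpha>, j) \<in> vindices d r" "(\<gamma>, c) = tensor_index d (\<alpha>, j)" by auto
      have k': "k = tensor_index d (\<alpha> + Poly_Mapping.single i 1, j)"
        using shift[of \<alpha> j \<gamma> c] l(2) by (simp add: k 2)
      have "h2_coeff (tensor_map d r (Z i x)) k = h2_coeff (Z i x) (\<alpha> + Poly_Mapping.single i 1, j)"
        unfolding k' using vshift l(1) by (intro h2_coeff_tensor_map) blast
      also have "\<dots> = h2_coeff (tensor_map d r x) (\<gamma>, c)"
        unfolding h2_coeff_Z_add_single l(2) by (rule h2_coeff_tensor_map[OF l(1), symmetric])
      finally show ?thesis unfolding k 2 h2_coeff_Z_add_single .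
    next
      case False
      have "h2_coeff (tensor_map d r (Z i x)) k = 0"
      proof (cases "k \<in> tensor_index d ` vindices d r")
        case True
        then obtain \<alpha> j where l: "(\<alpha>, j) \<in> vindices d r" "k = tensor_index d (\<alpha>, j)" by auto
        show ?thesis
        proof (cases \<alpha> i rule: mono_cases_single)
          case 1
          then show ?thesis unfolding l(2) h2_coeff_tensor_map[OF l(1)] by (rule h2_coeff_Z_eq_0)
        next
          case (2 \<alpha>')
          then have "(\<gamma>, c) = tensor_index d (\<alpha>', j)" "(\<alpha>', j) \<in> vindices d r"
            using l shift[of \<alpha>' j \<gamma> c] vshift[of \<alpha>' j] k \<open>\<beta> = \<gamma> + Poly_Mapping.single i 1\<close> by auto
          then show ?thesis using False by blast
        qed
      qed (rule h2_coeff_tensor_map_eq_0)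
      then show ?thesis
        unfolding k 2 h2_coeff_Z_add_single by (simp add: h2_coeff_tensor_map_eq_0[OF False])
    qed
  qed
qed

text \<open>Attaching a new variable raises an exponent from 0 to 1, so by
  \<open>weight_add_single\<close> the weight is multiplied by (0 + 1) / (n + 1), the same factor
  for all indices of degree n.\<close>

lemma cinner_tensor_map:
  assumes x: "proj (component d r n) x = x" and y: "proj (component d r n) y = y"
  shows "cinner (tensor_map d r x) (tensor_map d r y) = cinner x y / of_nat (Suc n)"
proof -
  let ?K = "component d r n"
  let ?g = "\<lambda>k. of_real (weight (fst k)) * h2_coeff (tensor_map d r x) k * cnj (h2_coeff (tensor_map d r y) k)"
  have coeff_eq_0: "h2_coeff x k = 0" if "k \<notin> ?K" for k
    using h2_coeff_proj[of ?K x k] x that by simp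
  have "cinner (tensor_map d r x) (tensor_map d r y) = (\<Sum>\<^sub>\<infinity>k\<in>tensor_index d ` ?K. ?g k)"
    unfolding cinner_def
  proof (rule infsum_cong_neutral)
    fix k
    assume "k \<in> UNIV - tensor_index d ` ?K"
    then have "h2_coeff (proj (tensor_index d ` ?K) (tensor_map d r x)) k = 0" by (simp add: h2_coeff_proj)
    then show "?g k = 0" by (simp add: proj_tensor_map x)
  qed auto
  also have "\<dots> = (\<Sum>\<^sub>\<infinity>k\<in>?K. ?g (tensor_index d k))"
    using infsum_reindex[OF inj_on_subset[OF inj_on_tensor_index component_subset_vindices], of ?g d r n]
    by (simp add: o_def)
  also have "\<dots> = (\<Sum>\<^sub>\<infinity>k\<in>UNIV. of_real (weight (fst k)) * h2_coeff x k * cnj (h2_coeff y k) / of_nat (Suc n))"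
  proof (rule infsum_cong_neutral)
    fix k
    assume "k \<in> ?K \<inter> UNIV"
    then have k: "k \<in> ?K" by simp
    then obtain \<alpha> j where \<alpha>: "k = (\<alpha>, j)" "keys \<alpha> \<subseteq> {..<d}" "mdeg \<alpha> = n" by (auto simp: component_def)
    have "weight (fst (tensor_index d k)) = weight \<alpha> / real (Suc n)"
      unfolding \<alpha>(1) tensor_index_def
      using weight_add_single[of \<alpha> "d + j"] lookup_eq_0_if_keys[OF \<alpha>(2), of "d + j"] \<alpha>(3)
      by (simp add: add.commute)
    moreover have "k \<in> vindices d r" using k component_subset_vindices by blast
    ultimately show "?g (tensor_index d k)
        = of_real (weight (fst k)) * h2_coeff x k * cnj (h2_coeff y k) / of_nat (Suc n)"
      by (simp add: h2_coeff_tensor_map \<alpha>(1) del: of_nat_Suc)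
  qed (auto simp: coeff_eq_0)
  also have "\<dots> = cinner x y / of_nat (Suc n)"
    unfolding cinner_def divide_inverse by (rule infsum_cmult_left')
  finally show ?thesis .
qed

subsection \<open>The quadratic polynomials\<close>

text \<open>The counterpart of \<open>tensor_map\<close> on polynomials, needed because the
  hypothesis speaks of sets of polynomials: a vector polynomial becomes the sum of z_(d+j) times its
  j-th entry, stored at the scalar basis index 0.\<close>

definition tensor_poly :: "nat \<Rightarrow> nat \<Rightarrow> vpoly \<Rightarrow> vpoly"
  where "tensor_poly d r f = Poly_Mapping.single 0
    (\<Sum>j<r. Poly_Mapping.single (Poly_Mapping.single (d + j) 1) 1 * lookup f j)"

lemma lookup_tensor_poly:
  "lookup (tensor_poly d r f) c
    = (if c = 0 then \<Sum>j<r. Poly_Mapping.single (Poly_Mapping.single (d + j) 1) 1 * lookup f j else 0)"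
  by (simp add: tensor_poly_def lookup_single)

lemma tensor_poly_vscale: "tensor_poly d r (vscale a f) = vscale a (tensor_poly d r f)"
  by (rule poly_mapping_eqI)
    (simp add: lookup_vscale lookup_tensor_poly sum_distrib_left mult.left_commute)

lemma lookup_single_mult:
  fixes b :: mpoly
  shows "lookup (Poly_Mapping.single (Poly_Mapping.single i 1) 1 * b) \<beta>
    = (if lookup \<beta> i = 0 then 0 else lookup b (\<beta> - Poly_Mapping.single i 1))"
proof -
  let ?f = "Poly_Mapping.single 0 b :: vpoly"
  have "lookup (Poly_Mapping.single (Poly_Mapping.single i 1) 1 * b) \<beta>
      = h2_coeff (Z i (of_vpoly ?f)) (\<beta>, 0)"
    by (simp add: Z_of_vpoly h2_coeff_of_vpoly lookup_vscale)
  then show ?thesis by (simp add: h2_coeff_Z Z_coeff_def h2_coeff_of_vpoly)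
qed

lemma of_vpoly_tensor_poly:
  assumes f: "f \<in> vpolys d r"
  shows "of_vpoly (tensor_poly d r f) = tensor_map d r (of_vpoly f)"
proof (rule h2_eqI)
  fix k :: "mono \<times> nat"
  obtain \<beta> c where k: "k = (\<beta>, c)" by (cases k)
  let ?t = "\<lambda>j. if lookup \<beta> (d + j) = 0 then 0 else lookup (lookup f j) (\<beta> - Poly_Mapping.single (d + j) 1)"
  have lhs: "h2_coeff (of_vpoly (tensor_poly d r f)) k = (if c = 0 then \<Sum>j<r. ?t j else 0)"
    by (simp add: k h2_coeff_of_vpoly lookup_tensor_poly lookup_sum lookup_single_mult del: One_nat_def)
  show "h2_coeff (of_vpoly (tensor_poly d r f)) k = h2_coeff (tensor_map d r (of_vpoly f)) k"
  proof (cases "k \<in> tensor_index d ` vindices d r")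
    case True
    then obtain \<alpha> i where l: "(\<alpha>, i) \<in> vindices d r" "k = tensor_index d (\<alpha>, i)" by auto
    have \<alpha>: "keys \<alpha> \<subseteq> {..<d}" "i < r" using l(1) by (auto simp: vindices_def)
    have \<beta>: "\<beta> = \<alpha> + Poly_Mapping.single (d + i) 1" "c = 0"
      using l(2) k by (auto simp: tensor_index_def)
    \<comment> \<open>The index contains exactly one new variable, with number d + i, so only the
      summand i can reach it.\<close>
    have "?t j = (if j = i then lookup (lookup f i) \<alpha> else 0)" for j
      using lookup_tensor_index[OF \<alpha>(1), of "d + j" i] by (simp add: \<beta>)
    then have "(\<Sum>j<r. ?t j) = (\<Sum>j<r. if j = i then lookup (lookup f i) \<alpha> else 0)" by simp
    also have "\<dots> = lookup (lookup f i) \<alpha>" using \<alpha>(2) by simp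
    finally show ?thesis
      unfolding lhs using \<beta>(2) by (simp add: l(2) h2_coeff_tensor_map[OF l(1)] h2_coeff_of_vpoly)
  next
    case False
    have "?t j = 0" if c: "c = 0" and j: "j < r" for j
    proof (rule ccontr)
      assume nz: "?t j \<noteq> 0"
      then obtain \<gamma> where \<gamma>: "\<beta> = \<gamma> + Poly_Mapping.single (d + j) 1"
        by (cases \<beta> "d + j" rule: mono_cases_single) auto
      then have "\<gamma> \<in> keys (lookup f j)" using nz by (simp add: in_keys_iff split: if_splits)
      then have "keys \<gamma> \<subseteq> {..<d}" using f by (auto simp: vpolys_def polys_def)
      then have "(\<gamma>, j) \<in> vindices d r" using j by (simp add: vindices_def)
      moreover have "k = tensor_index d (\<gamma>, j)" by (simp add: k \<gamma> c tensor_index_def)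
      ultimately show False using False by blast
    qed
    then show ?thesis unfolding lhs by (simp add: h2_coeff_tensor_map_eq_0[OF False])
  qed
qed

lemma generator_tensor_poly:
  assumes f: "f \<in> vpolys d r" and \<alpha>: "keys \<alpha> \<subseteq> {..<d}"
  shows "generator \<alpha> (tensor_poly d r f) = tensor_map d r (generator \<alpha> f)"
proof -
  have "vscale (Poly_Mapping.single \<alpha> 1) f \<in> vpolys d r"
  proof -
    have a: "(Poly_Mapping.single \<alpha> 1 :: mpoly) \<in> polys d" using \<alpha> by (simp add: polys_def)
    have "vscale (Poly_Mapping.single \<alpha> 1) f \<in> poly_submodule d {f}"
      unfolding poly_submodule_def using a
      by (intro CollectI exI[of _ "{f}"] exI[of _ "\<lambda>_. Poly_Mapping.single \<alpha> 1"]) auto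
    then show ?thesis using poly_submodule_subset[of "{f}" d r] f by blast
  qed
  then show ?thesis by (simp add: generator_def tensor_poly_vscale[symmetric] of_vpoly_tensor_poly)
qed

lemma keys_tensor_poly:
  assumes "\<delta> \<in> keys (lookup (tensor_poly d r f) c)"
  obtains j \<alpha> where "c = 0" "j < r" "\<alpha> \<in> keys (lookup f j)" "\<delta> = \<alpha> + Poly_Mapping.single (d + j) 1"
proof -
  have c: "c = 0" using assms by (auto simp: lookup_tensor_poly split: if_splits)
  then have "\<delta> \<in> keys (\<Sum>j<r. Poly_Mapping.single (Poly_Mapping.single (d + j) 1) 1 * lookup f j)"
    using assms by (simp add: lookup_tensor_poly)
  then have "(\<Sum>j<r. lookup (Poly_Mapping.single (Poly_Mapping.single (d + j) 1) 1 * lookup f j) \<delta>) \<noteq> 0"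
    by (simp add: in_keys_iff lookup_sum)
  then obtain j where j: "j < r" "lookup (Poly_Mapping.single (Poly_Mapping.single (d + j) 1) 1 * lookup f j) \<delta> \<noteq> 0"
    by (meson lessThan_iff sum.not_neutral_contains_not_neutral)
  then obtain \<alpha> where \<alpha>: "\<delta> = \<alpha> + Poly_Mapping.single (d + j) 1"
    unfolding lookup_single_mult by (cases \<delta> "d + j" rule: mono_cases_single) auto
  then have "\<alpha> \<in> keys (lookup f j)"
    using j(2) unfolding lookup_single_mult by (simp add: in_keys_iff split: if_splits)
  with that c j \<alpha> show ?thesis by blast
qed

lemma tensor_poly_homogeneous:
  assumes f: "f \<in> homogeneous_vpolys d r n"
  shows "tensor_poly d r f \<in> homogeneous_vpolys (d + r) 1 (Suc n)"
proof -
  have "keys \<delta> \<subseteq> {..<d + r} \<and> mdeg \<delta> = Suc n" if "\<delta> \<in> keys (lookup (tensor_poly d r f) c)" for \<delta> c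
  proof -
    from that obtain j \<alpha> where *: "j < r" "\<alpha> \<in> keys (lookup f j)" "\<delta> = \<alpha> + Poly_Mapping.single (d + j) 1"
      by (rule keys_tensor_poly)
    then have "keys \<alpha> \<subseteq> {..<d}" "mdeg \<alpha> = n"
      using f by (auto simp: homogeneous_vpolys_def vpolys_def polys_def)
    with * show ?thesis by (auto simp: keys_add_mono mdeg_add)
  qed
  then show ?thesis
    by (auto simp: homogeneous_vpolys_def vpolys_def polys_def tensor_poly_def split: if_splits)
qed

text \<open>Every monomial of such a generator has degree at least 2 in the new variables, one from
  \<beta> and one from the polynomial, whereas the indices in question have degree exactly 1. This
  keeps the bidegree (n, 1) part of the ideal inside the image of the original module.\<close>

lemma proj_generator_tensor_poly_eq_0:
  assumes \<beta>: "\<not> keys \<beta> \<subseteq> {..<d}"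
  shows "proj (tensor_index d ` component d r n) (generator \<beta> (tensor_poly d r f)) = 0"
proof (rule proj_eq_zero, rule notI)
  fix k
  assume nz: "h2_coeff (generator \<beta> (tensor_poly d r f)) k \<noteq> 0" and "k \<in> tensor_index d ` component d r n"
  then obtain \<alpha> j where k: "k = (\<alpha> + Poly_Mapping.single (d + j) 1, 0)" and \<alpha>: "keys \<alpha> \<subseteq> {..<d}"
    by (auto simp: tensor_index_def component_def)
  from nz obtain \<delta> where \<delta>: "\<alpha> + Poly_Mapping.single (d + j) 1 = \<beta> + \<delta>" "\<delta> \<in> keys (lookup (tensor_poly d r f) 0)"
    unfolding k by (rule h2_coeff_generator_nonzero)
  obtain i \<gamma> where \<gamma>: "\<delta> = \<gamma> + Poly_Mapping.single (d + i) 1" using \<delta>(2) by (rule keys_tensor_poly)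
  obtain l where l: "l \<in> keys \<beta>" "d \<le> l" using \<beta> by (meson lessThan_iff not_less subsetI)
  have eq: "lookup \<beta> m + (lookup \<gamma> m + (if m = d + i then 1 else 0)) = (if m = d + j then 1 else 0)"
    if "d \<le> m" for m
    using arg_cong[OF \<delta>(1), of "\<lambda>a. lookup a m"] lookup_tensor_index[OF \<alpha> that, of j]
    by (simp add: \<gamma> lookup_add lookup_single when_def eq_commute)
  \<comment> \<open>At l the exponents force l = d + j and i distinct from j; at d + i the left side
    is then at least 1 and the right side is 0.\<close>
  have "lookup \<beta> l \<noteq> 0" using l(1) by (simp add: in_keys_iff)
  then show False using eq[OF l(2)] eq[of "d + i"] l(2) by (auto split: if_splits)
qed

lemma tensor_component_shift:
  assumes i: "i < d"
  shows "(\<gamma> + Poly_Mapping.single i 1, c) \<in> tensor_index d ` component d r (Suc n)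
      \<longleftrightarrow> (\<gamma>, c) \<in> tensor_index d ` component d r n"
    and "(\<gamma> + Poly_Mapping.single i 1, c) \<notin> tensor_index d ` component d r 0"
proof -
  let ?e = "Poly_Mapping.single i 1 :: mono"
  have comm: "\<alpha> + ?e + Poly_Mapping.single (d + j) 1 = \<alpha> + Poly_Mapping.single (d + j) 1 + ?e" for \<alpha> j
    by (simp only: add.assoc add.commute[of ?e])
  have pred: "\<exists>\<alpha>' j. (\<alpha>' + ?e, j) \<in> component d r m \<and> (\<gamma>, c) = tensor_index d (\<alpha>', j)"
    if mem: "(\<gamma> + ?e, c) \<in> tensor_index d ` component d r m" for m
  proof -
    obtain \<alpha> j where \<alpha>: "(\<alpha>, j) \<in> component d r m" "\<gamma> + ?e = \<alpha> + Poly_Mapping.single (d + j) 1" "c = 0"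
      using mem by (auto simp: tensor_index_def)
    \<comment> \<open>The variable i is old, so it already divides \<alpha> and can be removed
      before the new variable is attached.\<close>
    have "lookup (\<gamma> + ?e) i = lookup \<alpha> i" unfolding \<alpha>(2) using i by (simp add: lookup_add lookup_single)
    then have "lookup \<alpha> i \<noteq> 0" by (simp add: lookup_add)
    then obtain \<alpha>' where \<alpha>': "\<alpha> = \<alpha>' + ?e" by (cases \<alpha> i rule: mono_cases_single) auto
    have "\<gamma> = \<alpha>' + Poly_Mapping.single (d + j) 1"
      using \<alpha>(2) unfolding \<alpha>' comm by (simp only: add_right_cancel)
    with \<alpha>(1,3) \<alpha>' show ?thesis by (auto simp: tensor_index_def)
  qed
  show "(\<gamma> + ?e, c) \<in> tensor_index d ` component d r (Suc n) \<longleftrightarrow> (\<gamma>, c) \<in> tensor_index d ` component d r n"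
  proof
    assume "(\<gamma> + ?e, c) \<in> tensor_index d ` component d r (Suc n)"
    from pred[OF this] show "(\<gamma>, c) \<in> tensor_index d ` component d r n"
      unfolding component_shift(1)[OF i] by blast
  next
    assume "(\<gamma>, c) \<in> tensor_index d ` component d r n"
    then obtain \<alpha> j where \<alpha>: "(\<alpha>, j) \<in> component d r n" "(\<gamma>, c) = tensor_index d (\<alpha>, j)" by auto
    then have "(\<gamma> + ?e, c) = tensor_index d (\<alpha> + ?e, j)"
      by (simp only: tensor_index_def split_conv prod.inject comm)
    moreover have "(\<alpha> + ?e, j) \<in> component d r (Suc n)" using \<alpha>(1) component_shift(1)[OF i] by blast
    ultimately show "(\<gamma> + ?e, c) \<in> tensor_index d ` component d r (Suc n)" by blast
  qed
  show "(\<gamma> + ?e, c) \<notin> tensor_index d ` component d r 0"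
    using pred[of 0] component_shift(2)[OF i] by blast
qed

section \<open>Comparison of the linear submodule with the quadratic ideal\<close>

lemma csubspace_equalizer:
  assumes "bounded_linear \<phi>" "bounded_linear \<psi>"
    and "\<And>c x. \<phi> (c *\<^sub>C x) = c * \<phi> x" "\<And>c x. \<psi> (c *\<^sub>C x) = c * (\<psi> x :: complex)"
  shows "csubspace {x. \<phi> x = \<psi> x}"
proof -
  have "closed {x. \<phi> x = \<psi> x}"
    by (intro closed_Collect_eq linear_continuous_on assms)
  moreover have "h2.subspace {x. \<phi> x = \<psi> x}"
    using bounded_linear.linear[OF assms(1)] bounded_linear.linear[OF assms(2)]
    by (intro h2.subspaceI) (simp_all add: linear_0 linear_add assms)
  ultimately show ?thesis by (simp add: csubspace_def)
qed

lemma summable_component_powr: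
  assumes p: "real d + 1 < p"
  shows "summable (\<lambda>n. real (card (component d r n)) * (1 / real (Suc n)) powr p)"
proof (rule summable_comparison_test')
  have "summable (\<lambda>n. real n powr (real d - p))"
    using p by (simp add: summable_real_powr_iff)
  then have "summable (\<lambda>n. real (Suc n) powr (real d - p))"
    by (subst summable_Suc_iff)
  then show "summable (\<lambda>n. real r * real (Suc n) powr (real d - p))" by (rule summable_mult)
  fix n :: nat
  have inv: "(1 / real (Suc n)) powr p = real (Suc n) powr (- p)"
    by (simp add: powr_minus_divide powr_divide)
  have "real (card (component d r n)) \<le> real (r * Suc n ^ d)"
    using card_component_le by (rule of_nat_mono)
  also have "\<dots> = real r * real (Suc n) powr real d" by (simp add: powr_realpow)
  finally have "real (card (component d r n)) * (1 / real (Suc n)) powr p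
      \<le> real r * real (Suc n) powr real d * (1 / real (Suc n)) powr p"
    by (rule mult_right_mono) simp
  also have "\<dots> = real r * real (Suc n) powr (real d - p)"
    unfolding inv by (simp only: mult.assoc powr_add[symmetric] diff_conv_add_uminus)
  finally show "norm (real (card (component d r n)) * (1 / real (Suc n)) powr p)
      \<le> real r * real (Suc n) powr (real d - p)" by simp
qed

text \<open>The constant 2 collects one error of at most 1 / (n + 1) from each of the two products
  in the commutator. Only \<open>i\<close> and \<open>j\<close> below \<open>d\<close> occur, so all
  operators respect the degree in the new variables.\<close>

lemma comparison_linear_quadratic:
  assumes F: "F \<subseteq> homogeneous_vpolys d r 1" and ij: "i < d" "j < d"
  defines "N \<equiv> generated_submodule (d + r) (tensor_poly d r ` F)"
  shows "comparison (generated_submodule d F) (component d r) (cross_commutator (generated_submodule d F) i j)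
    N (\<lambda>n. tensor_index d ` component d r n) (cross_commutator N i j) (tensor_map d r) 2"
proof -
  define M where "M = generated_submodule d F"
  define W where "W = tensor_map d r"
  define \<kappa> where "\<kappa> = component d r"
  define \<mu> where "\<mu> n = tensor_index d ` component d r n" for n
  have vp: "f \<in> vpolys d r" if "f \<in> F" for f
    using F that by (auto simp: homogeneous_vpolys_def)
  have gen_W: "generator \<beta> (tensor_poly d r f) = W (generator \<beta> f)" if "keys \<beta> \<subseteq> {..<d}" "f \<in> F" for \<beta> f
    unfolding W_def using generator_tensor_poly[OF vp that(1)] that(2) by blast
  have W_add: "W (x + y) = W x + W y" and W_scale: "W (c *\<^sub>C x) = c *\<^sub>C W x" for x y c
    by (simp_all add: W_def tensor_map_add tensor_map_scaleC)
  have W0: "W 0 = 0" using W_add[of 0 0] by simp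
  have proj_W: "proj (\<mu> n) (W x) = W (proj (\<kappa> n) x)" for n x
    unfolding \<mu>_def W_def \<kappa>_def by (rule proj_tensor_map)
  have W_Z: "W (Z k x) = Z k (W x)" if "k < d" for k x
    unfolding W_def by (rule tensor_map_Z[OF that])
  have csM: "csubspace M" and csN: "csubspace N"
    by (simp_all add: M_def N_def csubspace_generated_submodule)

  interpret A: shift_graded M \<kappa> d
    unfolding M_def \<kappa>_def by (rule shift_graded_linear[OF F])

  have W_mem: "W x \<in> N" if "x \<in> M" for x
  proof -
    have "M \<subseteq> {x. W x \<in> N}"
      unfolding M_def
    proof (rule generated_submodule_minimal)
      show "csubspace {x. W x \<in> N}"
        by (rule csubspace_vimage[OF csN _ W_scale]) (simp add: W_def bounded_linear_tensor_map)
      have "W (generator \<alpha> f) \<in> N" if "keys \<alpha> \<subseteq> {..<d}" "f \<in> F" for \<alpha> f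
        unfolding gen_W[OF that, symmetric] N_def using that by (intro generator_mem) auto
      then show "generators d F \<subseteq> {x. W x \<in> N}" by (auto simp: generators_def)
    qed
    with that show ?thesis by blast
  qed

  interpret B: shift_graded N \<mu> d
  proof
    show "csubspace N" by (rule csN)
    show "finite (\<mu> n)" for n unfolding \<mu>_def by (intro finite_imageI finite_component)
    show "\<mu> m \<inter> \<mu> n = {}" if "m \<noteq> n" for m n
      unfolding \<mu>_def
      using inj_on_image_Int[OF inj_on_tensor_index component_subset_vindices component_subset_vindices,
          of d r m n] component_disjoint[OF that] by simp
    show "Z k x \<in> N" if "k < d" "x \<in> N" for k x
      using that unfolding N_def by (intro Z_generated_submodule) auto
    show "proj (\<mu> (Suc n)) (Z k x) = Z k (proj (\<mu> n) x)" if "k < d" for k n x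
      unfolding \<mu>_def by (rule proj_Z) (rule tensor_component_shift(1)[OF that])
    show "proj (\<mu> 0) (Z k x) = 0" if "k < d" for k x
    proof -
      have "proj (\<mu> 0) (Z k x) = Z k (proj {} x)"
        unfolding \<mu>_def by (rule proj_Z) (use tensor_component_shift(2)[OF that] in blast)
      then show ?thesis by (simp add: A.Z_zero_arg)
    qed
    fix x n
    assume x: "x \<in> N"
    have "N \<subseteq> {x. proj (\<mu> n) x \<in> N}"
      unfolding N_def
    proof (rule generated_submodule_minimal)
      show "csubspace {x. proj (\<mu> n) x \<in> generated_submodule (d + r) (tensor_poly d r ` F)}"
        by (intro csubspace_vimage csubspace_generated_submodule bounded_linear_proj proj_scaleC)
      \<comment> \<open>Without new variables in \<beta> the generator is the \<open>W\<close>-image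
        of one in \<open>M\<close>, where the projection is known to stay; with new variables the
        projection is 0.\<close>
      have "proj (\<mu> n) (generator \<beta> (tensor_poly d r f)) \<in> N" if f: "f \<in> F" for \<beta> f
      proof (cases "keys \<beta> \<subseteq> {..<d}")
        case True
        have "generator \<beta> f \<in> M" unfolding M_def by (rule generator_mem[OF True f])
        then show ?thesis unfolding gen_W[OF True f] proj_W by (intro W_mem A.proj_mem)
      next
        case False
        then show ?thesis
          unfolding \<mu>_def by (simp add: proj_generator_tensor_poly_eq_0 csubspaceD[OF csN])
      qed
      then show "generators (d + r) (tensor_poly d r ` F)
          \<subseteq> {x. proj (\<mu> n) x \<in> generated_submodule (d + r) (tensor_poly d r ` F)}"
        by (auto simp: generators_def N_def)
    qed
    with x show "proj (\<mu> n) x \<in> N" by blast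
  qed

  have W_block: "W x \<in> B.block n" if "x \<in> A.block n" for x n
    using that W_mem by (simp add: A.block_def B.block_def proj_W)
  have cinner_W: "cinner (W x) (W y) = cinner x y / of_nat (Suc n)"
    if "x \<in> A.block n" "y \<in> A.block n" for x y n
    using A.blockD(2)[OF that(1)] A.blockD(2)[OF that(2)] unfolding W_def \<kappa>_def
    by (rule cinner_tensor_map)

  \<comment> \<open>Passing through \<open>Z k\<close> in \<open>M\<close> compares the scaling 1 /
    (n + 1) of degree n with the scaling 1 / n of degree n - 1. In degree 0 both sides
    vanish.\<close>
  have adj_W: "adj_on N (Z k) (W y) = (of_nat n / of_nat (Suc n)) *\<^sub>C W (adj_on M (Z k) y)"
    if y: "y \<in> A.block n" and k: "k < d" for y n k
  proof (cases n)
    case 0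
    then show ?thesis using B.adj_Z_block_0[OF k] W_block y by simp
  next
    case (Suc m)
    let ?v = "adj_on M (Z k) y"
    have yM: "y \<in> M" using A.blockD(1)[OF y] .
    have v: "?v \<in> A.block m" using A.adj_Z_block[OF k] y Suc by simp
    have Wy: "W y \<in> B.block (Suc m)" and Wv: "W ?v \<in> B.block m" using W_block y v Suc by auto
    define w where "w = (of_nat n / of_nat (Suc n)) *\<^sub>C W ?v"
    \<comment> \<open>The adjoint is taken in \<open>N\<close>, so the candidate \<open>w\<close>
      has to be tested against all of \<open>N\<close> and not just against the image of
      \<open>W\<close>; by linearity and continuity the generators suffice.\<close>
    have "N \<subseteq> {x. cinner (Z k x) (W y) = cinner x w}"
      unfolding N_def
    proof (rule generated_submodule_minimal)
      show "csubspace {x. cinner (Z k x) (W y) = cinner x w}"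
      proof (rule csubspace_equalizer)
        show "bounded_linear (\<lambda>x. cinner (Z k x) (W y))"
          by (rule bounded_linear_compose[OF bounded_linear_cinner_left bounded_linear_Z])
        show "bounded_linear (\<lambda>x. cinner x w)" by (rule bounded_linear_cinner_left)
      qed (simp_all add: Z_scaleC cinner_scaleC_left)
      have "cinner (Z k (generator \<beta> (tensor_poly d r f))) (W y) = cinner (generator \<beta> (tensor_poly d r f)) w"
        if f: "f \<in> F" for \<beta> f
      \<comment> \<open>The condition says that the generator has bidegree (m, 1). Every other
        generator has no coefficient in that bidegree and is orthogonal to both test
        vectors.\<close>
      proof (cases "keys \<beta> \<subseteq> {..<d} \<and> m = Suc (mdeg \<beta>)")
        case True
        let ?g = "generator \<beta> f"
        have "?g \<in> M" "proj (\<kappa> m) ?g = ?g"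
          using True f proj_generator[OF F, of \<beta> f m] generator_mem[of \<beta> d f F]
          by (simp_all add: \<kappa>_def M_def)
        then have g: "?g \<in> A.block m" by (simp add: A.block_def)
        have "cinner (Z k (W ?g)) (W y) = cinner (Z k ?g) y / of_nat (Suc (Suc m))"
          unfolding W_Z[OF k, symmetric] using A.Z_block[OF k g] y Suc by (intro cinner_W) auto
        also have "cinner (Z k ?g) y = cinner ?g ?v"
          by (rule cinner_adj_on[OF csM A.bounded_on_Z[OF k] yM A.blockD(1)[OF g]])
        also have "\<dots> = of_nat (Suc m) * cinner (W ?g) (W ?v)"
          unfolding cinner_W[OF g v] by (simp del: of_nat_Suc)
        also have "\<dots> / of_nat (Suc (Suc m)) = cinner (W ?g) w"
          unfolding w_def cinner_scaleC_right Suc by (simp del: of_nat_Suc)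
        finally show ?thesis using gen_W f True by simp
      next
        case False
        let ?x = "generator \<beta> (tensor_poly d r f)"
        have x0: "proj (\<mu> m) ?x = 0"
        proof (cases "keys \<beta> \<subseteq> {..<d}")
          case True
          then show ?thesis
            using False f proj_generator[OF F True f, of m] by (simp add: gen_W proj_W W0 \<kappa>_def)
        next
          case False
          then show ?thesis unfolding \<mu>_def by (rule proj_generator_tensor_poly_eq_0)
        qed
        have "cinner (Z k ?x) (W y) = cinner (Z k ?x) (proj (\<mu> (Suc m)) (W y))"
          using B.blockD(2)[OF Wy] by simp
        also have "\<dots> = 0"
          by (simp add: cinner_proj_left[symmetric] B.proj_Suc_Z[OF k] x0 A.Z_zero_arg)
        finally have "cinner (Z k ?x) (W y) = 0" .
        moreover have "cinner ?x (W ?v) = 0"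
          using cinner_proj_left[of "\<mu> m" ?x "W ?v"] by (simp add: x0 B.blockD(2)[OF Wv])
        ultimately show ?thesis by (simp add: w_def cinner_scaleC_right)
      qed
      then show "generators (d + r) (tensor_poly d r ` F) \<subseteq> {x. cinner (Z k x) (W y) = cinner x w}"
        by (auto simp: generators_def)
    qed
    moreover have "w \<in> N"
      unfolding w_def using B.blockD(1)[OF Wv] by (intro csubspaceD(6)[OF csN])
    ultimately have "adj_on N (Z k) (W y) = w"
      using B.blockD(1)[OF Wy] by (intro adj_on_eqI[OF csN B.bounded_on_Z[OF k]]) auto
    then show ?thesis by (simp add: w_def)
  qed

  have close: "norm (W (cross_commutator M i j x) - cross_commutator N i j (W x)) \<le> 2 / real (Suc n) * norm (W x)"
    if x: "x \<in> A.block n" for x n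
  proof -
    define u where "u = Z i (adj_on M (Z j) x)"
    define v where "v = adj_on M (Z j) (Z i x)"
    have xM: "x \<in> M" by (rule A.blockD(1)[OF x])
    have u: "u \<in> A.block n"
    proof (cases n)
      case 0
      then show ?thesis
        using A.adj_Z_block_0[OF ij(2)] x csubspaceD(1)[OF A.csubspace_block]
        by (simp add: u_def A.Z_zero_arg)
    next
      case (Suc m)
      then show ?thesis unfolding u_def using x by (simp add: A.Z_block A.adj_Z_block ij)
    qed
    have v: "v \<in> A.block n" unfolding v_def using x by (intro A.adj_Z_block A.Z_block ij)
    \<comment> \<open>In the first product the adjoint acts on \<open>x\<close> in degree n, in the
      second on \<open>Z i x\<close> in degree n + 1. Hence the two defects 1 - a and 1 - b are 1 /
      (n + 1) and 1 / (n + 2).\<close>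
    define a b :: complex where "a = of_nat n / of_nat (Suc n)" and "b = of_nat (Suc n) / of_nat (Suc (Suc n))"
    have "Z i (adj_on N (Z j) (W x)) = a *\<^sub>C W u"
      unfolding adj_W[OF x ij(2)] u_def Z_scaleC W_Z[OF ij(1)] a_def ..
    moreover have "adj_on N (Z j) (Z i (W x)) = b *\<^sub>C W v"
      using adj_W[OF A.Z_block[OF ij(1) x] ij(2)] unfolding W_Z[OF ij(1)] b_def v_def .
    ultimately have "cross_commutator N i j (W x) = a *\<^sub>C W u - b *\<^sub>C W v"
      by (simp only: cross_commutator_def)
    moreover have "W (cross_commutator M i j x) = W u - W v"
      using W_add[of "u - v" v] by (simp add: cross_commutator_def u_def v_def)
    moreover have "W u - W v - (a *\<^sub>C W u - b *\<^sub>C W v) = (1 - a) *\<^sub>C W u - (1 - b) *\<^sub>C W v"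
      by (simp add: h2.scale_left_diff_distrib)
    moreover have "1 - a = of_real (1 / real (Suc n))" "1 - b = of_real (1 / real (Suc (Suc n)))"
      by (simp_all add: a_def b_def field_simps del: of_nat_Suc) simp_all
    ultimately have eq: "W (cross_commutator M i j x) - cross_commutator N i j (W x)
        = of_real (1 / real (Suc n)) *\<^sub>C W u - of_real (1 / real (Suc (Suc n))) *\<^sub>C W v"
      by simp
    \<comment> \<open>Within one block \<open>W\<close> scales all norms by the same factor, so a
      comparison of norms in \<open>M\<close> survives under \<open>W\<close>.\<close>
    have norm_W: "norm (W y) \<le> norm (W x)" if "y \<in> A.block n" "norm y \<le> norm x" for y
    proof -
      have sq: "(norm (W z))\<^sup>2 = (norm z)\<^sup>2 / real (Suc n)" if "z \<in> A.block n" for z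
      proof -
        have "complex_of_real ((norm (W z))\<^sup>2) = of_real ((norm z)\<^sup>2 / real (Suc n))"
          using cinner_W[OF that that] unfolding cinner_self_norm by simp
        then show ?thesis using of_real_eq_iff by blast
      qed
      have "(norm (W y))\<^sup>2 \<le> (norm (W x))\<^sup>2"
        unfolding sq[OF that(1)] sq[OF x] using that(2) by (intro divide_right_mono power_mono) auto
      then show ?thesis by (rule power2_le_imp_le) simp
    qed
    have "norm u \<le> norm x"
      unfolding u_def using norm_Z_le A.norm_adj_Z_le[OF ij(2) xM] order_trans by blast
    then have nu: "norm (W u) \<le> norm (W x)" by (rule norm_W[OF u])
    have "norm v \<le> norm x"
      unfolding v_def using norm_Z_le A.norm_adj_Z_le[OF ij(2) A.Z_mem[OF ij(1) xM]] order_trans by blast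
    then have nv: "norm (W v) \<le> norm (W x)" by (rule norm_W[OF v])
    have "norm (W (cross_commutator M i j x) - cross_commutator N i j (W x))
        \<le> 1 / real (Suc n) * norm (W u) + 1 / real (Suc (Suc n)) * norm (W v)"
      unfolding eq by (rule order_trans[OF norm_triangle_ineq4]) (simp add: norm_scaleC norm_divide del: of_nat_Suc)
    also have "\<dots> \<le> 1 / real (Suc n) * norm (W x) + 1 / real (Suc n) * norm (W x)"
      using nu nv by (intro add_mono mult_mono) (auto simp: field_simps)
    finally show ?thesis by simp
  qed

  interpret A': graded_operator M \<kappa> "cross_commutator M i j"
    by (rule A.graded_operator_cross_commutator[OF ij])
  interpret A'': full_graded_operator M \<kappa> "cross_commutator M i j"
    by unfold_locales (simp add: M_def \<kappa>_def proj_Union_component[OF F])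
  interpret B': graded_operator N \<mu> "cross_commutator N i j"
    by (rule B.graded_operator_cross_commutator[OF ij])
  have "comparison M \<kappa> (cross_commutator M i j) N \<mu> (cross_commutator N i j) W 2"
  proof
    show "W (a *\<^sub>C x) = a *\<^sub>C W x" for a x by (rule W_scale)
    show "W x \<in> B.block n" if "x \<in> A.block n" for x n by (rule W_block[OF that])
    show "cinner (W x) (W y) = cinner x y / of_nat (Suc n)"
      if "x \<in> A.block n" "y \<in> A.block n" for x y n by (rule cinner_W[OF that])
    show "norm (W (cross_commutator M i j x) - cross_commutator N i j (W x)) \<le> 2 / real (Suc n) * norm (W x)"
      if "x \<in> A.block n" for x n by (rule close[OF that])
  qed simp
  moreover have "\<mu> = (\<lambda>n. tensor_index d ` component d r n)" by (simp add: fun_eq_iff \<mu>_def)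
  ultimately show ?thesis unfolding M_def \<kappa>_def W_def by (simp only:)
qed

theorem mainTheorem3:
  shows
    "((\<forall>d\<ge>1. \<forall>F \<subseteq> homogeneous_vpolys d 1 2. \<forall>p>real d.
         p_essentially_normal p d (generated_submodule d F))
      \<longrightarrow>
      (\<forall>d\<ge>1. \<forall>r\<ge>1. \<forall>F \<subseteq> homogeneous_vpolys d r 1. \<forall>p>real (d + r).
         p_essentially_normal p d (generated_submodule d F)))
     \<and>
     ((\<forall>d\<ge>1. \<forall>F \<subseteq> homogeneous_vpolys d 1 2.
         essentially_normal d (generated_submodule d F))
      \<longrightarrow>
      (\<forall>d\<ge>1. \<forall>r\<ge>1. \<forall>F \<subseteq> homogeneous_vpolys d r 1.
         essentially_normal d (generated_submodule d F)))"
proof -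
  \<comment> \<open>The new variable adds 1 to the degree of a linear polynomial.\<close>
  have quadratic: "tensor_poly d r ` F \<subseteq> homogeneous_vpolys (d + r) 1 2"
    if "F \<subseteq> homogeneous_vpolys d r 1" for d r F
    using that tensor_poly_homogeneous[of _ d r 1] by (auto simp: numeral_2_eq_2)
  show ?thesis
  proof (intro conjI impI allI)
    fix d r :: nat and F :: "vpoly set" and p :: real
    assume hyp: "\<forall>d\<ge>1. \<forall>F \<subseteq> homogeneous_vpolys d 1 2. \<forall>p>real d.
        p_essentially_normal p d (generated_submodule d F)"
      and d: "1 \<le> d" and r: "1 \<le> r" and F: "F \<subseteq> homogeneous_vpolys d r 1" and p: "real (d + r) < p"
    let ?N = "generated_submodule (d + r) (tensor_poly d r ` F)"
    \<comment> \<open>The ideal lives in d + r variables, which is the origin of the bound p > d +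
      r.\<close>
    have N: "p_essentially_normal p (d + r) ?N"
      using hyp[rule_format, of "d + r"] quadratic[OF F] d p by simp
    show "p_essentially_normal p d (generated_submodule d F)"
      unfolding p_essentially_normal_def
    proof (intro allI impI)
      fix i j
      assume ij: "i < d" "j < d"
      interpret comparison "generated_submodule d F" "component d r"
          "cross_commutator (generated_submodule d F) i j"
          ?N "\<lambda>n. tensor_index d ` component d r n" "cross_commutator ?N i j" "tensor_map d r" 2
        by (rule comparison_linear_quadratic[OF F ij])
      show "schatten_on p (generated_submodule d F) (cross_commutator (generated_submodule d F) i j)"
      proof (rule schatten_on_transfer)
        show "schatten_on p ?N (cross_commutator ?N i j)"
          using N ij by (simp add: p_essentially_normal_def)
        \<comment> \<open>Both d and r are at least 1, so p > d + r gives the exponent required for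
          Jensen; the summability below uses d + r \<ge> d + 1.\<close>
        show "2 \<le> p" using d r p by linarith
        show "summable (\<lambda>n. real (card (component d r n)) * (1 / real (Suc n)) powr p)"
          using r p by (intro summable_component_powr) linarith
      qed
    qed
  next
    fix d r :: nat and F :: "vpoly set"
    assume hyp: "\<forall>d\<ge>1. \<forall>F \<subseteq> homogeneous_vpolys d 1 2. essentially_normal d (generated_submodule d F)"
      and d: "1 \<le> d" and F: "F \<subseteq> homogeneous_vpolys d r 1"
    let ?N = "generated_submodule (d + r) (tensor_poly d r ` F)"
    have N: "essentially_normal (d + r) ?N"
      using hyp[rule_format, of "d + r"] quadratic[OF F] d by simp
    show "essentially_normal d (generated_submodule d F)"
      unfolding essentially_normal_def
    proof (intro allI impI)
      fix i j
      assume ij: "i < d" "j < d"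
      interpret comparison "generated_submodule d F" "component d r"
          "cross_commutator (generated_submodule d F) i j"
          ?N "\<lambda>n. tensor_index d ` component d r n" "cross_commutator ?N i j" "tensor_map d r" 2
        by (rule comparison_linear_quadratic[OF F ij])
      show "compact_on (generated_submodule d F) (cross_commutator (generated_submodule d F) i j)"
        using N ij by (intro compact_on_transfer) (simp add: essentially_normal_def)
    qed
  qed
qed

end
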